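(* Let $X=(X_1,\ldots,X_N)$ be a family of independent random variables with $X_k$ taking values in a set $\Lambda_k$, let $f:\prod_{j\in[N]}\Lambda_j\to\mathbb{R}$ be a function and $\mu=\mathbb{E}f(X)$. Fix any query strategy for $f$, let $\mathcal{Q}$ be its collection of query sets, and let $\gamma\in(0,1]$. Let $\phi(x)=(1+x)\log(1+x)-x$. Then the following hold. (1) Suppose there are numbers $(c_k)_{k\in[N]}$ such that $|f(x)-f(\tilde x)|\le c_k$ whenever $x,\tilde x\in\prod_{j\in[N]}\Lambda_j$ differ only in the $k$-th coordinate. Then for any $t\ge0$: (1a) $\mathbb{P}(f(X)\ge\mu+t)\le\exp\left(-\dfrac{2t^2}{\max_{Q\in\mathcal{Q}}\sum_{k\in Q}c_k^2}\right)$. (1b) If $\Lambda_k=\{0,1\}$ and $p_k=\mathbb{P}(X_k=1)$ for all $k$, then with $C=\max_{Q\in\mathcal{Q}}\max_{k\in Q}c_k$ and $V=\max_{Q\in\mathcal{Q}}\sum_{k\in Q}(1-p_k)p_kc_k^2$ we have $\mathbb{P}(f(X)\ge\mu+t)\le e^{-t^2/(2V+2Ct/3)}$, and this bound may be improved to $e^{-\frac{V}{C^2}\phi(Ct/V)}$ (whenever $V,C>0$). (1c) If $\max_{\eta\in\Lambda_k}\mathbb{P}(X_k=\eta)\ge1-p_k$ for all $k$, then $\mathbb{P}(f(X)\ge\mu+t)\le e^{-t^2/(2V'+2Ct/3)}$ with $V'=\max_{Q\in\mathcal{Q}}\sum_{k\in Q}p_kc_k^2$ and $C=\max_{Q\in\mathcal{Q}}\max_{k\in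 Q}c_k$. (2) Let $\Gamma\subseteq\prod_{j\in[N]}\Lambda_j$ be an event and let $(c_k)_{k\in[N]}$, $(d_k)_{k\in[N]}$ be numbers with $c_k\le d_k$. Suppose that one of the following holds: (i) whenever $x,\tilde x\in\prod_{j\in[N]}\Lambda_j$ differ only in the $k$-th coordinate, $|f(x)-f(\tilde x)|\le c_k$ if $x\in\Gamma$ and $|f(x)-f(\tilde x)|\le d_k$ otherwise; in this case set $e_k=\gamma(d_k-c_k)$; (ii) whenever $x,\tilde x\in\prod_{j\in[N]}\Lambda_j$ differ only in the $k$-th coordinate, $|f(x)-f(\tilde x)|\le c_k$ if $x,\tilde x\in\Gamma$ and $|f(x)-f(\tilde x)|\le d_k$ otherwise, and $\min_{\eta\in\Lambda_k}\mathbb{P}(X_k=\eta)\ge q_k>0$ for all $k$; in this case set $e_k=2\gamma(d_k-c_k)q_k^{-1}$. Then there is an event $\mathcal{B}$ (depending on $\Gamma$, $\gamma$ and the query strategy) satisfying $\mathbb{P}(\mathcal{B})\le\max_{Q\in\mathcal{Q}}\sum_{k\in Q}\gamma^{-1}\cdot\mathbb{P}(X\notin\Gamma)$ and $\neg\mathcal{B}\subseteq\Gamma$ such that, with $C=\max_{Q\in\mathcal{Q}}\max_{k\in Q}(c_k+e_k)$, for any $t\ge0$: (2a) $\mathbb{P}(f(X)\ge\mu+t\text{ and }\neg\mathcal{B})\le\exp\left(-\dfrac{t^2}{2\max_{Q\in\mathcal{Q}}\sum_{k\in Q}(c_k+e_k)^2}\right)$; if $|\Lambda_k|=2$ for all $k$,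 the exponent may be multiplied by a factor of $4$. (2b) If $\Lambda_k=\{0,1\}$ and $p_k=\mathbb{P}(X_k=1)$ for all $k$, then with $V=\max_{Q\in\mathcal{Q}}\sum_{k\in Q}(1-p_k)p_k(c_k+e_k)^2$ we have $\mathbb{P}(f(X)\ge\mu+t\text{ and }\neg\mathcal{B})\le e^{-t^2/(2V+2Ct/3)}$, and this bound may be improved to $e^{-\frac{V}{C^2}\phi(Ct/V)}$ (whenever $V,C>0$). (2c) If $\max_{\eta\in\Lambda_k}\mathbb{P}(X_k=\eta)\ge1-p_k$ with $p_k\in[0,1)$ for all $k$, then $\mathbb{P}(f(X)\ge\mu+t\text{ and }\neg\mathcal{B})\le e^{-t^2/(2V'+2Ct/3)}$ with $V'=\max_{Q\in\mathcal{Q}}\sum_{k\in Q}p_k\left(c_k+e_k(1-p_k)^{-1}\right)^2$. (3) Let $\Gamma_k\subseteq\Lambda_k$ ($k\in[N]$) and $\Gamma\subseteq\prod_{j\in[N]}\Gamma_j$ be events, and let $(c_k)_{k\in[N]}$, $(d_k)_{k\in[N]}$ be numbers with $c_k\le d_k$ such that for all $x,\tilde x\in\prod_{j\in[N]}\Gamma_j$ that differ only in the $k$-th coordinate, $|f(x)-f(\tilde x)|\le c_k$ if $x\in\Gamma$ and $|f(x)-f(\tilde x)|\le d_k$ otherwise. Suppose also that $|f(x)-f(\tilde x)|\le s$ for all $x,\tilde x\in\prod_{j\in[N]}\Lambda_j$. Set $\Delta=s\,\mathbb{P}(X\notin\Gamma)$ and $e_k=\gamma(d_k-c_k)$. Then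 there is an event $\mathcal{B}$ (depending on $\Gamma$, $\gamma$ and the query strategy) satisfying $\mathbb{P}(\mathcal{B})\le\max_{Q\in\mathcal{Q}}\sum_{k\in Q}\gamma^{-1}\cdot\mathbb{P}(X\notin\Gamma)$ and $\neg\mathcal{B}\subseteq\Gamma$ such that for any $t\ge0$ $$\mathbb{P}(f(X)\ge\mu+t+\Delta\text{ and }\neg\mathcal{B})\le\exp\left(-\frac{t^2}{2\max_{Q\in\mathcal{Q}}\sum_{k\in Q}(c_k+e_k)^2}\right).$$ If $\Gamma=\prod_{j\in[N]}\Gamma_j$, then one may set $\mathcal{B}=\neg\Gamma$, $e_k=0$ and multiply the exponent by a factor of $4$. Moreover, one may set $\Delta=0$ if $f(x)\ge f(\tilde x)$ whenever $x,\tilde x\in\prod_{j\in[N]}\Lambda_j$ differ only in their $k$-th coordinates $x_k\in\Lambda_k\setminus\Gamma_k$ and $\tilde x_k\in\Gamma_k$.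
   Context: $[N]=\{1,\ldots,N\}$. Each $\Lambda_k$ is a measurable space; events and functions are measurable. Events are identified with subsets of $\prod_{j\in[N]}\Lambda_j$; $\mathbb{P}(\mathcal{B})=\mathbb{P}(X\in\mathcal{B})$ and $\neg\mathcal{B}$ is the complement. Query strategy: a strategy sequentially exposes the values $X_{q_1},X_{q_2},\ldots$ of distinct coordinates, where each index $q_i=q_i(X_{q_1},\ldots,X_{q_{i-1}})\in[N]$ may depend on the previous outcomes and indices (so $q_1$ is fixed), until the value of $f(X)$ is determined by the exposed values; by convention $q_{k+1}=q_k$ if $f(X)$ is determined by $(X_{q_1},\ldots,X_{q_k})$ with $k<N$, i.e. no new coordinates are exposed from then on. (A strategy is a decision tree computing $f$.) For every possible outcome of $X$ the set of queried indices is $Q=\{q_1,q_2,\ldots\}\subseteq[N]$, and $\mathcal{Q}$ denotes the set of all possible such query sets $Q$. *)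

theory Defs
  imports "HOL-Probability.Probability"
begin

(* The product of the spaces \<Lambda> 1, ..., \<Lambda> N, as a set of points; it is the space of the
   product sigma-algebra PiM {1..N} \<Lambda>. *)
definition outcomes :: "nat \<Rightarrow> (nat \<Rightarrow> 'a measure) \<Rightarrow> (nat \<Rightarrow> 'a) set" where
  "outcomes N \<Lambda> = (\<Pi>\<^sub>E j\<in>{1..N}. space (\<Lambda> j))"

definition differ_only_in :: "nat \<Rightarrow> nat \<Rightarrow> (nat \<Rightarrow> 'a) \<Rightarrow> (nat \<Rightarrow> 'a) \<Rightarrow> bool" where
  "differ_only_in N k x y \<longleftrightarrow> x k \<noteq> y k \<and> (\<forall>j\<in>{1..N} - {k}. x j = y j)"

definition determined_by ::
  "nat \<Rightarrow> (nat \<Rightarrow> 'a measure) \<Rightarrow> ((nat \<Rightarrow> 'a) \<Rightarrow> real) \<Rightarrow> nat set \<Rightarrow> (nat \<Rightarrow> 'a) \<Rightarrow> bool" where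
  "determined_by N \<Lambda> f I x \<longleftrightarrow>
     (\<forall>y\<in>outcomes N \<Lambda>. (\<forall>j\<in>I. y j = x j) \<longrightarrow> f y = f x)"

(* q i x is the i-th queried index when the outcome is x.  The second clause says that q i
   is a function of the i - 1 previously exposed values only (hence q 1 is constant).  The third
   clause says that new coordinates are exposed until the exposed values determine f x, and
   that the last index is repeated from then on. *)
definition query_strategy ::
  "nat \<Rightarrow> (nat \<Rightarrow> 'a measure) \<Rightarrow> ((nat \<Rightarrow> 'a) \<Rightarrow> real) \<Rightarrow> (nat \<Rightarrow> (nat \<Rightarrow> 'a) \<Rightarrow> nat) \<Rightarrow> bool" where
  "query_strategy N \<Lambda> f q \<longleftrightarrow>
     (\<forall>i\<in>{1..N}. q i \<in> measurable (PiM {1..N} \<Lambda>) (count_space {1..N})) \<and>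
     (\<forall>i\<in>{1..N}. \<forall>x\<in>outcomes N \<Lambda>. \<forall>y\<in>outcomes N \<Lambda>.
        (\<forall>j\<in>{1..<i}. x (q j x) = y (q j y)) \<longrightarrow> q i x = q i y) \<and>
     (\<forall>k\<in>{1..<N}. \<forall>x\<in>outcomes N \<Lambda>.
        if determined_by N \<Lambda> f ((\<lambda>j. q j x) ` {1..k}) x
        then q (Suc k) x = q k x
        else q (Suc k) x \<notin> (\<lambda>j. q j x) ` {1..k})"

definition query_sets ::
  "nat \<Rightarrow> (nat \<Rightarrow> 'a measure) \<Rightarrow> (nat \<Rightarrow> (nat \<Rightarrow> 'a) \<Rightarrow> nat) \<Rightarrow> nat set set" where
  "query_sets N \<Lambda> q = (\<lambda>x. (\<lambda>i. q i x) ` {1..N}) ` outcomes N \<Lambda>"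

definition phi :: "real \<Rightarrow> real" where
  "phi x = (1 + x) * ln (1 + x) - x"

(* exp (- a / b) for a \<ge> 0.  If b = 0 < a the exponent is read as minus infinity, so that the bound
   is 0; the convention a / 0 = 0 would make it the trivial bound 1. *)
definition exp_neg_quot :: "real \<Rightarrow> real \<Rightarrow> real" where
  "exp_neg_quot a b = (if b = 0 then (if a = 0 then 1 else 0) else exp (- (a / b)))"

end

theory Submission
  imports Defs "HOL-Real_Asymp.Real_Asymp"
begin

text \<open>
  Let \<open>A\<^sub>i\<close> be the random set of the first \<open>i\<close> queried coordinates. The conditional expectations of
  \<open>f\<close> given the values on \<open>A\<^sub>i\<close> form a martingale from \<open>\<mu>\<close> to \<open>f X\<close>, because the last exposed set
  determines \<open>f\<close>. Dividing \<open>exp (\<lambda> * increment)\<close> by its conditional moment generating function at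
  every step gives a nonnegative process of mean exactly 1, so on any event on which each generating
  function is at most \<open>exp (\<psi> k)\<close> for the queried \<open>k\<close>, Markov's inequality yields
  \<open>exp (max\<^sub>Q (\<Sum>k\<in>Q. \<psi> k) - \<lambda> t)\<close>; no truncation of the increments is needed. The bounds \<open>\<psi>\<close>
  come from Hoeffding's lemma or Bennett's inequality.

  The good event consists of those \<open>x\<close> in \<open>\<Gamma>\<close> for which, before every new query, the conditional
  probability of leaving \<open>\<Gamma>\<close> is at most \<open>\<gamma>\<close>: there an increment is at most \<open>c k\<close> up to the
  correction \<open>e k\<close>. For part (3) each \<open>X k\<close> is conditioned on \<open>G k\<close>, which by independence gives
  again a product measure.
\<close>

section \<open>Inequalities for moment generating functions\<close>

text \<open>Membership in the good event depends on coordinates not yet exposed, so the process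
  cannot be stopped when it fails. The normalised exponential process therefore runs unrestricted,
  and the bounds on the generating functions enter only when its final value is read off on the good
  event, which need not be adapted. Repeated queries contribute a factor 1, so the exponents add up
  over the query set of the actual outcome; this gives a maximum of sums. The difference of two
  increments is at most c plus (d - c) times the risk at one or both of the values just shown. A
  single risk may be far above \<gamma>; the history controls only its average over the new
  coordinate. Averaging over one end of a pair bounds the absolute value of an increment, which
  means an interval of length 2 (c + e) in Hoeffding's lemma. If every pair is controlled the length
  is c + e, and the exponent gains the factor 4. An atom of known mass turns the averaged risk into
  a pointwise one; hence the divisions by \<open>r k\<close> and \<open>1 - p k\<close>.\<close>

lemma exp_le_quadratic:
  fixes u b :: real
  assumes "u \<le> b" "0 < b"
  shows "exp u \<le> 1 + u + u\<^sup>2 * ((exp b - 1 - b) / b\<^sup>2)"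
proof (cases "0 \<le> u")
  case True
  have S: "(\<lambda>n. x ^ (n + 2) / fact (n + 2)) sums (exp x - 1 - x)" for x :: real
    using sums_split_initial_segment[OF exp_converges[of x], of 2]
    by (simp add: scaleR_conv_of_real divide_inverse mult.commute numeral_2_eq_2 algebra_simps)
  have B: "(\<lambda>n. u\<^sup>2 * (b ^ n / fact (n + 2))) sums (u\<^sup>2 * ((exp b - 1 - b) / b\<^sup>2))"
    using sums_mult[OF sums_divide[OF S[of b], of "b\<^sup>2"], of "u\<^sup>2"] assms(2)
    by (simp add: power_add power2_eq_square)
  have "exp u - 1 - u \<le> u\<^sup>2 * ((exp b - 1 - b) / b\<^sup>2)"
  proof (rule sums_le[OF _ S B])
    fix n
    have "u ^ (n + 2) \<le> u\<^sup>2 * b ^ n"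
    proof -
      have "u\<^sup>2 * u ^ n \<le> u\<^sup>2 * b ^ n"
        using True assms by (intro mult_left_mono power_mono) auto
      then show ?thesis by (simp only: power_add mult.commute)
    qed
    then show "u ^ (n + 2) / fact (n + 2) \<le> u\<^sup>2 * (b ^ n / fact (n + 2))"
      by (simp add: divide_right_mono del: fact_Suc)
  qed
  then show ?thesis by simp
next
  \<comment> \<open>The quotient of \<open>exp u - 1 - u\<close> by the square of u is increasing,
    with limit 1/2 at 0. For negative u both sides are compared with that value 1/2.\<close>
  case False
  have "exp u \<le> 1 + u + u\<^sup>2 / 2"
  proof -
    have "(1 + 0 + 0\<^sup>2 / 2 - exp 0 :: real) \<le> 1 + u + u\<^sup>2 / 2 - exp u"
      using False
      by (intro DERIV_nonpos_imp_nonincreasing[of u 0])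
         (auto intro!: exI derivative_eq_intros simp: add_nonneg_eq_0_iff exp_ge_add_one_self)
    then show ?thesis by simp
  qed
  moreover have "1 / 2 \<le> (exp b - 1 - b) / b\<^sup>2"
    using exp_lower_Taylor_quadratic[of b] assms by (simp add: field_simps)
  then have "u\<^sup>2 * (1/2) \<le> u\<^sup>2 * ((exp b - 1 - b) / b\<^sup>2)" by (intro mult_left_mono) auto
  ultimately show ?thesis by linarith
qed

text \<open>Only an upper bound on Z is required: the quadratic majorant of exp is valid on the
  whole half-line below \<open>l * C\<close>. Mean zero removes the linear term, so the second
  moment alone remains.\<close>

lemma (in prob_space) bennett_mgf:
  fixes Z :: "'a \<Rightarrow> real"
  assumes "integrable M Z" "integrable M (\<lambda>x. (Z x)\<^sup>2)" "integrable M (\<lambda>x. exp (l * Z x))"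
    and "expectation Z = 0" and Zv: "expectation (\<lambda>x. (Z x)\<^sup>2) \<le> v"
    and "AE x in M. Z x \<le> C" and "0 < C" and "0 < l"
  shows "expectation (\<lambda>x. exp (l * Z x)) \<le> exp (v / C\<^sup>2 * (exp (l * C) - 1 - l * C))"
proof -
  define R where "R = (exp (l * C) - 1 - l * C) / C\<^sup>2"
  have R0: "0 \<le> R"
    unfolding R_def using exp_ge_add_one_self[of "l * C"]
    by (intro divide_nonneg_nonneg) (linarith, simp)
  have "expectation (\<lambda>x. exp (l * Z x)) \<le> expectation (\<lambda>x. 1 + l * Z x + R * (Z x)\<^sup>2)"
  proof (rule integral_mono_AE)
    show "AE x in M. exp (l * Z x) \<le> 1 + l * Z x + R * (Z x)\<^sup>2"
      using assms(6)
    proof eventually_elim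
      case (elim x)
      have "exp (l * Z x) \<le> 1 + l * Z x + (l * Z x)\<^sup>2 * ((exp (l * C) - 1 - l * C) / (l * C)\<^sup>2)"
        using elim assms by (intro exp_le_quadratic) auto
      also have "(l * Z x)\<^sup>2 * ((exp (l * C) - 1 - l * C) / (l * C)\<^sup>2) = R * (Z x)\<^sup>2"
        using assms by (simp add: R_def power_mult_distrib field_simps)
      finally show ?case .
    qed
  qed (use assms in auto)
  also have "\<dots> = 1 + R * expectation (\<lambda>x. (Z x)\<^sup>2)"
    using assms by (simp add: prob_space)
  also have "\<dots> \<le> 1 + R * v" using Zv R0 by (simp add: mult_left_mono)
  also have "\<dots> \<le> exp (R * v)" by (rule exp_ge_add_one_self)
  finally show ?thesis by (simp add: R_def mult.commute)
qed

text \<open>This weakens Bennett exponents to Bernstein ones. In partial fractions the left side is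
  \<open>3/2 * (u - 3) + 27/2 * inverse (3 + u)\<close>; \<open>h\<close> is the difference of the
  two sides and \<open>g\<close> its derivative. That \<open>g\<close> increases comes down to
  \<open>27 * (1 + y) \<le> (3 + y) ^ 3\<close>, the inequality of arithmetic and geometric means
  for 1, 1 and 1 + y.\<close>

lemma phi_ge:
  assumes "0 \<le> u" shows "u\<^sup>2 / (2 + 2 * u / 3) \<le> phi u"
proof -
  define g where "g = (\<lambda>x::real. ln (1 + x) - 3 / 2 + 27 / 2 * (inverse (3 + x))\<^sup>2)"
  have g0: "0 \<le> g x" if "0 \<le> x" for x
  proof -
    have "g 0 \<le> g x"
    proof (rule DERIV_nonneg_imp_nondecreasing[OF that])
      fix y :: real assume y: "0 \<le> y" "y \<le> x"
      have "((\<lambda>x. (27 / 2) * (inverse (3 + x))\<^sup>2) has_real_derivative - 27 * inverse (3 + y) ^ 3) (at y)"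
        using y by (auto intro!: derivative_eq_intros simp: power3_eq_cube)
      moreover have "((\<lambda>x. ln (1 + x)) has_real_derivative 1 / (1 + y)) (at y)"
        using y by (auto intro!: derivative_eq_intros)
      ultimately have "(g has_real_derivative 1 / (1 + y) - 27 * inverse (3 + y) ^ 3) (at y)"
        unfolding g_def using y by (auto intro!: derivative_eq_intros simp: power3_eq_cube)
      moreover have "27 * inverse (3 + y) ^ 3 \<le> 1 / (1 + y)"
      proof -
        have "(3 + y) ^ 3 = 27 * (1 + y) + 9 * y\<^sup>2 + y ^ 3"
          by (simp add: power2_eq_square power3_eq_cube algebra_simps)
        then have "27 * (1 + y) \<le> (3 + y) ^ 3" using y by simp
        then show ?thesis using y by (simp add: power_inverse divide_simps)
      qed
      ultimately show "\<exists>d. (g has_real_derivative d) (at y) \<and> 0 \<le> d" by fastforce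
    qed
    then show ?thesis by (simp add: g_def power2_eq_square)
  qed
  define h where "h = (\<lambda>x::real. phi x - (3 / 2 * (x - 3) + 27 / 2 * inverse (3 + x)))"
  have "h 0 \<le> h u"
  proof (rule DERIV_nonneg_imp_nondecreasing[OF assms])
    fix y :: real assume y: "0 \<le> y" "y \<le> u"
    have "((\<lambda>x. 3 / 2 * (x - 3) + 27 / 2 * inverse (3 + x)) has_real_derivative
        3 / 2 - 27 / 2 * (inverse (3 + y))\<^sup>2) (at y)"
      using y by (auto intro!: derivative_eq_intros simp: power2_eq_square)
    moreover have "(phi has_real_derivative ln (1 + y)) (at y)"
      unfolding phi_def[abs_def] using y by (auto intro!: derivative_eq_intros)
    ultimately have "(h has_real_derivative ln (1 + y) - (3 / 2 - 27 / 2 * (inverse (3 + y))\<^sup>2)) (at y)"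
      unfolding h_def by (intro DERIV_diff)
    with g0[OF y(1)] show "\<exists>d. (h has_real_derivative d) (at y) \<and> 0 \<le> d"
      by (auto simp: g_def field_simps)
  qed
  moreover have "u\<^sup>2 / (2 + 2 * u / 3) = 3 / 2 * (u - 3) + 27 / 2 * inverse (3 + u)"
    using assms by (simp add: field_simps power2_eq_square)
  ultimately show ?thesis by (simp add: h_def phi_def)
qed

lemma exp_neg_quot_0: "exp_neg_quot 0 b = 1"
  by (simp add: exp_neg_quot_def)

lemma exp_neg_quot_nonneg: "0 \<le> exp_neg_quot a b"
  by (simp add: exp_neg_quot_def)

text \<open>Serves the degenerate cases of \<open>exp_neg_quot\<close>: with vanishing variance the
  Chernoff bound is \<open>exp (- l * t)\<close> for every positive l, and l may tend to
  infinity.\<close>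

lemma le_0_if_le_exp:
  fixes p t :: real
  assumes "\<And>l. 0 < l \<Longrightarrow> p \<le> exp (- l * t)" "0 < t" shows "p \<le> 0"
proof (rule tendsto_lowerbound)
  show "((\<lambda>l. exp (- l * t)) \<longlongrightarrow> 0) at_top" using assms(2) by real_asymp
  show "\<forall>\<^sub>F l in at_top. p \<le> exp (- l * t)"
    using eventually_gt_at_top[of 0] by (rule eventually_mono) (use assms(1) in simp)
qed (rule trivial_limit_at_top_linorder)

lemma chernoff_gaussian:
  assumes "\<And>l. 0 < l \<Longrightarrow> p \<le> exp (l\<^sup>2 * W / (4 * a) - l * t)" "p \<le> 1" "0 \<le> t" "0 \<le> W" "0 < a"
  shows "p \<le> exp_neg_quot (a * t\<^sup>2) W"
proof (cases "t = 0 \<or> W = 0")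
  case True
  then consider "t = 0" | "W = 0" "0 < t" using assms(3) by fastforce
  then show ?thesis
  proof cases
    case 1
    then show ?thesis using assms(2) by (simp add: exp_neg_quot_0)
  next
    case 2
    have "p \<le> 0"
    proof (rule le_0_if_le_exp[OF _ 2(2)])
      show "p \<le> exp (- l * t)" if "0 < l" for l using assms(1)[OF that] 2 by simp
    qed
    then show ?thesis using exp_neg_quot_nonneg order_trans by blast
  qed
next
  case False
  then have pos: "t > 0" "W > 0" using assms by auto
  \<comment> \<open>The value \<open>2 * a * t / W\<close> of l minimises the quadratic
    exponent.\<close>
  have "p \<le> exp ((2 * a * t / W)\<^sup>2 * W / (4 * a) - (2 * a * t / W) * t)"
    using pos assms(5) by (intro assms) auto
  also have "(2 * a * t / W)\<^sup>2 * W / (4 * a) - (2 * a * t / W) * t = - (a * t\<^sup>2 / W)"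
    using pos assms(5) by (simp add: field_simps power2_eq_square)
  finally show ?thesis using pos by (simp add: exp_neg_quot_def)
qed

lemma chernoff_bennett:
  assumes "\<And>l. 0 < l \<Longrightarrow> p \<le> exp (V / C\<^sup>2 * (exp (l * C) - 1 - l * C) - l * t)" "0 < V" "0 < C" "0 < t"
  shows "p \<le> exp (- (V / C\<^sup>2 * phi (C * t / V)))"
    and "p \<le> exp_neg_quot (t\<^sup>2) (2 * V + 2 * C * t / 3)"
proof -
  define u where "u = C * t / V"
  have u: "0 < u" using assms by (simp add: u_def)
  \<comment> \<open>The exponent is minimal where
    \<open>exp (l * C) = 1 + C * t / V\<close>.\<close>
  define l where "l = ln (1 + u) / C"
  have l: "0 < l" using u assms by (simp add: l_def)
  have lC: "l * C = ln (1 + u)" using assms by (simp add: l_def)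
  have t: "t = u * V / C" using assms by (simp add: u_def)
  have "V / C\<^sup>2 * (exp (l * C) - 1 - l * C) - l * t = - (V / C\<^sup>2 * phi u)"
    using u assms unfolding lC t by (simp add: l_def phi_def power2_eq_square field_simps)
  with assms(1)[OF l] show *: "p \<le> exp (- (V / C\<^sup>2 * phi (C * t / V)))" by (simp add: u_def)
  have "0 < V * 6 + V * (u * 2)" using u assms by (simp add: add_pos_pos)
  then have pos: "V * 6 + V * (u * 2) \<noteq> 0" by simp
  have "t\<^sup>2 / (2 * V + 2 * C * t / 3) = V / C\<^sup>2 * (u\<^sup>2 / (2 + 2 * u / 3))"
    unfolding t using assms u by (simp add: divide_simps power2_eq_square) (simp add: algebra_simps add_pos_pos pos)
  also have "\<dots> \<le> V / C\<^sup>2 * phi u"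
    using assms u by (intro mult_left_mono phi_ge) auto
  finally have "exp (- (V / C\<^sup>2 * phi u)) \<le> exp (- (t\<^sup>2 / (2 * V + 2 * C * t / 3)))" by simp
  moreover have "2 * V + 2 * C * t / 3 \<noteq> 0"
  proof -
    have "0 < C * t" using assms by simp
    with assms(2) show ?thesis by simp
  qed
  ultimately have "exp (- (V / C\<^sup>2 * phi u)) \<le> exp_neg_quot (t\<^sup>2) (2 * V + 2 * C * t / 3)"
    by (simp only: exp_neg_quot_def if_False)
  with * show "p \<le> exp_neg_quot (t\<^sup>2) (2 * V + 2 * C * t / 3)"
    unfolding u_def by (rule order_trans)
qed

lemma (in prob_space) hoeffding_mgf:
  fixes Z :: "'a \<Rightarrow> real"
  assumes [measurable]: "random_variable borel Z" and "AE x in M. Z x \<in> {a..b}" "expectation Z = 0" "0 < l"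
  shows "expectation (\<lambda>x. exp (l * Z x)) \<le> exp (l\<^sup>2 * (b - a)\<^sup>2 / 8)"
proof -
  interpret interval_bounded_random_variable M Z a b
    by unfold_locales (use assms in auto)
  have "integrable M (\<lambda>x. exp (l * Z x))"
    using assms(2,4) by (intro integrable_const_bound[where B="exp (l * b)"]) (auto elim!: eventually_mono)
  then have "ennreal (expectation (\<lambda>x. exp (l * Z x))) = (\<integral>\<^sup>+x. exp (l * Z x) \<partial>M)"
    by (intro nn_integral_eq_integral[symmetric]) auto
  also have "\<dots> \<le> ennreal (exp (l\<^sup>2 * (b - a)\<^sup>2 / 8))"
    using Hoeffdings_lemma_nn_integral_0 assms(3,4) by simp
  finally show ?thesis by simp
qed

section \<open>Conditional expectations in finite product spaces\<close>

text \<open>Resampling outside \<open>A\<close>: with \<open>y\<close> drawn from the product law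
  this realises conditioning on the coordinates in \<open>A\<close> for every single
  \<open>x\<close>. Conditional expectations become genuine functions, and no null sets have to be
  tracked when \<open>A\<close> itself depends on \<open>x\<close>.\<close>

definition mix :: "'i set \<Rightarrow> ('i \<Rightarrow> 'a) \<Rightarrow> ('i \<Rightarrow> 'a) \<Rightarrow> 'i \<Rightarrow> 'a" where
  "mix A x y = (\<lambda>j. if j \<in> A then x j else y j)"

lemma mix_simps:
  "mix A (mix A x y) z = mix A x z"
  "mix {} x y = y"
  "mix A x x = x"
  by (auto simp: mix_def)

lemma mix_absorb: "A \<subseteq> B \<Longrightarrow> mix B (mix A x y) z = mix A x (mix B y z)"
  by (auto simp: mix_def fun_eq_iff)

lemma mix_PiE: "x \<in> PiE I G \<Longrightarrow> y \<in> PiE I G \<Longrightarrow> mix A x y \<in> PiE I G"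
  by (auto simp: mix_def PiE_def Pi_def extensional_def)

locale index_product =
  fixes m :: "'i \<Rightarrow> 'a measure" and I :: "'i set"
  assumes prob_component: "\<And>k. prob_space (m k)"
    and finite_index: "finite I"
begin

abbreviation "P \<equiv> PiM I m"

sublocale finite_product_prob_space m I
proof -
  interpret m: prob_space "m k" for k by (rule prob_component)
  show "finite_product_prob_space m I"
    by unfold_locales (auto intro: finite_index)
qed

sublocale PP: pair_prob_space P P ..

lemma measurable_mix [measurable]: "(\<lambda>(x, y). mix A x y) \<in> measurable (P \<Otimes>\<^sub>M P) P"
proof (rule measurable_PiM_single')
  fix i assume "i \<in> I"
  then show "(\<lambda>p. (case p of (x, y) \<Rightarrow> mix A x y) i) \<in> measurable (P \<Otimes>\<^sub>M P) (m i)"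
    by (cases "i \<in> A") (simp_all add: mix_def case_prod_beta)
next
  show "(\<lambda>p. case p of (x, y) \<Rightarrow> mix A x y) \<in> space (P \<Otimes>\<^sub>M P) \<rightarrow> (\<Pi>\<^sub>E i\<in>I. space (m i))"
  proof (rule Pi_I)
    fix p assume "p \<in> space (P \<Otimes>\<^sub>M P)"
    then show "(case p of (x, y) \<Rightarrow> mix A x y) \<in> (\<Pi>\<^sub>E i\<in>I. space (m i))"
      using mix_PiE[of "fst p" I "\<lambda>i. space (m i)" "snd p" A]
      by (simp add: space_pair_measure space_PiM case_prod_beta mem_Times_iff)
  qed
qed

lemma measurable_mix' [measurable (raw)]:
  assumes "g \<in> measurable Q P" "h \<in> measurable Q P"
  shows "(\<lambda>w. mix A (g w) (h w)) \<in> measurable Q P"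
  using measurable_compose[OF measurable_Pair[OF assms] measurable_mix[of A]] by simp

lemma mix_in_space: "x \<in> space P \<Longrightarrow> y \<in> space P \<Longrightarrow> mix A x y \<in> space P"
  by (simp add: space_PiM mix_PiE)

text \<open>Checked on boxes: the preimage of a box is a product of two boxes, and at each index one
  of the two is the whole space, so the measures multiply to that of the given box.\<close>

lemma distr_mix: "distr (P \<Otimes>\<^sub>M P) P (\<lambda>(x, y). mix A x y) = P"
proof (rule PiM_eqI)
  fix E assume E: "\<And>i. i \<in> I \<Longrightarrow> E i \<in> sets (m i)"
  define F where "F = (\<lambda>i. if i \<in> A then E i else space (m i))"
  define H where "H = (\<lambda>i. if i \<in> A then space (m i) else E i)"
  have FH: "i \<in> I \<Longrightarrow> F i \<in> sets (m i)" "i \<in> I \<Longrightarrow> H i \<in> sets (m i)" for i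
    using E by (auto simp: F_def H_def)
  have "(\<lambda>(x, y). mix A x y) -` PiE I E \<inter> space (P \<Otimes>\<^sub>M P) = PiE I F \<times> PiE I H"
    using E[THEN sets.sets_into_space]
    by (auto simp: space_pair_measure space_PiM mix_def F_def H_def PiE_def Pi_def extensional_def
        split: if_splits) blast+
  then have "emeasure (distr (P \<Otimes>\<^sub>M P) P (\<lambda>(x, y). mix A x y)) (PiE I E)
      = emeasure P (PiE I F) * emeasure P (PiE I H)"
    using E FH finite_index
    by (subst emeasure_distr) (auto intro!: sets_PiM_I_finite sigma_finite_measure.emeasure_pair_measure_Times
        prob_space_imp_sigma_finite P.prob_space_axioms)
  also have "\<dots> = (\<Prod>i\<in>I. emeasure (m i) (F i)) * (\<Prod>i\<in>I. emeasure (m i) (H i))"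
    using FH by (simp add: measure_times)
  also have "\<dots> = (\<Prod>i\<in>I. emeasure (m i) (F i) * emeasure (m i) (H i))"
    by (simp add: prod.distrib)
  also have "\<dots> = (\<Prod>i\<in>I. emeasure (m i) (E i))"
    by (intro prod.cong refl) (auto simp: F_def H_def prob_space.emeasure_space_1[OF prob_component])
  finally show "emeasure (distr (P \<Otimes>\<^sub>M P) P (\<lambda>(x, y). mix A x y)) (PiE I E)
      = (\<Prod>i\<in>I. emeasure (m i) (E i))" .
qed (auto intro: finite_index)

text \<open>\<open>cexp A h x\<close> is a version of the conditional expectation of \<open>h\<close> given the coordinates in \<open>A\<close>.\<close>

definition cexp :: "'i set \<Rightarrow> (('i \<Rightarrow> 'a) \<Rightarrow> real) \<Rightarrow> ('i \<Rightarrow> 'a) \<Rightarrow> real" where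
  "cexp A h x = (\<integral>y. h (mix A x y) \<partial>P)"

text \<open>A class of integrands closed under sums, products, exponentials, resampling and
  conditional expectation, so that integrability never needs a separate argument. The hypotheses on
  differences, or on the range, put \<open>f\<close> into it.\<close>

definition bdd :: "(('i \<Rightarrow> 'a) \<Rightarrow> real) \<Rightarrow> bool" where
  "bdd h \<longleftrightarrow> h \<in> borel_measurable P \<and> (\<exists>K. \<forall>x\<in>space P. \<bar>h x\<bar> \<le> K)"

lemma bddI: "h \<in> borel_measurable P \<Longrightarrow> (\<And>x. x \<in> space P \<Longrightarrow> \<bar>h x\<bar> \<le> K) \<Longrightarrow> bdd h"
  by (auto simp: bdd_def)

lemma bdd_measurable [measurable_dest]: "bdd h \<Longrightarrow> h \<in> borel_measurable P"
  by (simp add: bdd_def)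

lemma bdd_bound:
  assumes "bdd h" obtains K where "0 \<le> K" "\<And>x. x \<in> space P \<Longrightarrow> \<bar>h x\<bar> \<le> K"
proof -
  from assms obtain K where K: "\<forall>x\<in>space P. \<bar>h x\<bar> \<le> K" by (auto simp: bdd_def)
  obtain x where "x \<in> space P" using P.not_empty by blast
  with K have "0 \<le> K" by force
  with K that show ?thesis by blast
qed

lemma bdd_integrable: "bdd h \<Longrightarrow> integrable P h"
 
  by (rule bdd_bound) (auto intro!: P.integrable_const_bound AE_I2 simp: bdd_def)

lemma bdd_const: "bdd (\<lambda>x. a)"
  by (rule bddI[of _ "\<bar>a\<bar>"]) auto

lemma bdd_indicator: "S \<in> sets P \<Longrightarrow> bdd (indicator S)"
  by (rule bddI[of _ 1]) (auto split: split_indicator)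

lemma bdd_add: assumes "bdd g" "bdd h" shows "bdd (\<lambda>x. g x + h x)"
proof -
  obtain K L where "\<And>x. x \<in> space P \<Longrightarrow> \<bar>g x\<bar> \<le> K" "\<And>x. x \<in> space P \<Longrightarrow> \<bar>h x\<bar> \<le> L"
    using bdd_bound[OF assms(1)] bdd_bound[OF assms(2)] by metis
  then show ?thesis
    using assms by (intro bddI[of _ "K + L"]) (measurable, auto intro: order_trans[OF abs_triangle_ineq] add_mono)
qed

lemma bdd_mult: assumes "bdd g" "bdd h" shows "bdd (\<lambda>x. g x * h x)"
proof -
  obtain K L where "0 \<le> K" "\<And>x. x \<in> space P \<Longrightarrow> \<bar>g x\<bar> \<le> K" "\<And>x. x \<in> space P \<Longrightarrow> \<bar>h x\<bar> \<le> L"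
    using bdd_bound[OF assms(1)] bdd_bound[OF assms(2)] by metis
  then show ?thesis
    using assms by (intro bddI[of _ "K * L"]) (measurable, auto simp: abs_mult intro!: mult_mono)
qed

lemma bdd_diff: "bdd g \<Longrightarrow> bdd h \<Longrightarrow> bdd (\<lambda>x. g x - h x)"
  using bdd_add[OF _ bdd_mult[OF bdd_const[of "-1"]], of g h] by simp

lemma bdd_exp: assumes "bdd g" shows "bdd (\<lambda>x. exp (g x))"
proof -
  obtain K where "\<And>x. x \<in> space P \<Longrightarrow> \<bar>g x\<bar> \<le> K" using bdd_bound[OF assms] by metis
  then show ?thesis using assms
    by (intro bddI[of _ "exp K"]) (measurable, auto intro: order_trans[OF abs_ge_self])
qed

lemma bdd_abs: assumes "bdd g" shows "bdd (\<lambda>x. \<bar>g x\<bar>)"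
  using assms by (auto simp: bdd_def)

lemma bdd_mix: assumes "bdd h" "x \<in> space P" shows "bdd (\<lambda>y. h (mix A x y))"
proof -
  obtain K where "\<And>x. x \<in> space P \<Longrightarrow> \<bar>h x\<bar> \<le> K" using bdd_bound[OF assms(1)] by metis
  then show ?thesis using bdd_measurable[OF assms(1)] assms(2)
    by (intro bddI[of _ K]) (measurable, auto intro: mix_in_space)
qed

lemma abs_integral_le:
  assumes "bdd h" "\<And>x. x \<in> space P \<Longrightarrow> \<bar>h x\<bar> \<le> K" shows "\<bar>integral\<^sup>L P h\<bar> \<le> K"
proof -
  have "\<bar>integral\<^sup>L P h\<bar> \<le> (\<integral>x. \<bar>h x\<bar> \<partial>P)" by (rule integral_abs_bound)
  also have "\<dots> \<le> (\<integral>x. K \<partial>P)"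
    by (rule integral_mono) (auto intro!: bdd_integrable bdd_abs bdd_const assms)
  finally show ?thesis by (simp add: P.prob_space)
qed

lemma abs_cexp_le:
  assumes "bdd h" "\<And>x. x \<in> space P \<Longrightarrow> \<bar>h x\<bar> \<le> K" "x \<in> space P" shows "\<bar>cexp A h x\<bar> \<le> K"
  unfolding cexp_def using assms by (intro abs_integral_le bdd_mix) (auto intro: mix_in_space)

lemma bdd_cexp: assumes "bdd h" shows "bdd (cexp A h)"
proof -
  obtain K where "\<And>x. x \<in> space P \<Longrightarrow> \<bar>h x\<bar> \<le> K" using bdd_bound[OF assms] by metis
  then show ?thesis using assms unfolding bdd_def
    by (intro conjI exI[of _ K] ballI abs_cexp_le) (unfold cexp_def, measurable, auto simp: bdd_def)
qed

lemma integral_cexp: assumes "bdd h" shows "(\<integral>x. cexp A h x \<partial>P) = (\<integral>x. h x \<partial>P)"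
proof -
  obtain K where K: "\<And>x. x \<in> space P \<Longrightarrow> \<bar>h x\<bar> \<le> K" using bdd_bound[OF assms] by metis
  have [measurable]: "h \<in> borel_measurable P" using assms by simp
  have "(\<integral>x. h x \<partial>P) = (\<integral>x. h x \<partial>distr (P \<Otimes>\<^sub>M P) P (\<lambda>(x, y). mix A x y))"
    by (simp add: distr_mix)
  also have "\<dots> = (\<integral>p. h (case p of (x, y) \<Rightarrow> mix A x y) \<partial>(P \<Otimes>\<^sub>M P))"
    by (subst integral_distr) auto
  also have "\<dots> = (\<integral>x. (\<integral>y. h (mix A x y) \<partial>P) \<partial>P)"
    using K
    by (subst PP.integral_fst'[symmetric])
       (auto simp: space_pair_measure intro!: PP.integrable_const_bound[where B=K] AE_I2 simp: mix_in_space)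
  finally show ?thesis by (simp add: cexp_def)
qed

lemma cexp_mix: "cexp A h (mix A x y) = cexp A h x"
  by (simp add: cexp_def mix_simps)

lemma cexp_cong: "(\<And>j. j \<in> A \<Longrightarrow> x j = y j) \<Longrightarrow> cexp A h x = cexp A h y"
  by (auto simp: cexp_def mix_def intro!: Bochner_Integration.integral_cong arg_cong[where f=h])

lemma cexp_empty: "cexp {} h x = integral\<^sup>L P h"
  by (simp add: cexp_def mix_simps)

lemma integral_cexp_mix:
  assumes "bdd h" "x \<in> space P" "A \<subseteq> B"
  shows "(\<integral>y. cexp B h (mix A x y) \<partial>P) = cexp A h x"
  using integral_cexp[OF bdd_mix[OF assms(1,2), of A], of B] assms(3)
  by (simp add: cexp_def mix_absorb)

text \<open>The tower property for a random set of coordinates. The hypothesis \<open>stop\<close>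
  is the analogue of a stopping time: whether \<open>S x = A\<close> can be read off from the
  coordinates in \<open>A\<close>. The space is split according to the value of \<open>S\<close>,
  and on each piece the indicator is constant under resampling outside \<open>A\<close>, so it can
  be pulled out of \<open>cexp A\<close>.\<close>

lemma integral_stopping:
  assumes "bdd h" and S: "S \<in> measurable P (count_space (Pow I))"
    and stop: "\<And>x y. x \<in> space P \<Longrightarrow> y \<in> space P \<Longrightarrow> (\<And>j. j \<in> S x \<Longrightarrow> x j = y j) \<Longrightarrow> S y = S x"
  shows "(\<integral>x. cexp (S x) h x \<partial>P) = (\<integral>x. h x \<partial>P)"
proof -
  have SP: "x \<in> space P \<Longrightarrow> S x \<in> Pow I" for x using measurable_space[OF S] by auto
  define Z where "Z A = {x \<in> space P. S x = A}" for A
  have Z: "A \<in> Pow I \<Longrightarrow> Z A \<in> sets P" for A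
    using measurable_sets[OF S, of "{A}"] by (auto simp: Z_def vimage_def Int_def conj_commute)
  have dec: "g x = (\<Sum>A\<in>Pow I. indicator (Z A) x * g x)" if "x \<in> space P" for g :: "_ \<Rightarrow> real" and x
  proof -
    have "(\<Sum>A\<in>Pow I. indicator (Z A) x * g x) = (\<Sum>A\<in>Pow I. if A = S x then g x else 0)"
      using that by (intro sum.cong) (auto simp: Z_def)
    also have "\<dots> = g x" using SP[OF that] finite_index by (subst sum.delta) auto
    finally show ?thesis ..
  qed
  have bh: "A \<in> Pow I \<Longrightarrow> bdd (\<lambda>x. indicator (Z A) x * h x)" for A
    using Z assms by (intro bdd_mult bdd_indicator)
  have bc: "A \<in> Pow I \<Longrightarrow> bdd (\<lambda>x. indicator (Z A) x * cexp A h x)" for A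
    using Z assms by (intro bdd_mult bdd_indicator bdd_cexp)
  have mixZ: "mix A x y \<in> Z A \<longleftrightarrow> x \<in> Z A" if "x \<in> space P" "y \<in> space P" for A x y
  proof
    assume "mix A x y \<in> Z A"
    then have "S (mix A x y) = A" by (simp add: Z_def)
    with stop[of "mix A x y" x] that mix_in_space[OF that] show "x \<in> Z A"
      by (auto simp: Z_def mix_def)
  next
    assume "x \<in> Z A"
    then have "S x = A" by (simp add: Z_def)
    with stop[of x "mix A x y"] that mix_in_space[OF that] show "mix A x y \<in> Z A"
      by (auto simp: Z_def mix_def)
  qed
  have "(\<integral>x. h x \<partial>P) = (\<integral>x. (\<Sum>A\<in>Pow I. indicator (Z A) x * h x) \<partial>P)"
    by (intro Bochner_Integration.integral_cong refl dec)
  also have "\<dots> = (\<Sum>A\<in>Pow I. (\<integral>x. indicator (Z A) x * h x \<partial>P))"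
    by (intro Bochner_Integration.integral_sum bdd_integrable bh)
  also have "\<dots> = (\<Sum>A\<in>Pow I. (\<integral>x. indicator (Z A) x * cexp A h x \<partial>P))"
  proof (intro sum.cong refl)
    fix A assume A: "A \<in> Pow I"
    have "(\<integral>x. indicator (Z A) x * h x \<partial>P) = (\<integral>x. cexp A (\<lambda>x. indicator (Z A) x * h x) x \<partial>P)"
      by (rule integral_cexp[symmetric, OF bh[OF A]])
    also have "\<dots> = (\<integral>x. indicator (Z A) x * cexp A h x \<partial>P)"
    proof (intro Bochner_Integration.integral_cong refl)
      fix x assume x: "x \<in> space P"
      have "cexp A (\<lambda>x. indicator (Z A) x * h x) x = (\<integral>y. indicator (Z A) x * h (mix A x y) \<partial>P)"
        unfolding cexp_def using x
        by (intro Bochner_Integration.integral_cong refl) (auto simp: mixZ split: split_indicator)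
      then show "cexp A (\<lambda>x. indicator (Z A) x * h x) x = indicator (Z A) x * cexp A h x"
        by (simp add: cexp_def)
    qed
    finally show "(\<integral>x. indicator (Z A) x * h x \<partial>P) = (\<integral>x. indicator (Z A) x * cexp A h x \<partial>P)" .
  qed
  also have "\<dots> = (\<integral>x. (\<Sum>A\<in>Pow I. indicator (Z A) x * cexp A h x) \<partial>P)"
    by (intro Bochner_Integration.integral_sum[symmetric] bdd_integrable bc)
  also have "\<dots> = (\<integral>x. (\<Sum>A\<in>Pow I. indicator (Z A) x * cexp (S x) h x) \<partial>P)"
    by (intro Bochner_Integration.integral_cong refl sum.cong) (auto simp: Z_def split: split_indicator)
  also have "\<dots> = (\<integral>x. cexp (S x) h x \<partial>P)"
    by (intro Bochner_Integration.integral_cong refl) (subst dec, auto)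
  finally show ?thesis ..
qed

end

section \<open>Exposing one further coordinate: differences and variances\<close>

context index_product begin

text \<open>\<open>fiber A k h x y\<close> is the conditional expectation of \<open>h\<close> when \<open>A\<close> is exposed
  with values from \<open>x\<close> and the next coordinate \<open>k\<close> shows the value \<open>y k\<close>.\<close>

definition fiber :: "'i set \<Rightarrow> 'i \<Rightarrow> (('i \<Rightarrow> 'a) \<Rightarrow> real) \<Rightarrow> ('i \<Rightarrow> 'a) \<Rightarrow> ('i \<Rightarrow> 'a) \<Rightarrow> real" where
  "fiber A k h x y = cexp (insert k A) h (mix A x y)"

lemma fiber_cong: "y k = y' k \<Longrightarrow> fiber A k h x y = fiber A k h x y'"
  unfolding fiber_def by (rule cexp_cong) (auto simp: mix_def)

lemma bdd_fiber: "bdd h \<Longrightarrow> x \<in> space P \<Longrightarrow> bdd (fiber A k h x)"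
  unfolding fiber_def by (rule bdd_mix[OF bdd_cexp])

lemma integral_fiber: "bdd h \<Longrightarrow> x \<in> space P \<Longrightarrow> (\<integral>y. fiber A k h x y \<partial>P) = cexp A h x"
  unfolding fiber_def by (rule integral_cexp_mix) auto

lemma fiber_nonneg: "(\<And>x. 0 \<le> h x) \<Longrightarrow> 0 \<le> fiber A k h x y"
  unfolding fiber_def cexp_def by (rule Bochner_Integration.integral_nonneg)

lemma coordinate_atom_sets:
  assumes "k \<in> I" "{u} \<in> sets (m k)" shows "{y\<in>space P. y k = u} \<in> sets P"
proof -
  have "(\<lambda>z. z k) \<in> measurable P (m k)" using assms(1) by simp
  from measurable_sets[OF this assms(2)] show ?thesis by (simp add: vimage_def Int_def conj_commute)
qed

text \<open>Markov's inequality on an atom: the fiber is nonnegative with mean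
  \<open>cexp A h x\<close>, and it is constant on the event that coordinate \<open>k\<close> shows
  \<open>y k\<close>.\<close>

lemma fiber_atom:
  assumes "bdd h" "\<And>x. 0 \<le> h x" "x \<in> space P" "y \<in> space P" "k \<in> I" "{y k} \<in> sets (m k)"
  shows "fiber A k h x y * measure P {z\<in>space P. z k = y k} \<le> cexp A h x"
proof -
  let ?S = "{z\<in>space P. z k = y k}"
  have S: "?S \<in> sets P" by (rule coordinate_atom_sets[OF assms(5,6)])
  have "fiber A k h x y * measure P ?S = (\<integral>z. fiber A k h x y * indicator ?S z \<partial>P)" using S by simp
  also have "\<dots> \<le> (\<integral>z. fiber A k h x z \<partial>P)"
  proof (rule integral_mono[OF bdd_integrable[OF bdd_mult[OF bdd_const bdd_indicator[OF S]]]
        bdd_integrable[OF bdd_fiber[OF assms(1,3)]]])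
    fix z
    show "fiber A k h x y * indicator ?S z \<le> fiber A k h x z"
      using fiber_nonneg[of h A k x z] assms(2) fiber_cong[of y k z A h x]
      by (auto split: split_indicator)
  qed
  finally show ?thesis by (simp add: integral_fiber assms)
qed

text \<open>A coupling: both fibers are computed with the same resampled point \<open>z\<close>, so
  the two arguments of \<open>h\<close> differ only at \<open>k\<close> and the pointwise estimate
  can be integrated. The factor \<open>a\<close> decides whether the second endpoint is charged too;
  it is 0 for the one-sided hypothesis and 1 for the two-sided one.\<close>

lemma fiber_diff_le:
  assumes "bdd h" "bdd g" "x \<in> space P" "y \<in> space P" "y' \<in> space P"
    and box: "AE z in P. z \<in> S" "x \<in> S" "y \<in> S" "y' \<in> S"
    and mixS: "\<And>A u v. u \<in> S \<Longrightarrow> v \<in> S \<Longrightarrow> mix A u v \<in> S"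
    and k: "k \<notin> A" "y k \<noteq> y' k" and "0 \<le> a"
    and Lip: "\<And>u v. u \<in> S \<Longrightarrow> v \<in> S \<Longrightarrow> u k \<noteq> v k \<Longrightarrow> (\<And>j. j \<noteq> k \<Longrightarrow> u j = v j) \<Longrightarrow>
      \<bar>h u - h v\<bar> \<le> c + e * (g v + a * g u)"
  shows "\<bar>fiber A k h x y - fiber A k h x y'\<bar> \<le> c + e * (fiber A k g x y' + a * fiber A k g x y)"
proof -
  define u where "u z = mix (insert k A) (mix A x y) z" for z
  define v where "v z = mix (insert k A) (mix A x y') z" for z
  have b: "bdd (\<lambda>z. r (u z))" "bdd (\<lambda>z. r (v z))" if "bdd r" for r
    unfolding u_def v_def using assms(3-5) by (auto intro!: bdd_mix[OF that] mix_in_space)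
  note i = b[THEN bdd_integrable]
  have "\<bar>fiber A k h x y - fiber A k h x y'\<bar> = \<bar>\<integral>z. h (u z) - h (v z) \<partial>P\<bar>"
    using i[OF assms(1)] by (simp add: fiber_def cexp_def u_def v_def)
  also have "\<dots> \<le> (\<integral>z. \<bar>h (u z) - h (v z)\<bar> \<partial>P)" by (rule integral_abs_bound)
  also have "\<dots> \<le> (\<integral>z. c + e * (g (v z) + a * g (u z)) \<partial>P)"
  proof (rule integral_mono_AE)
    show "AE z in P. \<bar>h (u z) - h (v z)\<bar> \<le> c + e * (g (v z) + a * g (u z))"
      using box(1)
    proof eventually_elim
      case (elim z)
      have "u z \<in> S" "v z \<in> S" using elim box mixS by (auto simp: u_def v_def)
      then show ?case using k by (intro Lip) (auto simp: u_def v_def mix_def)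
    qed
  qed (use i[OF assms(1)] i[OF assms(2)] in auto)
  also have "\<dots> = c + e * (fiber A k g x y' + a * fiber A k g x y)"
    using i[OF assms(2)] by (simp add: fiber_def cexp_def u_def v_def P.prob_space)
  finally show ?thesis .
qed

text \<open>A centred \<open>Z\<close> satisfies that \<open>Z y\<close> is the mean of
  \<open>Z y - Z y'\<close> over \<open>y'\<close>. Thus only the average of the pairwise bound
  matters, even if it is large for some \<open>y'\<close>.\<close>

lemma abs_centered_le:
  assumes "bdd Z" "(\<integral>y. Z y \<partial>P) = 0" "bdd g" "AE y' in P. \<bar>Z y - Z y'\<bar> \<le> g y'"
  shows "\<bar>Z y\<bar> \<le> (\<integral>y'. g y' \<partial>P)"
proof -
  have "\<bar>Z y\<bar> = \<bar>\<integral>y'. Z y - Z y' \<partial>P\<bar>"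
    using assms(2) bdd_integrable[OF assms(1)] by (simp add: P.prob_space)
  also have "\<dots> \<le> (\<integral>y'. \<bar>Z y - Z y'\<bar> \<partial>P)" by (rule integral_abs_bound)
  also have "\<dots> \<le> (\<integral>y'. g y' \<partial>P)"
    using assms(4) bdd_integrable[OF assms(1)] bdd_integrable[OF assms(3)]
    by (intro integral_mono_AE) auto
  finally show ?thesis .
qed

lemma variance_two_values:
  assumes "bdd Z" "(\<integral>y. Z y \<partial>P) = 0" "S \<in> sets P"
    and Z: "\<And>y. y \<in> space P \<Longrightarrow> Z y = (if y \<in> S then a else b)" and "\<bar>a - b\<bar> \<le> D"
  shows "(\<integral>y. (Z y)\<^sup>2 \<partial>P) \<le> (1 - measure P S) * measure P S * D\<^sup>2"
proof -
  let ?p = "measure P S"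
  have i: "(\<integral>y. b' + (a' - b') * indicator S y \<partial>P) = b' + (a' - b') * ?p" for a' b' :: real
    using assms(3) by (subst Bochner_Integration.integral_add)
      (auto intro!: bdd_integrable bdd_const bdd_mult bdd_indicator simp: P.prob_space)
  have "(\<integral>y. Z y \<partial>P) = (\<integral>y. b + (a - b) * indicator S y \<partial>P)"
    by (intro Bochner_Integration.integral_cong) (auto simp: Z)
  then have 0: "b + (a - b) * ?p = 0" using assms(2) i by simp
  have "(\<integral>y. (Z y)\<^sup>2 \<partial>P) = (\<integral>y. b\<^sup>2 + (a\<^sup>2 - b\<^sup>2) * indicator S y \<partial>P)"
    by (intro Bochner_Integration.integral_cong) (auto simp: Z)
  also have "\<dots> = b\<^sup>2 + (a\<^sup>2 - b\<^sup>2) * ?p" by (rule i)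
  \<comment> \<open>The second moment is the variance of a two-valued variable plus the square of
    its mean, and the mean is 0.\<close>
  also have "\<dots> = (1 - ?p) * ?p * (a - b)\<^sup>2 + (b + (a - b) * ?p)\<^sup>2"
    by (simp add: power2_eq_square algebra_simps)
  also have "\<dots> = (1 - ?p) * ?p * (a - b)\<^sup>2" using 0 by simp
  also have "\<dots> \<le> (1 - ?p) * ?p * D\<^sup>2"
    using assms(5) by (intro mult_left_mono) (auto simp: abs_le_square_iff[symmetric])
  finally show ?thesis .
qed

text \<open>The variance is at most the second moment about any point. Taken about the value
  \<open>a\<close> on the likely set \<open>S\<close>, only the complement of \<open>S\<close>, of
  mass at most \<open>p\<close>, contributes.\<close>

lemma variance_near_atom:
  assumes "bdd Z" "(\<integral>y. Z y \<partial>P) = 0" "S \<in> sets P" "1 - p \<le> measure P S"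
    and Z: "\<And>y. y \<in> S \<Longrightarrow> Z y = a" "\<And>y. y \<in> space P \<Longrightarrow> y \<notin> S \<Longrightarrow> \<bar>Z y - a\<bar> \<le> D"
  shows "(\<integral>y. (Z y)\<^sup>2 \<partial>P) \<le> p * D\<^sup>2"
proof -
  have b2: "bdd (\<lambda>y. (Z y)\<^sup>2)" unfolding power2_eq_square by (rule bdd_mult[OF assms(1,1)])
  have "(\<integral>y. (Z y - a)\<^sup>2 \<partial>P) = (\<integral>y. (Z y)\<^sup>2 + (a\<^sup>2 - 2 * a * Z y) \<partial>P)"
    by (intro Bochner_Integration.integral_cong) (auto simp: power2_eq_square algebra_simps)
  also have "\<dots> = (\<integral>y. (Z y)\<^sup>2 \<partial>P) + a\<^sup>2"
    using bdd_integrable[OF b2] bdd_integrable[OF assms(1)] assms(2) by (simp add: P.prob_space)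
  finally have "(\<integral>y. (Z y)\<^sup>2 \<partial>P) \<le> (\<integral>y. (Z y - a)\<^sup>2 \<partial>P)" by simp
  also have "\<dots> \<le> (\<integral>y. D\<^sup>2 * indicator (space P - S) y \<partial>P)"
  proof (rule integral_mono)
    show "integrable P (\<lambda>y. (Z y - a)\<^sup>2)"
      unfolding power2_eq_square
      by (rule bdd_integrable[OF bdd_mult[OF bdd_diff[OF assms(1) bdd_const] bdd_diff[OF assms(1) bdd_const]]])
    show "integrable P (\<lambda>y. D\<^sup>2 * indicator (space P - S) y :: real)"
      using assms(3) by (intro bdd_integrable bdd_mult bdd_const bdd_indicator) auto
    fix y assume y: "y \<in> space P"
    show "(Z y - a)\<^sup>2 \<le> D\<^sup>2 * indicator (space P - S) y"
    proof (cases "y \<in> S")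
      case True then show ?thesis using Z(1) by simp
    next
      case False
      then show ?thesis using Z(2)[OF y False] y by (auto simp: abs_le_square_iff[symmetric])
    qed
  qed
  also have "\<dots> = D\<^sup>2 * (1 - measure P S)" using assms(3) by (simp add: P.prob_compl)
  also have "\<dots> \<le> D\<^sup>2 * p" using assms(4) by (intro mult_left_mono) auto
  finally show ?thesis by (simp add: mult.commute)
qed

end

section \<open>The martingale of a query strategy\<close>

text \<open>The parameter \<open>{1..N}\<close> of the locale must not be rewritten to \<open>{Suc 0..N}\<close>.\<close>

declare One_nat_def [simp del]

locale query_process = index_product m "{1..N}" for m :: "nat \<Rightarrow> 'a measure" and N :: nat +
  fixes f :: "(nat \<Rightarrow> 'a) \<Rightarrow> real" and q :: "nat \<Rightarrow> (nat \<Rightarrow> 'a) \<Rightarrow> nat"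
  assumes N_pos: "1 \<le> N"
    and f_measurable [measurable]: "f \<in> borel_measurable P"
    and strategy: "query_strategy N m f q"
begin

lemma outcomes_eq: "outcomes N m = space P"
  by (simp add: outcomes_def space_PiM)

definition exposed :: "nat \<Rightarrow> (nat \<Rightarrow> 'a) \<Rightarrow> nat set" where
  "exposed i x = (\<lambda>j. q j x) ` {1..i}"

text \<open>Once \<open>f\<close> is determined the last index is repeated. A step that is not fresh
  exposes nothing, its increment vanishes, and it must not be counted.\<close>

definition fresh :: "nat \<Rightarrow> (nat \<Rightarrow> 'a) \<Rightarrow> bool" where
  "fresh i x \<longleftrightarrow> q (Suc i) x \<notin> exposed i x"

lemma exposed_0: "exposed 0 x = {}"
  by (simp add: exposed_def)

lemma exposed_Suc: "exposed (Suc i) x = insert (q (Suc i) x) (exposed i x)"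
  by (simp add: exposed_def atLeastAtMostSuc_conv)

lemma exposed_mono: "i \<le> j \<Longrightarrow> exposed i x \<subseteq> exposed j x"
  by (auto simp: exposed_def)

lemma finite_exposed: "finite (exposed i x)"
  by (simp add: exposed_def)

lemma q_range: "x \<in> space P \<Longrightarrow> i \<in> {1..N} \<Longrightarrow> q i x \<in> {1..N}"
  using strategy measurable_space[of "q i" P "count_space {1..N}" x]
  by (auto simp: query_strategy_def)

lemma exposed_subset: "x \<in> space P \<Longrightarrow> i \<le> N \<Longrightarrow> exposed i x \<subseteq> {1..N}"
  using q_range[of x] by (fastforce simp: exposed_def)

text \<open>Strong induction on \<open>j\<close>. The range reaches \<open>Suc i\<close>, one beyond
  the exposed values, because the next index is a function of the first \<open>i\<close> values
  only; \<open>min N\<close> keeps it within the queries that the strategy regulates.\<close>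

lemma q_agree:
  assumes "x \<in> space P" "y \<in> space P" "i \<le> N" "\<And>j. j \<in> exposed i x \<Longrightarrow> x j = y j"
  shows "j \<in> {1..min N (Suc i)} \<Longrightarrow> q j x = q j y"
proof (induction j rule: less_induct)
  case (less j)
  have "\<forall>l\<in>{1..<j}. x (q l x) = y (q l y)"
  proof
    fix l assume l: "l \<in> {1..<j}"
    then have "q l x = q l y" using less by auto
    moreover have "q l x \<in> exposed i x" using l less.prems by (auto simp: exposed_def)
    ultimately show "x (q l x) = y (q l y)" using assms(4) by metis
  qed
  moreover have "j \<in> {1..N}" using less.prems by auto
  moreover have "\<forall>i\<in>{1..N}. \<forall>x\<in>space P. \<forall>y\<in>space P.
      (\<forall>j\<in>{1..<i}. x (q j x) = y (q j y)) \<longrightarrow> q i x = q i y"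
    using strategy unfolding query_strategy_def outcomes_eq by (elim conjE)
  ultimately show ?case using assms(1,2) by blast
qed

lemma exposed_agree:
  assumes "x \<in> space P" "y \<in> space P" "i \<le> N" "\<And>j. j \<in> exposed i x \<Longrightarrow> x j = y j"
  shows "l \<le> min N (Suc i) \<Longrightarrow> exposed l y = exposed l x"
  using q_agree[OF assms] unfolding exposed_def by (intro image_cong refl) auto

lemma q_Suc:
  "\<forall>k\<in>{1..<N}. \<forall>x\<in>space P.
    if determined_by N m f (exposed k x) x then q (Suc k) x = q k x else q (Suc k) x \<notin> exposed k x"
  using strategy unfolding query_strategy_def outcomes_eq exposed_def by (elim conjE)

text \<open>While \<open>f\<close> is undetermined every query is new, and once determined it stays
  so. At time \<open>N\<close> the second alternative means that all coordinates are
  exposed.\<close>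

lemma exposed_determines:
  assumes "x \<in> space P" "1 \<le> k" "k \<le> N"
  shows "determined_by N m f (exposed k x) x \<or> card (exposed k x) = k"
  using assms(2,3)
proof (induction k rule: dec_induct)
  case base then show ?case by (simp add: exposed_def)
next
  case (step k)
  show ?case
  proof (cases "determined_by N m f (exposed k x) x")
    case True
    then show ?thesis by (auto simp: determined_by_def exposed_Suc)
  next
    case False
    have "k \<in> {1..<N}" using step by auto
    then have "q (Suc k) x \<notin> exposed k x" using q_Suc assms(1) False by simp
    then show ?thesis using step False by (simp add: exposed_Suc finite_exposed)
  qed
qed

lemma cexp_exposed_N:
  assumes "x \<in> space P" shows "cexp (exposed N x) f x = f x"
proof -
  have "determined_by N m f (exposed N x) x"
    using exposed_determines[OF assms N_pos order_refl]
  proof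
    assume "card (exposed N x) = N"
    then have "exposed N x = {1..N}"
      using exposed_subset[OF assms order_refl] by (intro card_subset_eq) auto
    moreover have "y = x" if "y \<in> space P" "\<forall>j\<in>{1..N}. y j = x j" for y
      using that assms by (auto simp: space_PiM intro: PiE_ext)
    ultimately show ?thesis by (auto simp: determined_by_def outcomes_eq)
  qed
  then have "f (mix (exposed N x) x y) = f x" if "y \<in> space P" for y
    using mix_in_space[OF assms that] by (auto simp: determined_by_def outcomes_eq mix_def)
  then have "cexp (exposed N x) f x = (\<integral>y. f x \<partial>P)"
    unfolding cexp_def by (intro Bochner_Integration.integral_cong) auto
  then show ?thesis by (simp add: P.prob_space)
qed

lemma q_measurable: "i \<in> {1..N} \<Longrightarrow> q i \<in> measurable P (count_space {1..N})"
  using strategy by (auto simp: query_strategy_def)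

lemma exposed_measurable:
  assumes "i \<le> N" shows "exposed i \<in> measurable P (count_space (Pow {1..N}))"
  using assms
proof (induction i)
  case 0 then show ?case by (simp add: exposed_0)
next
  case (Suc i)
  then have IH: "exposed i \<in> measurable P (count_space (Pow {1..N}))" by simp
  have "(\<lambda>x. insert (q (Suc i) x) (exposed i x)) \<in> measurable P (count_space (Pow {1..N}))"
  proof (rule measurable_compose_countable'[where I="{1..N}" and g="q (Suc i)"])
    fix k assume "k \<in> {1..N}"
    then have "insert k \<in> measurable (count_space (Pow {1..N})) (count_space (Pow {1..N}))"
      by auto
    then show "(\<lambda>x. insert k (exposed i x)) \<in> measurable P (count_space (Pow {1..N}))"
      by (rule measurable_compose[OF IH])
  next
    show "q (Suc i) \<in> measurable P (count_space {1..N})" using Suc.prems by (intro q_measurable) simp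
  qed simp
  then show ?case by (simp add: exposed_Suc)
qed

lemma measurable_exposed_dep:
  assumes "i \<le> N" "\<And>A. A \<subseteq> {1..N} \<Longrightarrow> g A \<in> measurable P Q"
  shows "(\<lambda>x. g (exposed i x) x) \<in> measurable P Q"
proof (rule measurable_compose_countable'[where f=g, OF _ exposed_measurable[OF assms(1)]])
  show "g A \<in> measurable P Q" if "A \<in> Pow {1..N}" for A using that assms(2) by blast
qed (simp add: countable_finite)

lemma integral_cexp_exposed:
  assumes "bdd h" "i \<le> N"
  shows "(\<integral>x. cexp (exposed i x) h x \<partial>P) = (\<integral>x. h x \<partial>P)"
proof (rule integral_stopping[OF assms(1) exposed_measurable[OF assms(2)]])
  fix x y assume "x \<in> space P" "y \<in> space P" "\<And>j. j \<in> exposed i x \<Longrightarrow> x j = y j"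
  then show "exposed i y = exposed i x" using assms(2) by (intro exposed_agree[of x y i]) auto
qed

text \<open>Passes from a sum over time to a sum over the query set: each exposed index is fresh
  exactly once.\<close>

lemma sum_fresh:
  "(\<Sum>i<n. if fresh i x then \<psi> (q (Suc i) x) else 0) = (\<Sum>k\<in>exposed n x. \<psi> k :: 'b :: comm_monoid_add)"
  by (induction n) (auto simp: exposed_0 exposed_Suc fresh_def insert_absorb finite_exposed add.commute)

text \<open>The martingale increment of step \<open>i + 1\<close> on the history of \<open>x\<close> when the newly exposed
  coordinate shows the value from \<open>y\<close>.\<close>

definition incr :: "nat \<Rightarrow> (nat \<Rightarrow> 'a) \<Rightarrow> (nat \<Rightarrow> 'a) \<Rightarrow> real" where
  "incr i x y = cexp (exposed (Suc i) x) f (mix (exposed i x) x y) - cexp (exposed i x) f x"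

definition mgf :: "real \<Rightarrow> nat \<Rightarrow> (nat \<Rightarrow> 'a) \<Rightarrow> real" where
  "mgf l i x = (\<integral>y. exp (l * incr i x y) \<partial>P)"

lemma mgf_not_fresh: "\<not> fresh i x \<Longrightarrow> mgf l i x = 1"
  by (simp add: mgf_def incr_def fresh_def exposed_Suc insert_absorb cexp_mix P.prob_space)

lemma bdd_incr: "bdd f \<Longrightarrow> x \<in> space P \<Longrightarrow> bdd (incr i x)"
  unfolding incr_def by (rule bdd_diff[OF bdd_mix[OF bdd_cexp] bdd_const])

lemma bdd_exp_incr: "bdd f \<Longrightarrow> x \<in> space P \<Longrightarrow> bdd (\<lambda>y. exp (l * incr i x y))"
  by (rule bdd_exp[OF bdd_mult[OF bdd_const bdd_incr]])

lemma integral_incr: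
  assumes "bdd f" "x \<in> space P" shows "(\<integral>y. incr i x y \<partial>P) = 0"
proof -
  have "(\<integral>y. incr i x y \<partial>P)
      = (\<integral>y. cexp (exposed (Suc i) x) f (mix (exposed i x) x y) \<partial>P) - (\<integral>y. cexp (exposed i x) f x \<partial>P)"
    unfolding incr_def
    by (rule Bochner_Integration.integral_diff[OF bdd_integrable[OF bdd_mix[OF bdd_cexp[OF assms(1)] assms(2)]]
          bdd_integrable[OF bdd_const]])
  then show ?thesis
    using assms by (simp add: integral_cexp_mix exposed_mono P.prob_space)
qed

lemma incr_bound:
  assumes "bdd f" "\<And>x. x \<in> space P \<Longrightarrow> \<bar>f x\<bar> \<le> K" "x \<in> space P" "y \<in> space P"
  shows "\<bar>incr i x y\<bar> \<le> 2 * K"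
proof -
  have "\<bar>cexp (exposed (Suc i) x) f (mix (exposed i x) x y)\<bar> \<le> K" "\<bar>cexp (exposed i x) f x\<bar> \<le> K"
    using assms by (auto intro!: abs_cexp_le mix_in_space)
  then show ?thesis by (auto simp: incr_def)
qed

lemma incr_self: "incr i x x = cexp (exposed (Suc i) x) f x - cexp (exposed i x) f x"
  by (simp add: incr_def mix_simps)

definition weight :: "real \<Rightarrow> nat \<Rightarrow> (nat \<Rightarrow> 'a) \<Rightarrow> real" where
  "weight l i x = exp (l * incr i x x) / mgf l i x"

lemma exp_mgf_bounds:
  assumes "bdd f" "\<And>x. x \<in> space P \<Longrightarrow> \<bar>f x\<bar> \<le> K" "x \<in> space P" "0 \<le> l"
  shows "exp (- (l * (2 * K))) \<le> mgf l i x"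
proof -
  have "(\<integral>y. exp (- (l * (2 * K))) \<partial>P) \<le> mgf l i x"
    unfolding mgf_def
  proof (rule integral_mono[OF bdd_integrable[OF bdd_const] bdd_integrable[OF bdd_exp_incr[OF assms(1,3)]]])
    fix y assume "y \<in> space P"
    then have "\<bar>incr i x y\<bar> \<le> 2 * K" using incr_bound[of K x y i] assms by auto
    then have "l * (- (2 * K)) \<le> l * incr i x y" using assms(4) by (intro mult_left_mono) auto
    then show "exp (- (l * (2 * K))) \<le> exp (l * incr i x y)" by simp
  qed
  then show ?thesis by (simp add: P.prob_space)
qed

lemma mgf_pos: assumes "bdd f" "x \<in> space P" "0 \<le> l" shows "0 < mgf l i x"
proof -
  obtain K where "\<And>x. x \<in> space P \<Longrightarrow> \<bar>f x\<bar> \<le> K" using bdd_bound[OF assms(1)] by metis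
  from exp_mgf_bounds[OF assms(1) this assms(2,3)] show ?thesis
    by (meson exp_gt_zero less_le_trans)
qed

lemma mgf_measurable:
  assumes "bdd f" "i < N" shows "mgf l i \<in> borel_measurable P"
proof -
  have [measurable]: "cexp A f \<in> borel_measurable P" for A
    using bdd_cexp[OF assms(1)] by (rule bdd_measurable)
  have "(\<lambda>x. \<integral>y. exp (l * (cexp B f (mix A x y) - cexp A f x)) \<partial>P) \<in> borel_measurable P" for A B
    by measurable
  \<comment> \<open>The integrand contains two random sets. They are made random one after the
    other, first the history \<open>exposed i x\<close> with \<open>B\<close> fixed, then
    \<open>B\<close> itself.\<close>
  then have "(\<lambda>x. \<integral>y. exp (l * (cexp B f (mix (exposed i x) x y) - cexp (exposed i x) f x)) \<partial>P)
      \<in> borel_measurable P" for B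
    using less_imp_le[OF assms(2)]
    by (intro measurable_exposed_dep[where
          g="\<lambda>A x. \<integral>y. exp (l * (cexp B f (mix A x y) - cexp A f x)) \<partial>P"])
  then have "(\<lambda>x. \<integral>y. exp (l * (cexp (exposed (Suc i) x) f (mix (exposed i x) x y) - cexp (exposed i x) f x)) \<partial>P)
      \<in> borel_measurable P"
    using Suc_leI[OF assms(2)]
    by (intro measurable_exposed_dep[where i="Suc i" and
          g="\<lambda>B x. \<integral>y. exp (l * (cexp B f (mix (exposed i x) x y) - cexp (exposed i x) f x)) \<partial>P"])
  then show ?thesis by (simp add: mgf_def[abs_def] incr_def)
qed

lemma bdd_weight:
  assumes "bdd f" "i < N" "0 \<le> l" shows "bdd (weight l i)"
proof -
  obtain K where K: "\<And>x. x \<in> space P \<Longrightarrow> \<bar>f x\<bar> \<le> K" using bdd_bound[OF assms(1)] by metis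
  have c: "cexp A f \<in> borel_measurable P" for A
    using bdd_cexp[OF assms(1)] by (rule bdd_measurable)
  have [measurable]: "(\<lambda>x. cexp (exposed i x) f x) \<in> borel_measurable P"
    "(\<lambda>x. cexp (exposed (Suc i) x) f x) \<in> borel_measurable P" "mgf l i \<in> borel_measurable P"
    using measurable_exposed_dep[where g="\<lambda>A. cexp A f" and i=i]
      measurable_exposed_dep[where g="\<lambda>A. cexp A f" and i="Suc i"] c mgf_measurable assms(1,2)
    by simp_all
  show ?thesis
  proof (rule bddI)
    show "weight l i \<in> borel_measurable P"
      unfolding weight_def[abs_def] incr_self by measurable
    fix x assume x: "x \<in> space P"
    have "l * incr i x x \<le> l * (2 * K)"
      using incr_bound[OF assms(1) K x x, of i] assms(3) by (intro mult_left_mono) auto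
    then have "weight l i x \<le> exp (l * (2 * K)) / exp (- (l * (2 * K)))"
      unfolding weight_def using exp_mgf_bounds[OF assms(1) K x assms(3)] by (intro frac_le) auto
    moreover have "0 \<le> weight l i x"
      using mgf_pos[OF assms(1) x assms(3), of i] by (simp add: weight_def)
    ultimately show "\<bar>weight l i x\<bar> \<le> exp (l * (2 * K)) / exp (- (l * (2 * K)))" by simp
  qed
qed

lemma bdd_prod_weight:
  assumes "bdd f" "i \<le> N" "0 \<le> l" shows "bdd (\<lambda>x. \<Prod>j<i. weight l j x)"
  using assms(2)
proof (induction i)
  case 0 then show ?case by (simp add: bdd_const)
next
  case (Suc i)
  then show ?case using bdd_mult[OF Suc.IH bdd_weight[OF assms(1) _ assms(3)], of i] by simp
qed

lemma mgf_agree: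
  assumes "x \<in> space P" "y \<in> space P" "i < N" "\<And>j. j \<in> exposed i x \<Longrightarrow> x j = y j"
  shows "mgf l i y = mgf l i x"
proof -
  have e: "exposed i y = exposed i x" "exposed (Suc i) y = exposed (Suc i) x"
    using exposed_agree[of x y i] assms by simp_all
  have "mix (exposed i x) y z = mix (exposed i x) x z" for z
    using assms(4) by (auto simp: mix_def)
  then show ?thesis
    using cexp_cong[of "exposed i x" y x f] assms(4) by (simp add: mgf_def incr_def e)
qed

lemma weight_agree:
  assumes "x \<in> space P" "y \<in> space P" "i < N" "\<And>j. j \<in> exposed (Suc i) x \<Longrightarrow> x j = y j"
  shows "weight l i y = weight l i x"
proof -
  have a: "j \<in> exposed i x \<Longrightarrow> x j = y j" for j using assms(4) by (simp add: exposed_Suc)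
  have e: "exposed i y = exposed i x" "exposed (Suc i) y = exposed (Suc i) x"
    using exposed_agree[of x y i] assms(1-3) a by simp_all
  show ?thesis
    using mgf_agree[OF assms(1,2,3) a] cexp_cong[of "exposed i x" y x f]
      cexp_cong[of "exposed (Suc i) x" y x f] a assms(4)
    by (simp add: weight_def incr_self e)
qed

text \<open>Dividing each exponential increment by its conditional moment generating function makes the
  product a martingale, whatever the strategy does.\<close>

lemma integral_prod_weight:
  assumes "bdd f" "0 \<le> l" "i \<le> N"
  shows "(\<integral>x. (\<Prod>j<i. weight l j x) \<partial>P) = 1"
  using assms(3)
proof (induction i)
  case 0 then show ?case by (simp add: P.prob_space)
next
  case (Suc i)
  have i: "i < N" "i \<le> N" using Suc by auto
  have "(\<integral>x. (\<Prod>j<Suc i. weight l j x) \<partial>P)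
      = (\<integral>x. cexp (exposed i x) (\<lambda>x. \<Prod>j<Suc i. weight l j x) x \<partial>P)"
    using Suc.prems assms i
    by (intro integral_cexp_exposed[OF bdd_prod_weight, symmetric])
  also have "\<dots> = (\<integral>x. (\<Prod>j<i. weight l j x) \<partial>P)"
  proof (intro Bochner_Integration.integral_cong refl)
    fix x assume x: "x \<in> space P"
    have "(\<Prod>j<Suc i. weight l j (mix (exposed i x) x y))
        = (\<Prod>j<i. weight l j x) * (exp (l * incr i x y) / mgf l i x)" if y: "y \<in> space P" for y
    proof -
      let ?z = "mix (exposed i x) x y"
      have z: "?z \<in> space P" "\<And>j. j \<in> exposed i x \<Longrightarrow> x j = ?z j"
        using mix_in_space[OF x y] by (auto simp: mix_def)
      \<comment> \<open>Resampling outside \<open>exposed i x\<close> leaves the earlier weights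
        unchanged, since they depend on exposed values only. The last weight becomes the exponential
        increment over \<open>mgf l i x\<close>, whose average over \<open>y\<close> is 1.\<close>
      have "weight l j ?z = weight l j x" if "j < i" for j
        using z exposed_mono[of "Suc j" i x] that i by (intro weight_agree x) auto
      moreover have "weight l i ?z = exp (l * incr i x y) / mgf l i x"
      proof -
        have "exposed i ?z = exposed i x" "exposed (Suc i) ?z = exposed (Suc i) x"
          using exposed_agree[OF x z(1) i(2) z(2)] i by auto
        then show ?thesis
          using mgf_agree[OF x z(1) i(1) z(2), of l]
          by (simp add: weight_def incr_self) (simp add: incr_def cexp_mix)
      qed
      ultimately show ?thesis by simp
    qed
    then have "cexp (exposed i x) (\<lambda>x. \<Prod>j<Suc i. weight l j x) x
        = (\<integral>y. (\<Prod>j<i. weight l j x) * (exp (l * incr i x y) / mgf l i x) \<partial>P)"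
      unfolding cexp_def by (intro Bochner_Integration.integral_cong refl)
    also have "\<dots> = (\<Prod>j<i. weight l j x) * (mgf l i x / mgf l i x)"
      by (simp add: mgf_def)
    finally show "cexp (exposed i x) (\<lambda>x. \<Prod>j<Suc i. weight l j x) x = (\<Prod>j<i. weight l j x)"
      using mgf_pos[OF assms(1) x assms(2), of i] by simp
  qed
  finally show ?case using Suc by simp
qed

lemma prod_weight:
  "x \<in> space P \<Longrightarrow> (\<Prod>i<N. weight l i x) = exp (l * (f x - integral\<^sup>L P f)) / (\<Prod>i<N. mgf l i x)"
proof -
  assume x: "x \<in> space P"
  have "(\<Prod>i<n. weight l i x)
      = exp (l * (cexp (exposed n x) f x - integral\<^sup>L P f)) / (\<Prod>i<n. mgf l i x)" for n
    by (induction n)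
       (simp_all add: exposed_0 cexp_empty weight_def incr_self mult_exp_exp algebra_simps)
  from this[of N] x show ?thesis by (simp add: cexp_exposed_N)
qed

text \<open>The product of the weights has mean 1 and is nonnegative everywhere. On the part of
  \<open>E\<close> in the tail it is at least \<open>exp (l * t - \<Psi>)\<close>, because there the
  accumulated generating functions are at most \<open>exp \<Psi>\<close>. Outside \<open>E\<close>
  nothing about them is required.\<close>

lemma chernoff:
  assumes "bdd f" "0 \<le> l" "E \<in> sets P"
    and step: "\<And>x i. x \<in> E \<Longrightarrow> i < N \<Longrightarrow> fresh i x \<Longrightarrow> mgf l i x \<le> exp (\<psi> (q (Suc i) x))"
    and total: "\<And>x. x \<in> E \<Longrightarrow> (\<Sum>k\<in>exposed N x. \<psi> k) \<le> \<Psi>"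
  shows "measure P {x\<in>E. integral\<^sup>L P f + t \<le> f x} \<le> exp (\<Psi> - l * t)"
proof -
  let ?F = "{x\<in>E. integral\<^sup>L P f + t \<le> f x}"
  have E: "x \<in> E \<Longrightarrow> x \<in> space P" for x using assms(3) sets.sets_into_space by blast
  have F: "?F \<in> sets P"
  proof -
    have "?F = E \<inter> {x\<in>space P. integral\<^sup>L P f + t \<le> f x}" using E by auto
    then show ?thesis using assms(3) by simp
  qed
  have "measure P ?F = (\<integral>x. indicator ?F x \<partial>P)" using F by simp
  also have "\<dots> \<le> (\<integral>x. exp (\<Psi> - l * t) * (\<Prod>i<N. weight l i x) \<partial>P)"
  proof (rule integral_mono[OF bdd_integrable[OF bdd_indicator[OF F]]
        bdd_integrable[OF bdd_mult[OF bdd_const bdd_prod_weight[OF assms(1) order_refl assms(2)]]]])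
    fix x assume x: "x \<in> space P"
    have pos: "0 < (\<Prod>i<N. mgf l i x)" using mgf_pos[OF assms(1) x assms(2)] by (intro prod_pos) auto
    show "indicator ?F x \<le> exp (\<Psi> - l * t) * (\<Prod>i<N. weight l i x)"
    proof (cases "x \<in> ?F")
      case True
      have "(\<Prod>i<N. mgf l i x) \<le> (\<Prod>i<N. exp (if fresh i x then \<psi> (q (Suc i) x) else 0))"
        using True step mgf_pos[OF assms(1) x assms(2)] mgf_not_fresh
        by (intro prod_mono) (auto intro: less_imp_le)
      also have "\<dots> = exp (\<Sum>k\<in>exposed N x. \<psi> k)"
        by (simp add: exp_sum[symmetric] sum_fresh)
      also have "\<dots> \<le> exp \<Psi>" using total True by simp
      finally have L: "(\<Prod>i<N. mgf l i x) \<le> exp \<Psi>" .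
      have "l * t \<le> l * (f x - integral\<^sup>L P f)" using True assms(2) by (intro mult_left_mono) auto
      then have "exp (l * t) / exp \<Psi> \<le> (\<Prod>i<N. weight l i x)"
        unfolding prod_weight[OF x] using L pos by (intro frac_le) auto
      then have "exp (\<Psi> - l * t) * (exp (l * t) / exp \<Psi>) \<le> exp (\<Psi> - l * t) * (\<Prod>i<N. weight l i x)"
        by (intro mult_left_mono) auto
      moreover have "exp (\<Psi> - l * t) * (exp (l * t) / exp \<Psi>) = 1" by (simp add: exp_diff)
      ultimately show ?thesis using True by simp
    next
      case False
      then show ?thesis using pos by (simp add: prod_weight[OF x])
    qed
  qed
  also have "\<dots> = exp (\<Psi> - l * t)" using integral_prod_weight[OF assms(1,2)] by simp
  finally show ?thesis .
qed

end

section \<open>Tail bounds from bounds on the increments\<close>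

context query_process begin

lemma query_sets_eq: "query_sets N m q = exposed N ` space P"
  by (simp add: query_sets_def exposed_def outcomes_eq)

lemma finite_query_sets: "finite (query_sets N m q)"
proof (rule finite_subset)
  show "query_sets N m q \<subseteq> Pow {1..N}" using exposed_subset by (auto simp: query_sets_eq)
qed simp

lemma query_set_nonempty: "Q \<in> query_sets N m q \<Longrightarrow> Q \<noteq> {} \<and> finite Q"
  using N_pos by (auto simp: query_sets_eq exposed_def)

lemma sum_le_Max:
  fixes \<psi> :: "nat \<Rightarrow> real"
  assumes "x \<in> space P" shows "(\<Sum>k\<in>exposed N x. \<psi> k) \<le> (MAX Q\<in>query_sets N m q. \<Sum>k\<in>Q. \<psi> k)"
  using assms finite_query_sets by (intro Max_ge) (auto simp: query_sets_eq)

lemma le_Max_Max: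
  fixes D :: "nat \<Rightarrow> real"
  assumes "x \<in> space P" "i < N"
  shows "D (q (Suc i) x) \<le> (MAX Q\<in>query_sets N m q. MAX k\<in>Q. D k)"
proof -
  have "q (Suc i) x \<in> exposed N x" using assms(2) by (auto simp: exposed_def)
  then have "D (q (Suc i) x) \<le> (MAX k\<in>exposed N x. D k)"
    using finite_exposed by (intro Max_ge) auto
  also have "\<dots> \<le> (MAX Q\<in>query_sets N m q. MAX k\<in>Q. D k)"
    using assms finite_query_sets by (intro Max_ge) (auto simp: query_sets_eq)
  finally show ?thesis .
qed

lemma Max_sum_nonneg:
  fixes \<psi> :: "nat \<Rightarrow> real"
  assumes "\<And>k. k \<in> {1..N} \<Longrightarrow> 0 \<le> \<psi> k"
  shows "0 \<le> (MAX Q\<in>query_sets N m q. \<Sum>k\<in>Q. \<psi> k)"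
proof -
  obtain x where x: "x \<in> space P" using P.not_empty by blast
  have "0 \<le> (\<Sum>k\<in>exposed N x. \<psi> k)"
    using exposed_subset[OF x order_refl] assms by (intro sum_nonneg) auto
  with sum_le_Max[OF x, of \<psi>] show ?thesis by simp
qed

lemma sum_mult_le_Max:
  fixes \<psi> :: "nat \<Rightarrow> real"
  assumes "x \<in> space P" "0 \<le> a"
  shows "(\<Sum>k\<in>exposed N x. \<psi> k * a) \<le> (MAX Q\<in>query_sets N m q. \<Sum>k\<in>Q. \<psi> k) * a"
  unfolding sum_distrib_right[symmetric] using assms by (intro mult_right_mono sum_le_Max)

text \<open>The parameter \<open>a\<close> is 1 for increments of absolute value at most
  \<open>D k\<close>, and 4 for increments confined to an interval of length
  \<open>D k\<close>.\<close>

lemma tail_gaussian: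
  assumes "bdd f" "E \<in> sets P" "0 < a" "0 \<le> t"
    and step: "\<And>x i l. x \<in> E \<Longrightarrow> i < N \<Longrightarrow> fresh i x \<Longrightarrow> 0 < l \<Longrightarrow>
      mgf l i x \<le> exp (l\<^sup>2 * (D (q (Suc i) x))\<^sup>2 / (2 * a))"
  shows "measure P {x\<in>E. integral\<^sup>L P f + t \<le> f x}
    \<le> exp_neg_quot (a * t\<^sup>2) (2 * (MAX Q\<in>query_sets N m q. \<Sum>k\<in>Q. (D k)\<^sup>2))"
proof (rule chernoff_gaussian)
  have E: "x \<in> E \<Longrightarrow> x \<in> space P" for x using assms(2) sets.sets_into_space by blast
  let ?S = "MAX Q\<in>query_sets N m q. \<Sum>k\<in>Q. (D k)\<^sup>2"
  fix l :: real assume l: "0 < l"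
  have "measure P {x\<in>E. integral\<^sup>L P f + t \<le> f x} \<le> exp (?S * (l\<^sup>2 / (2 * a)) - l * t)"
  proof (rule chernoff[OF assms(1) less_imp_le[OF l] assms(2)])
    show "mgf l i x \<le> exp ((D (q (Suc i) x))\<^sup>2 * (l\<^sup>2 / (2 * a)))" if "x \<in> E" "i < N" "fresh i x" for x i
      using step[OF that l] by (simp add: mult.commute)
    show "(\<Sum>k\<in>exposed N x. (D k)\<^sup>2 * (l\<^sup>2 / (2 * a))) \<le> ?S * (l\<^sup>2 / (2 * a))" if "x \<in> E" for x
      using E[OF that] assms(3) by (intro sum_mult_le_Max) auto
  qed
  then show "measure P {x\<in>E. integral\<^sup>L P f + t \<le> f x} \<le> exp (l\<^sup>2 * (2 * ?S) / (4 * a) - l * t)"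
    by (simp add: mult.commute)
qed (use assms Max_sum_nonneg[of "\<lambda>k. (D k)\<^sup>2"] in auto)

text \<open>The upper bound is cut off at 0 because \<open>D k\<close> may be negative at a
  coordinate with a single possible value, where the increment vanishes.\<close>

lemma tail_bennett:
  assumes "bdd f" "E \<in> sets P" "0 \<le> t"
    and v0: "\<And>k. k \<in> {1..N} \<Longrightarrow> 0 \<le> v k"
    and upper: "\<And>x i. x \<in> E \<Longrightarrow> i < N \<Longrightarrow> fresh i x \<Longrightarrow> AE y in P. incr i x y \<le> max 0 (D (q (Suc i) x))"
    and var: "\<And>x i. x \<in> E \<Longrightarrow> i < N \<Longrightarrow> fresh i x \<Longrightarrow> (\<integral>y. (incr i x y)\<^sup>2 \<partial>P) \<le> v (q (Suc i) x)"
    and C: "C = (MAX Q\<in>query_sets N m q. MAX k\<in>Q. D k)"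
    and V: "V = (MAX Q\<in>query_sets N m q. \<Sum>k\<in>Q. v k)"
  shows "measure P {x\<in>E. integral\<^sup>L P f + t \<le> f x} \<le> exp_neg_quot (t\<^sup>2) (2 * V + 2 * C * t / 3)"
    and "0 < V \<Longrightarrow> 0 < C \<Longrightarrow>
      measure P {x\<in>E. integral\<^sup>L P f + t \<le> f x} \<le> exp (- (V / C\<^sup>2 * phi (C * t / V)))"
proof -
  let ?p = "measure P {x\<in>E. integral\<^sup>L P f + t \<le> f x}"
  have E: "x \<in> E \<Longrightarrow> x \<in> space P" for x using assms(2) sets.sets_into_space by blast
  have V0: "0 \<le> V" unfolding V by (rule Max_sum_nonneg[OF v0])
  have up: "AE y in P. incr i x y \<le> max 0 C" if "x \<in> E" "i < N" "fresh i x" for x i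
    using upper[OF that] le_Max_Max[OF E[OF that(1)] that(2), of D] unfolding C
    by (auto elim!: eventually_mono)
  have b: "?p \<le> exp (V / C\<^sup>2 * (exp (l * C) - 1 - l * C) - l * t)" if "0 < l" "0 < C" for l
  proof -
    let ?R = "(exp (l * C) - 1 - l * C) / C\<^sup>2"
    have R: "0 \<le> ?R" using exp_ge_add_one_self[of "l * C"] by (intro divide_nonneg_nonneg) (linarith, simp)
    have "?p \<le> exp (V * ?R - l * t)"
    proof (rule chernoff[OF assms(1) less_imp_le[OF that(1)] assms(2)])
      show "mgf l i x \<le> exp (v (q (Suc i) x) * ?R)" if i: "x \<in> E" "i < N" "fresh i x" for x i
      proof -
        have x: "x \<in> space P" using E i(1) by blast
        have sq: "bdd (\<lambda>y. (incr i x y)\<^sup>2)"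
          unfolding power2_eq_square using bdd_mult[OF bdd_incr[OF assms(1) x] bdd_incr[OF assms(1) x]] .
        have "mgf l i x \<le> exp (v (q (Suc i) x) / C\<^sup>2 * (exp (l * C) - 1 - l * C))"
          unfolding mgf_def
          using up[OF i] \<open>0 < C\<close> \<open>0 < l\<close>
          by (intro P.bennett_mgf bdd_integrable bdd_incr[OF assms(1) x] sq bdd_exp_incr[OF assms(1) x]
              integral_incr[OF assms(1) x] var[OF i]) auto
        then show ?thesis by simp
      qed
      show "(\<Sum>k\<in>exposed N x. v k * ?R) \<le> V * ?R" if "x \<in> E" for x
        unfolding V using E[OF that] R by (rule sum_mult_le_Max)
    qed
    then show ?thesis by simp
  qed
  \<comment> \<open>The cases with no optimal l. If \<open>C \<le> 0\<close> the increments are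
    almost surely at most 0, so every generating function is at most 1; if \<open>V = 0\<close> the
    Bennett exponent vanishes. Either way the bound \<open>exp (- l * t)\<close> holds for all
    l.\<close>
  have zero: "?p \<le> 0" if "0 < t" "C \<le> 0 \<or> V = 0"
  proof (rule le_0_if_le_exp[OF _ that(1)])
    fix l :: real assume l: "0 < l"
    show "?p \<le> exp (- l * t)"
    proof (cases "C \<le> 0")
      case True
      have "?p \<le> exp (0 - l * t)"
      proof (rule chernoff[where \<psi>="\<lambda>_. 0", OF assms(1) less_imp_le[OF l] assms(2)])
        fix x i assume i: "x \<in> E" "i < N" "fresh i x"
        have x: "x \<in> space P" using E i(1) by blast
        have "mgf l i x \<le> (\<integral>y. 1 \<partial>P)"
          unfolding mgf_def
        proof (rule integral_mono_AE[OF bdd_integrable[OF bdd_exp_incr[OF assms(1) x]] bdd_integrable[OF bdd_const]])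
          show "AE y in P. exp (l * incr i x y) \<le> 1"
            using up[OF i] True l by (auto elim!: eventually_mono simp: mult_nonneg_nonpos)
        qed
        then show "mgf l i x \<le> exp 0" by (simp add: P.prob_space)
      qed simp
      then show ?thesis by simp
    next
      case False
      then show ?thesis using b[OF l] that by simp
    qed
  qed
  show "0 < V \<Longrightarrow> 0 < C \<Longrightarrow> ?p \<le> exp (- (V / C\<^sup>2 * phi (C * t / V)))"
  proof (cases "t = 0")
    case True
    then show ?thesis by (simp add: phi_def)
  next
    case False
    assume "0 < V" "0 < C"
    then show ?thesis using chernoff_bennett(1)[of ?p V C t, OF b] False assms(3) by simp
  qed
  show "?p \<le> exp_neg_quot (t\<^sup>2) (2 * V + 2 * C * t / 3)"
  proof (cases "t = 0")
    case True
    then show ?thesis by (simp add: exp_neg_quot_0)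
  next
    case False
    then have t: "0 < t" using assms(3) by simp
    show ?thesis
    proof (cases "C \<le> 0 \<or> V = 0")
      case True
      then show ?thesis using zero[OF t] exp_neg_quot_nonneg order_trans by blast
    next
      case False
      then show ?thesis using chernoff_bennett(2)[of ?p V C t, OF b] t V0 by simp
    qed
  qed
qed

lemma mgf_le_of_abs_bound:
  assumes "bdd f" "x \<in> space P" "0 < l" "AE y in P. \<bar>incr i x y\<bar> \<le> \<bar>D\<bar>"
  shows "mgf l i x \<le> exp (l\<^sup>2 * D\<^sup>2 / (2 * 1))"
proof -
  have "mgf l i x \<le> exp (l\<^sup>2 * (\<bar>D\<bar> - (- \<bar>D\<bar>))\<^sup>2 / 8)"
    unfolding mgf_def using assms(4)
    by (intro P.hoeffding_mgf bdd_measurable bdd_incr integral_incr assms) (auto elim!: eventually_mono)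
  also have "(\<bar>D\<bar> - (- \<bar>D\<bar>))\<^sup>2 = 4 * D\<^sup>2" by (simp add: power2_eq_square)
  finally show ?thesis by (simp add: mult.commute)
qed

text \<open>With the infimum of the increment as left endpoint, its values lie in an interval of
  length \<open>\<bar>D\<bar>\<close>. A bound on the absolute value would only give length
  \<open>2 * \<bar>D\<bar>\<close>, which costs the factor 4.\<close>

lemma mgf_le_of_oscillation:
  assumes "bdd f" "x \<in> space P" "0 < l" "AE y in P. y \<in> S" "S \<subseteq> space P"
    and osc: "\<And>y y'. y \<in> S \<Longrightarrow> y' \<in> S \<Longrightarrow> \<bar>incr i x y - incr i x y'\<bar> \<le> \<bar>D\<bar>"
  shows "mgf l i x \<le> exp (l\<^sup>2 * D\<^sup>2 / (2 * 4))"
proof -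
  obtain y0 where y0: "y0 \<in> S"
  proof -
    have "S \<noteq> {}" using assms(4) P.not_empty by (auto simp: P.AE_False)
    then show ?thesis using that by blast
  qed
  define a where "a = (INF y\<in>S. incr i x y)"
  have bb: "bdd_below (incr i x ` S)"
  proof (rule bdd_belowI2)
    show "incr i x y0 - \<bar>D\<bar> \<le> incr i x y" if "y \<in> S" for y using osc[OF y0 that] by linarith
  qed
  have "incr i x y \<in> {a..a + \<bar>D\<bar>}" if y: "y \<in> S" for y
  proof -
    have "a \<le> incr i x y" unfolding a_def using bb y by (rule cINF_lower)
    moreover have "incr i x y - \<bar>D\<bar> \<le> a" unfolding a_def
    proof (rule cINF_greatest)
      show "S \<noteq> {}" using y0 by blast
      show "incr i x y - \<bar>D\<bar> \<le> incr i x y'" if "y' \<in> S" for y' using osc[OF y that] by linarith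
    qed
    ultimately show ?thesis by simp
  qed
  then have "AE y in P. incr i x y \<in> {a..a + \<bar>D\<bar>}" using assms(4) by (auto elim!: eventually_mono)
  then have "mgf l i x \<le> exp (l\<^sup>2 * (a + \<bar>D\<bar> - a)\<^sup>2 / 8)"
    unfolding mgf_def by (intro P.hoeffding_mgf bdd_measurable bdd_incr integral_incr assms)
  then show ?thesis by simp
qed

end

section \<open>The event of typical outcomes\<close>

context query_process begin

lemma incr_eq_fiber: "incr i x y = fiber (exposed i x) (q (Suc i) x) f x y - cexp (exposed i x) f x"
  by (simp add: incr_def fiber_def exposed_Suc)

lemma incr_cong: "y (q (Suc i) x) = y' (q (Suc i) x) \<Longrightarrow> incr i x y = incr i x y'"
  unfolding incr_eq_fiber by (drule fiber_cong) simp

text \<open>The risk is tested before each query, given the history alone, which is the information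
  available when the next increment is estimated. Only fresh steps are tested, so that the number of
  tests is governed by the query set and not by \<open>N\<close>.\<close>

definition typical :: "real \<Rightarrow> (nat \<Rightarrow> 'a) set \<Rightarrow> (nat \<Rightarrow> 'a) set" where
  "typical \<gamma> \<Gamma> = {x\<in>\<Gamma>. \<forall>i<N. fresh i x \<longrightarrow> cexp (exposed i x) (indicator (space P - \<Gamma>)) x \<le> \<gamma>}"

lemma typical_subset: "typical \<gamma> \<Gamma> \<subseteq> \<Gamma>"
  by (auto simp: typical_def)

lemma cexp_exposed_measurable:
  assumes "bdd h" "i \<le> N" shows "(\<lambda>x. cexp (exposed i x) h x) \<in> borel_measurable P"
  using measurable_exposed_dep[where g="\<lambda>A. cexp A h", OF assms(2)]
    bdd_measurable[OF bdd_cexp[OF assms(1)]] by blast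

lemma fresh_measurable:
  assumes "i < N" shows "{x\<in>space P. fresh i x} \<in> sets P"
proof -
  have "(\<lambda>x. q (Suc i) x \<notin> A) \<in> measurable P (count_space UNIV)" for A
    by (rule measurable_compose[OF q_measurable[of "Suc i"]]) (use assms in auto)
  then have "(\<lambda>x. q (Suc i) x \<notin> exposed i x) \<in> measurable P (count_space UNIV)"
    using measurable_exposed_dep[where g="\<lambda>A x. q (Suc i) x \<notin> A" and i=i] assms by simp
  then show ?thesis by (simp add: fresh_def pred_def)
qed

lemma typical_measurable:
  assumes "\<Gamma> \<in> sets P" shows "typical \<gamma> \<Gamma> \<in> sets P"
proof -
  let ?W = "indicator (space P - \<Gamma>) :: _ \<Rightarrow> real"
  have "bdd ?W" using assms by (intro bdd_indicator) auto
  then have b: "{x\<in>space P. cexp (exposed i x) ?W x \<le> \<gamma>} \<in> sets P" if "i < N" for i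
    using cexp_exposed_measurable[of ?W i] that by simp
  have "typical \<gamma> \<Gamma> = \<Gamma> \<inter> {x\<in>space P. \<forall>i\<in>{..<N}. x \<in> (space P - {x\<in>space P. fresh i x}) \<union> {x\<in>space P. cexp (exposed i x) ?W x \<le> \<gamma>}}"
    using sets.sets_into_space[OF assms] by (auto simp: typical_def)
  also have "\<dots> \<in> sets P"
    using assms fresh_measurable b by (intro sets.Int sets.sets_Collect_finite_All) auto
  finally show ?thesis .
qed

text \<open>If step \<open>i + 1\<close> is fresh then \<open>f\<close> was undetermined before it,
  so the first \<open>i\<close> queries were distinct and at least \<open>i + 1\<close> indices are
  exposed in the end. This limits the union bound to the largest query set.\<close>

lemma fresh_imp_lt_card:
  assumes "x \<in> space P" "i < N" "fresh i x"
  shows "i < card (exposed N x)"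
proof -
  have "card (exposed i x) = i"
  proof (cases "i = 0")
    case False
    then have k: "i \<in> {1..<N}" using assms by auto
    moreover have "q i x \<in> exposed i x" using k by (auto simp: exposed_def)
    ultimately have "\<not> determined_by N m f (exposed i x) x"
      using assms q_Suc unfolding fresh_def by metis
    then show ?thesis using exposed_determines[OF assms(1), of i] k by auto
  qed (simp add: exposed_0)
  then have "card (exposed (Suc i) x) = Suc i"
    using assms(3) by (simp add: exposed_Suc fresh_def finite_exposed)
  moreover have "card (exposed (Suc i) x) \<le> card (exposed N x)"
    using assms(2) by (intro card_mono exposed_mono finite_exposed) auto
  ultimately show ?thesis by simp
qed

text \<open>Before the first query the condition is not random, and if it fails the bound is trivial. This
  saves one term of the union bound, which pays for the complement of \<open>\<Gamma>\<close>.\<close>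

lemma prob_not_typical:
  assumes "\<Gamma> \<in> sets P" "0 < \<gamma>" "\<gamma> \<le> 1"
  shows "measure P (space P - typical \<gamma> \<Gamma>)
    \<le> (MAX Q\<in>query_sets N m q. \<Sum>k\<in>Q. 1 / \<gamma>) * measure P (space P - \<Gamma>)"
proof -
  let ?W = "indicator (space P - \<Gamma>) :: _ \<Rightarrow> real"
  let ?w = "measure P (space P - \<Gamma>)"
  let ?R = "MAX Q\<in>query_sets N m q. \<Sum>k\<in>Q. 1 / \<gamma>"
  have W: "space P - \<Gamma> \<in> sets P" using assms by auto
  note bW = bdd_indicator[OF W]
  obtain L where L: "?R = real L / \<gamma>" "1 \<le> L" "\<And>x. x \<in> space P \<Longrightarrow> card (exposed N x) \<le> L"
    and LN: "L \<le> N"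
  proof -
    have "?R \<in> (\<lambda>Q. \<Sum>k\<in>Q. 1 / \<gamma>) ` query_sets N m q"
      using finite_query_sets P.not_empty by (intro Max_in) (auto simp: query_sets_eq)
    then obtain Q where Q: "Q \<in> query_sets N m q" "?R = real (card Q) / \<gamma>" by auto
    have "real (card (exposed N x)) / \<gamma> \<le> real (card Q) / \<gamma>" if "x \<in> space P" for x
      using sum_le_Max[OF that, of "\<lambda>k. 1 / \<gamma>"] unfolding Q(2) by simp
    then have "card (exposed N x) \<le> card Q" if "x \<in> space P" for x
      using that assms(2) by (simp add: divide_le_cancel)
    moreover have "1 \<le> card Q"
      using query_set_nonempty[OF Q(1)] by (simp add: Suc_le_eq card_gt_0_iff One_nat_def)
    moreover have "card Q \<le> card {1..N}"
      using Q(1) exposed_subset by (intro card_mono) (auto simp: query_sets_eq)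
    ultimately show ?thesis using that[OF Q(2)] by simp
  qed
  show ?thesis
  proof (cases "?w \<le> \<gamma>")
    case False
    have "1 \<le> real L / \<gamma> * ?w"
      using L(2) False assms(2) mult_mono[of 1 "real L" \<gamma> ?w] by (simp add: field_simps)
    then show ?thesis using P.prob_le_1 order_trans unfolding L(1) by blast
  next
    case True
    define B where "B i = {x\<in>space P. \<gamma> < cexp (exposed i x) ?W x}" for i
    have B: "B i \<in> sets P" if "i < N" for i
      using cexp_exposed_measurable[OF bW, of i] that by (simp add: B_def)
    \<comment> \<open>Markov's inequality: the conditional probability of leaving \<Gamma> has mean
      \<open>?w\<close> at every time.\<close>
    have mB: "measure P (B i) \<le> ?w / \<gamma>" if "i < N" for i
    proof -
      have "measure P (B i) * \<gamma> = (\<integral>x. indicator (B i) x * \<gamma> \<partial>P)" using B[OF that] by simp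
      also have "\<dots> \<le> (\<integral>x. cexp (exposed i x) ?W x \<partial>P)"
      proof (rule integral_mono)
        show "integrable P (\<lambda>x. cexp (exposed i x) ?W x)"
          using cexp_exposed_measurable[OF bW, of i] that
          by (intro bdd_integrable bddI[where K=1] abs_cexp_le[OF bW]) (auto split: split_indicator)
        show "integrable P (\<lambda>x. indicator (B i) x * \<gamma>)"
          using B[OF that] by (intro bdd_integrable bdd_mult bdd_const bdd_indicator)
        fix x
        have "0 \<le> cexp (exposed i x) ?W x"
          unfolding cexp_def by (rule Bochner_Integration.integral_nonneg) simp
        then show "indicator (B i) x * \<gamma> \<le> cexp (exposed i x) ?W x"
          by (auto simp: B_def split: split_indicator)
      qed
      also have "\<dots> = ?w"
        using integral_cexp_exposed[OF bW, of i] that W by simp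
      finally show ?thesis using assms(2) by (simp add: field_simps)
    qed
    have sub: "space P - typical \<gamma> \<Gamma> \<subseteq> (space P - \<Gamma>) \<union> (\<Union>i\<in>{1..<L}. B i)"
    proof
      fix x assume x: "x \<in> space P - typical \<gamma> \<Gamma>"
      show "x \<in> (space P - \<Gamma>) \<union> (\<Union>i\<in>{1..<L}. B i)"
      proof (cases "x \<in> \<Gamma>")
        case True
        then obtain i where i: "i < N" "fresh i x" "\<gamma> < cexp (exposed i x) ?W x"
          using x by (auto simp: typical_def not_le)
        have "i \<noteq> 0"
        proof
          assume "i = 0"
          then have "cexp (exposed i x) ?W x = ?w" using W by (simp add: exposed_0 cexp_empty)
          then show False using i(3) \<open>?w \<le> \<gamma>\<close> by simp
        qed
        moreover have "i < L" using fresh_imp_lt_card[OF _ i(1,2)] L(3) x by force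
        ultimately show ?thesis using i x by (auto simp: B_def)
      qed (use x in auto)
    qed
    have BL: "B i \<in> sets P" if "i \<in> {1..<L}" for i using B that LN by auto
    have "measure P (space P - typical \<gamma> \<Gamma>) \<le> measure P ((space P - \<Gamma>) \<union> (\<Union>i\<in>{1..<L}. B i))"
      using sub W BL by (intro P.finite_measure_mono) auto
    also have "\<dots> \<le> ?w + measure P (\<Union>i\<in>{1..<L}. B i)"
      using W BL by (intro measure_Un_le) auto
    also have "measure P (\<Union>i\<in>{1..<L}. B i) \<le> (\<Sum>i\<in>{1..<L}. measure P (B i))"
      using BL by (intro measure_UNION_le) auto
    also have "\<dots> \<le> (\<Sum>i\<in>{1..<L}. ?w / \<gamma>)"
      using LN by (intro sum_mono mB) auto
    \<comment> \<open>Since \<gamma> is at most 1, the complement of \<Gamma> costs no more than the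
      term for time 0, which the union over \<open>{1..<L}\<close> omits.\<close>
    also have "?w + \<dots> \<le> ?w / \<gamma> + (real L - 1) * (?w / \<gamma>)"
      using L(2) assms(2,3) by (simp add: of_nat_diff field_simps mult_left_le_one_le)
    also have "\<dots> = ?R * ?w" unfolding L(1) using assms(2) by (simp add: divide_simps) (simp add: algebra_simps)
    finally show ?thesis by simp
  qed
qed

end

section \<open>Increments under typical bounded differences\<close>

text \<open>Differences are controlled only on a box that carries the law. With \<open>G k\<close>
  the whole space nothing is restricted; after conditioning coordinate \<open>k\<close> on
  \<open>G k\<close> a proper box has full measure too.\<close>

locale boxed_query = query_process +
  fixes G :: "nat \<Rightarrow> 'a set"
  assumes box_subset: "\<And>k. k \<in> {1..N} \<Longrightarrow> G k \<subseteq> space (m k)"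
    and AE_box: "AE z in P. z \<in> PiE {1..N} G"
    and bdd_f: "bdd f"
begin

abbreviation "region \<equiv> PiE {1..N} G"

lemma box_space: "x \<in> region \<Longrightarrow> x \<in> space P"
  unfolding space_PiM using PiE_mono[of "{1..N}" G "\<lambda>k. space (m k)"] box_subset by blast

text \<open>The alternative of a zero increment is needed for a coordinate with a single possible value: no
  two points differ there, so its Lipschitz constant, and with it the bound, may be negative.\<close>

lemma incr_alternatives:
  assumes x: "x \<in> space P" "i < N" and g: "bdd g"
    and pair: "\<And>y y'. y \<in> region \<Longrightarrow> y' \<in> region \<Longrightarrow> y (q (Suc i) x) \<noteq> y' (q (Suc i) x) \<Longrightarrow>
      \<bar>incr i x y - incr i x y'\<bar> \<le> g y'"
    and y: "y \<in> region"
  shows "incr i x y = 0 \<or> \<bar>incr i x y\<bar> \<le> (\<integral>y. g y \<partial>P)"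
proof -
  let ?k = "q (Suc i) x"
  have k: "?k \<in> {1..N}" using q_range[OF x(1), of "Suc i"] x(2) by auto
  note Z = bdd_incr[OF bdd_f x(1), of i] integral_incr[OF bdd_f x(1), of i]
  show ?thesis
  proof (cases "\<exists>\<eta>\<in>G ?k. \<exists>\<eta>'\<in>G ?k. \<eta> \<noteq> \<eta>'")
    case True
    have "AE y' in P. \<bar>incr i x y - incr i x y'\<bar> \<le> g y'"
      using AE_box
    proof eventually_elim
      case (elim y')
      obtain \<eta> where \<eta>: "\<eta> \<in> G ?k" "\<eta> \<noteq> y' ?k" using True by metis
      have "y'(?k := \<eta>) \<in> region" using elim k \<eta> by (auto simp: PiE_iff extensional_def)
      \<comment> \<open>The pair bound says nothing when \<open>y\<close> and \<open>y'\<close> show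
        the same value. A third point with a different value forces \<open>g y'\<close> to be
        nonnegative, which covers that case.\<close>
      then have "0 \<le> g y'" using pair[of "y'(?k := \<eta>)" y'] elim \<eta> by fastforce
      then show ?case using pair[OF y elim] incr_cong[of y i x y'] by (cases "y ?k = y' ?k") auto
    qed
    then show ?thesis using abs_centered_le[OF Z g] by blast
  next
    case False
    have "AE y' in P. \<bar>incr i x y - incr i x y'\<bar> \<le> 0"
      using AE_box
    proof eventually_elim
      case (elim y')
      have "y ?k \<in> G ?k" "y' ?k \<in> G ?k" using y elim k by auto
      then have "y ?k = y' ?k" using False by blast
      then show ?case using incr_cong[of y i x y'] by simp
    qed
    from abs_centered_le[OF Z bdd_const this] show ?thesis by simp
  qed
qed

lemma tail_abs:
  assumes "E \<in> sets P" "0 \<le> t"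
    and step: "\<And>x i y. x \<in> E \<Longrightarrow> i < N \<Longrightarrow> fresh i x \<Longrightarrow> y \<in> region \<Longrightarrow>
      incr i x y = 0 \<or> \<bar>incr i x y\<bar> \<le> D (q (Suc i) x)"
  shows "measure P {x\<in>E. integral\<^sup>L P f + t \<le> f x}
    \<le> exp_neg_quot (t\<^sup>2) (2 * (MAX Q\<in>query_sets N m q. \<Sum>k\<in>Q. (D k)\<^sup>2))"
proof -
  have "measure P {x\<in>E. integral\<^sup>L P f + t \<le> f x}
    \<le> exp_neg_quot (1 * t\<^sup>2) (2 * (MAX Q\<in>query_sets N m q. \<Sum>k\<in>Q. (D k)\<^sup>2))"
  proof (rule tail_gaussian[OF bdd_f assms(1) _ assms(2)])
    fix x i and l :: real assume x: "x \<in> E" "i < N" "fresh i x" and l: "0 < l"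
    show "mgf l i x \<le> exp (l\<^sup>2 * (D (q (Suc i) x))\<^sup>2 / (2 * 1))"
    proof (rule mgf_le_of_abs_bound[OF bdd_f _ l])
      show "x \<in> space P" using x(1) sets.sets_into_space[OF assms(1)] by blast
      show "AE y in P. \<bar>incr i x y\<bar> \<le> \<bar>D (q (Suc i) x)\<bar>"
        using AE_box
      proof eventually_elim
        case (elim y)
        from step[OF x this] show ?case by auto
      qed
    qed
  qed simp
  then show ?thesis by simp
qed

lemma oscillation_of_pairs:
  assumes "\<And>y y'. y \<in> region \<Longrightarrow> y' \<in> region \<Longrightarrow> y (q (Suc i) x) \<noteq> y' (q (Suc i) x) \<Longrightarrow>
      \<bar>incr i x y - incr i x y'\<bar> \<le> D"
    and "y \<in> region" "y' \<in> region"
  shows "\<bar>incr i x y - incr i x y'\<bar> \<le> \<bar>D\<bar>"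
  using assms(1)[OF assms(2,3)] incr_cong[of y i x y'] by (cases "y (q (Suc i) x) = y' (q (Suc i) x)") auto

lemma tail_oscillation:
  assumes "E \<in> sets P" "0 \<le> t"
    and step: "\<And>x i y y'. x \<in> E \<Longrightarrow> i < N \<Longrightarrow> fresh i x \<Longrightarrow> y \<in> region \<Longrightarrow> y' \<in> region \<Longrightarrow>
      y (q (Suc i) x) \<noteq> y' (q (Suc i) x) \<Longrightarrow> \<bar>incr i x y - incr i x y'\<bar> \<le> D (q (Suc i) x)"
  shows "measure P {x\<in>E. integral\<^sup>L P f + t \<le> f x}
    \<le> exp_neg_quot (4 * t\<^sup>2) (2 * (MAX Q\<in>query_sets N m q. \<Sum>k\<in>Q. (D k)\<^sup>2))"
proof (rule tail_gaussian[OF bdd_f assms(1) _ assms(2)])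
  fix x i and l :: real assume x: "x \<in> E" "i < N" "fresh i x" and l: "0 < l"
  show "mgf l i x \<le> exp (l\<^sup>2 * (D (q (Suc i) x))\<^sup>2 / (2 * 4))"
  proof (rule mgf_le_of_oscillation[OF bdd_f _ l AE_box])
    show "x \<in> space P" using x(1) sets.sets_into_space[OF assms(1)] by blast
    show "region \<subseteq> space P" using box_space by blast
    show "\<bar>incr i x y - incr i x y'\<bar> \<le> \<bar>D (q (Suc i) x)\<bar>" if "y \<in> region" "y' \<in> region" for y y'
      using oscillation_of_pairs[OF step[OF x] that] by blast
  qed
qed simp

lemma incr_upper:
  assumes "\<And>y. y \<in> region \<Longrightarrow> incr i x y = 0 \<or> \<bar>incr i x y\<bar> \<le> D"
  shows "AE y in P. incr i x y \<le> max 0 D"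
  using AE_box
proof eventually_elim
  case (elim y)
  from assms[OF this] show ?case by auto
qed

lemma tail_two_values:
  assumes "E \<in> sets P" "0 \<le> t"
    and step: "\<And>x i y y'. x \<in> E \<Longrightarrow> i < N \<Longrightarrow> fresh i x \<Longrightarrow> y \<in> region \<Longrightarrow> y' \<in> region \<Longrightarrow>
      y (q (Suc i) x) \<noteq> y' (q (Suc i) x) \<Longrightarrow> \<bar>incr i x y - incr i x y'\<bar> \<le> D (q (Suc i) x)"
    and two: "z \<noteq> u" "\<And>k. k \<in> {1..N} \<Longrightarrow> G k = {z, u}" "\<And>k. k \<in> {1..N} \<Longrightarrow> space (m k) = {z, u}"
      "\<And>k. k \<in> {1..N} \<Longrightarrow> {u} \<in> sets (m k)"
    and p: "\<And>k. k \<in> {1..N} \<Longrightarrow> p k = measure P {y\<in>space P. y k = u}"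
    and C: "C = (MAX Q\<in>query_sets N m q. MAX k\<in>Q. D k)"
    and V: "V = (MAX Q\<in>query_sets N m q. \<Sum>k\<in>Q. (1 - p k) * p k * (D k)\<^sup>2)"
  shows "measure P {x\<in>E. integral\<^sup>L P f + t \<le> f x} \<le> exp_neg_quot (t\<^sup>2) (2 * V + 2 * C * t / 3)
    \<and> (0 < V \<and> 0 < C \<longrightarrow>
      measure P {x\<in>E. integral\<^sup>L P f + t \<le> f x} \<le> exp (- (V / C\<^sup>2 * phi (C * t / V))))"
proof -
  have E: "x \<in> E \<Longrightarrow> x \<in> space P" for x using assms(1) sets.sets_into_space by blast
  have "region = space P" using two(2,3) by (auto simp: space_PiM intro!: PiE_cong)
  have v0: "0 \<le> (1 - p k) * p k * (D k)\<^sup>2" if "k \<in> {1..N}" for k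
    unfolding p[OF that] by simp
  have upper: "AE y in P. incr i x y \<le> max 0 (D (q (Suc i) x))" if i: "x \<in> E" "i < N" "fresh i x" for x i
  proof (rule incr_upper)
    fix y assume "y \<in> region"
    from incr_alternatives[OF E[OF i(1)] i(2) bdd_const step[OF i] this]
    show "incr i x y = 0 \<or> \<bar>incr i x y\<bar> \<le> D (q (Suc i) x)" by (simp add: P.prob_space)
  qed
  have var: "(\<integral>y. (incr i x y)\<^sup>2 \<partial>P) \<le> (1 - p (q (Suc i) x)) * p (q (Suc i) x) * (D (q (Suc i) x))\<^sup>2"
    if i: "x \<in> E" "i < N" "fresh i x" for x i
  proof -
    let ?k = "q (Suc i) x"
    have x: "x \<in> space P" using E i by blast
    have k: "?k \<in> {1..N}" using q_range[OF x, of "Suc i"] i(2) by auto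
    have sp: "x(?k := w) \<in> space P" if "w \<in> {z, u}" for w
      using x that two(3) k by (auto simp: space_PiM PiE_iff extensional_def)
    show ?thesis unfolding p[OF k]
    proof (rule variance_two_values[OF bdd_incr[OF bdd_f x] integral_incr[OF bdd_f x]
          coordinate_atom_sets[OF k two(4)[OF k]]])
      show "incr i x y = (if y \<in> {y \<in> space P. y ?k = u} then incr i x (x(?k := u)) else incr i x (x(?k := z)))"
        if y: "y \<in> space P" for y
      proof -
        have "y ?k \<in> space (m ?k)" using y k by (auto simp: space_PiM)
        then have "y ?k = u \<or> y ?k = z" using two(3)[OF k] by auto
        then show ?thesis
          using y two(1) incr_cong[of y i x "x(?k := u)"] incr_cong[of y i x "x(?k := z)"] by auto
      qed
      show "\<bar>incr i x (x(?k := u)) - incr i x (x(?k := z))\<bar> \<le> D ?k"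
        using two(1) sp \<open>region = space P\<close> by (intro step[OF i]) auto
    qed
  qed
  show ?thesis
    using tail_bennett[OF bdd_f assms(1,2) v0 upper var C V] by blast
qed

text \<open>Two constants are needed: \<open>D\<close> bounds the increments themselves and yields
  \<open>C\<close>, while \<open>D'\<close> bounds their distance to the increment at the likely
  value and yields the variance. The latter cannot be averaged over the other end of the pair, so it
  may be larger.\<close>

lemma tail_atom:
  assumes "E \<in> sets P" "0 \<le> t"
    and step: "\<And>x i y. x \<in> E \<Longrightarrow> i < N \<Longrightarrow> fresh i x \<Longrightarrow> y \<in> region \<Longrightarrow>
      incr i x y = 0 \<or> \<bar>incr i x y\<bar> \<le> D (q (Suc i) x)"
    and region: "region = space P"
    and atom: "\<And>k. k \<in> {1..N} \<Longrightarrow> \<eta> k \<in> space (m k)" "\<And>k. k \<in> {1..N} \<Longrightarrow> {\<eta> k} \<in> sets (m k)"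
      "\<And>k. k \<in> {1..N} \<Longrightarrow> 1 - p k \<le> measure P {y\<in>space P. y k = \<eta> k}"
    and pair: "\<And>x i y y'. x \<in> E \<Longrightarrow> i < N \<Longrightarrow> fresh i x \<Longrightarrow> y \<in> region \<Longrightarrow> y' \<in> region \<Longrightarrow>
      y (q (Suc i) x) \<noteq> y' (q (Suc i) x) \<Longrightarrow> y' (q (Suc i) x) = \<eta> (q (Suc i) x) \<Longrightarrow>
      \<bar>incr i x y - incr i x y'\<bar> \<le> D' (q (Suc i) x)"
    and C: "C = (MAX Q\<in>query_sets N m q. MAX k\<in>Q. D k)"
    and V: "V = (MAX Q\<in>query_sets N m q. \<Sum>k\<in>Q. p k * (D' k)\<^sup>2)"
  shows "measure P {x\<in>E. integral\<^sup>L P f + t \<le> f x} \<le> exp_neg_quot (t\<^sup>2) (2 * V + 2 * C * t / 3)"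
proof (rule tail_bennett(1)[OF bdd_f assms(1,2) _ _ _ C V])
  have E: "x \<in> E \<Longrightarrow> x \<in> space P" for x using assms(1) sets.sets_into_space by blast
  show "0 \<le> p k * (D' k)\<^sup>2" if "k \<in> {1..N}" for k
  proof -
    have "0 \<le> p k" using atom(3)[OF that] P.prob_le_1[of "{y\<in>space P. y k = \<eta> k}"] by linarith
    then show ?thesis by simp
  qed
  fix x i assume i: "x \<in> E" "i < N" "fresh i x"
  let ?k = "q (Suc i) x"
  have x: "x \<in> space P" using E i by blast
  have k: "?k \<in> {1..N}" using q_range[OF x, of "Suc i"] i(2) by auto
  show "AE y in P. incr i x y \<le> max 0 (D ?k)" by (rule incr_upper[OF step[OF i]])
  have x': "x(?k := \<eta> ?k) \<in> space P"
    using x atom(1) k by (auto simp: space_PiM PiE_iff extensional_def)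
  show "(\<integral>y. (incr i x y)\<^sup>2 \<partial>P) \<le> p ?k * (D' ?k)\<^sup>2"
  proof (rule variance_near_atom[OF bdd_incr[OF bdd_f x] integral_incr[OF bdd_f x]
        coordinate_atom_sets[OF k atom(2)[OF k]] atom(3)[OF k]])
    show "incr i x y = incr i x (x(?k := \<eta> ?k))" if "y \<in> {y \<in> space P. y ?k = \<eta> ?k}" for y
      using that by (intro incr_cong) simp
    show "\<bar>incr i x y - incr i x (x(?k := \<eta> ?k))\<bar> \<le> D' ?k"
      if "y \<in> space P" "y \<notin> {y \<in> space P. y ?k = \<eta> ?k}" for y
      using that x' region by (intro pair[OF i]) auto
  qed
qed

text \<open>As the condition may be read in both orders, \<open>c\<close> applies as soon as one of
  the two points lies in \<Gamma>. This is what allows the risk to be charged at a single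
  endpoint.\<close>

definition lipschitz_one :: "(nat \<Rightarrow> 'a) set \<Rightarrow> nat \<Rightarrow> real \<Rightarrow> real \<Rightarrow> bool" where
  "lipschitz_one \<Gamma> k c d \<longleftrightarrow> (\<forall>x\<in>region. \<forall>y\<in>region. differ_only_in N k x y \<longrightarrow>
     \<bar>f x - f y\<bar> \<le> (if x \<in> \<Gamma> then c else d))"

definition lipschitz_both :: "(nat \<Rightarrow> 'a) set \<Rightarrow> nat \<Rightarrow> real \<Rightarrow> real \<Rightarrow> bool" where
  "lipschitz_both \<Gamma> k c d \<longleftrightarrow> (\<forall>x\<in>region. \<forall>y\<in>region. differ_only_in N k x y \<longrightarrow>
     \<bar>f x - f y\<bar> \<le> (if x \<in> \<Gamma> \<and> y \<in> \<Gamma> then c else d))"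

text \<open>The conditional probability of leaving \<open>\<Gamma>\<close> when the next coordinate shows \<open>y k\<close>.\<close>

definition risk :: "(nat \<Rightarrow> 'a) set \<Rightarrow> nat \<Rightarrow> (nat \<Rightarrow> 'a) \<Rightarrow> (nat \<Rightarrow> 'a) \<Rightarrow> real" where
  "risk \<Gamma> i x = fiber (exposed i x) (q (Suc i) x) (indicator (space P - \<Gamma>)) x"

context
  fixes \<Gamma> x i k and \<gamma> c d :: real
  assumes \<Gamma>: "\<Gamma> \<in> sets P" and x: "x \<in> region" and i: "i < N" "fresh i x"
    and safe: "cexp (exposed i x) (indicator (space P - \<Gamma>)) x \<le> \<gamma>"
    and k_def: "k = q (Suc i) x" and cd: "c \<le> d"
begin

lemma k_range: "k \<in> {1..N}"
  using q_range[OF box_space[OF x], of "Suc i"] i(1) by (auto simp: k_def)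

lemma bdd_bad: "bdd (indicator (space P - \<Gamma>))"
  using \<Gamma> by (intro bdd_indicator) auto

lemma bdd_risk: "bdd (risk \<Gamma> i x)"
  unfolding risk_def by (rule bdd_fiber[OF bdd_bad box_space[OF x]])

lemma integral_risk: "(\<integral>y. risk \<Gamma> i x y \<partial>P) \<le> \<gamma>"
  unfolding risk_def using integral_fiber[OF bdd_bad box_space[OF x]] safe by simp

lemma risk_nonneg: "0 \<le> risk \<Gamma> i x y"
  unfolding risk_def by (rule fiber_nonneg) simp

lemma risk_atom:
  assumes "y \<in> space P" "{y k} \<in> sets (m k)"
  shows "risk \<Gamma> i x y * measure P {z\<in>space P. z k = y k} \<le> \<gamma>"
  using fiber_atom[OF bdd_bad _ box_space[OF x] assms(1) k_range assms(2), of "exposed i x"] safe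
  unfolding risk_def k_def[symmetric] by simp

lemma incr_diff_le:
  assumes "y \<in> region" "y' \<in> region" "y k \<noteq> y' k" "0 \<le> a"
    and Lip: "\<And>u v. u \<in> region \<Longrightarrow> v \<in> region \<Longrightarrow> differ_only_in N k u v \<Longrightarrow>
      \<bar>f u - f v\<bar> \<le> c + (d - c) * (indicator (space P - \<Gamma>) v + a * indicator (space P - \<Gamma>) u)"
  shows "\<bar>incr i x y - incr i x y'\<bar> \<le> c + (d - c) * (risk \<Gamma> i x y' + a * risk \<Gamma> i x y)"
proof -
  have "\<bar>fiber (exposed i x) k f x y - fiber (exposed i x) k f x y'\<bar>
      \<le> c + (d - c) * (risk \<Gamma> i x y' + a * risk \<Gamma> i x y)"
    unfolding risk_def k_def[symmetric]
  proof (rule fiber_diff_le[OF bdd_f bdd_bad box_space[OF x] box_space[OF assms(1)] box_space[OF assms(2)]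
        AE_box x assms(1,2) mix_PiE _ assms(3,4)])
    show "k \<notin> exposed i x" using i by (simp add: fresh_def k_def)
    show "\<bar>f u - f v\<bar> \<le> c + (d - c) * (indicator (space P - \<Gamma>) v + a * indicator (space P - \<Gamma>) u)"
      if "u \<in> region" "v \<in> region" "u k \<noteq> v k" "\<And>j. j \<noteq> k \<Longrightarrow> u j = v j" for u v
      using that by (intro Lip) (auto simp: differ_only_in_def)
  qed
  then show ?thesis by (simp add: incr_eq_fiber k_def)
qed

lemma incr_diff_le_one:
  assumes "lipschitz_one \<Gamma> k c d" "y \<in> region" "y' \<in> region" "y k \<noteq> y' k"
  shows "\<bar>incr i x y - incr i x y'\<bar> \<le> c + (d - c) * risk \<Gamma> i x y'"
proof -
  have "\<bar>incr i x y - incr i x y'\<bar> \<le> c + (d - c) * (risk \<Gamma> i x y' + 0 * risk \<Gamma> i x y)"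
  proof (rule incr_diff_le[OF assms(2-4)])
    fix u v assume uv: "u \<in> region" "v \<in> region" "differ_only_in N k u v"
    \<comment> \<open>Reading the hypothesis from \<open>v\<close> to \<open>u\<close> charges the
      risk at \<open>y'\<close>, the variable over which the centred increment is averaged
      later.\<close>
    then have "differ_only_in N k v u" by (auto simp: differ_only_in_def)
    then have "\<bar>f v - f u\<bar> \<le> (if v \<in> \<Gamma> then c else d)"
      using assms(1) uv unfolding lipschitz_one_def by blast
    then show "\<bar>f u - f v\<bar> \<le> c + (d - c) * (indicator (space P - \<Gamma>) v + 0 * indicator (space P - \<Gamma>) u)"
      using box_space[OF uv(2)] by (auto split: if_splits)
  qed simp
  then show ?thesis by simp
qed

lemma incr_diff_le_both:
  assumes "lipschitz_both \<Gamma> k c d" "y \<in> region" "y' \<in> region" "y k \<noteq> y' k"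
  shows "\<bar>incr i x y - incr i x y'\<bar> \<le> c + (d - c) * (risk \<Gamma> i x y' + 1 * risk \<Gamma> i x y)"
proof (rule incr_diff_le[OF assms(2-4)])
  fix u v assume uv: "u \<in> region" "v \<in> region" "differ_only_in N k u v"
  then have "\<bar>f u - f v\<bar> \<le> (if u \<in> \<Gamma> \<and> v \<in> \<Gamma> then c else d)"
    using assms(1) unfolding lipschitz_both_def by blast
  then show "\<bar>f u - f v\<bar> \<le> c + (d - c) * (indicator (space P - \<Gamma>) v + 1 * indicator (space P - \<Gamma>) u)"
    using box_space[OF uv(1)] box_space[OF uv(2)] cd
    by (cases "u \<in> \<Gamma>"; cases "v \<in> \<Gamma>") auto
qed simp

text \<open>Averaging the pair bound over \<open>y'\<close> replaces the risk at \<open>y'\<close>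
  by its mean, the conditional probability of leaving \<Gamma> given the history, which is at most
  \<gamma>.\<close>

lemma incr_bound_one:
  assumes "lipschitz_one \<Gamma> k c d" "y \<in> region"
  shows "incr i x y = 0 \<or> \<bar>incr i x y\<bar> \<le> c + \<gamma> * (d - c)"
proof -
  have "incr i x y = 0 \<or> \<bar>incr i x y\<bar> \<le> (\<integral>y. c + (d - c) * risk \<Gamma> i x y \<partial>P)"
    using incr_diff_le_one[OF assms(1)] unfolding k_def
    by (intro incr_alternatives box_space x i bdd_add[OF bdd_const bdd_mult[OF bdd_const bdd_risk]] assms) auto
  moreover have "(\<integral>y. c + (d - c) * risk \<Gamma> i x y \<partial>P) = c + (d - c) * (\<integral>y. risk \<Gamma> i x y \<partial>P)"
    using bdd_integrable[OF bdd_risk] by (simp add: P.prob_space)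
  moreover have "(d - c) * (\<integral>y. risk \<Gamma> i x y \<partial>P) \<le> (d - c) * \<gamma>"
    using cd by (intro mult_left_mono integral_risk) auto
  ultimately show ?thesis by (auto simp: mult.commute)
qed

text \<open>The pair bound holds with the risk at either end, hence with the smaller one. With only
  two possible values the smaller risk is at most the mean risk, so pairs obey the bound otherwise
  known only for single increments.\<close>

lemma pair_one_two_points:
  assumes "lipschitz_one \<Gamma> k c d" "y \<in> region" "y' \<in> region" "y k \<noteq> y' k" "card (space (m k)) = 2"
  shows "\<bar>incr i x y - incr i x y'\<bar> \<le> c + \<gamma> * (d - c)"
proof -
  let ?r = "min (risk \<Gamma> i x y) (risk \<Gamma> i x y')"
  have "y k \<in> space (m k)" "y' k \<in> space (m k)"
    using box_space[OF assms(2)] box_space[OF assms(3)] k_range by (auto simp: space_PiM)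
  then have sp: "space (m k) = {y k, y' k}"
    using assms(4,5) by (auto simp: card_2_iff)
  have "?r \<le> risk \<Gamma> i x z" if z: "z \<in> space P" for z
  proof -
    have "z k \<in> {y k, y' k}" using z k_range sp by (auto simp: space_PiM)
    then have "risk \<Gamma> i x z \<in> {risk \<Gamma> i x y, risk \<Gamma> i x y'}"
      unfolding risk_def k_def[symmetric] using fiber_cong[of z k] by blast
    then show ?thesis by auto
  qed
  then have "(\<integral>z. ?r \<partial>P) \<le> (\<integral>z. risk \<Gamma> i x z \<partial>P)"
    by (intro integral_mono bdd_integrable[OF bdd_const] bdd_integrable[OF bdd_risk])
  then have r: "?r \<le> \<gamma>" using integral_risk by (simp add: P.prob_space)
  have "\<bar>incr i x y - incr i x y'\<bar> \<le> c + (d - c) * ?r"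
    using incr_diff_le_one[OF assms(1-4)] incr_diff_le_one[OF assms(1,3,2)] assms(4)
    by (auto simp: min_def abs_minus_commute)
  also have "\<dots> \<le> c + (d - c) * \<gamma>" using r cd by (intro add_left_mono mult_left_mono) auto
  finally show ?thesis by (simp add: mult.commute)
qed

text \<open>Here the endpoint is fixed at a value of mass at least \<open>1 - p\<close> and no
  averaging is possible; the mass of the atom bounds its risk by
  \<open>\<gamma> / (1 - p)\<close>.\<close>

lemma pair_one_atom:
  assumes "lipschitz_one \<Gamma> k c d" "y \<in> region" "y' \<in> region" "y k \<noteq> y' k" "p < 1"
    "{y' k} \<in> sets (m k)" "1 - p \<le> measure P {z\<in>space P. z k = y' k}"
  shows "\<bar>incr i x y - incr i x y'\<bar> \<le> c + \<gamma> * (d - c) / (1 - p)"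
proof -
  have "risk \<Gamma> i x y' * (1 - p) \<le> risk \<Gamma> i x y' * measure P {z\<in>space P. z k = y' k}"
    using assms(7) risk_nonneg by (rule mult_left_mono)
  also have "\<dots> \<le> \<gamma>" using assms(3,6) by (intro risk_atom box_space)
  finally have "risk \<Gamma> i x y' \<le> \<gamma> / (1 - p)" using assms(5) by (simp add: field_simps)
  then have "(d - c) * risk \<Gamma> i x y' \<le> (d - c) * (\<gamma> / (1 - p))" using cd by (intro mult_left_mono) auto
  then show ?thesis using incr_diff_le_one[OF assms(1-4)] by (simp add: mult.commute)
qed

text \<open>Both endpoints are charged, which explains the factor 2; as every value has mass at
  least \<open>r\<close>, each risk is at most \<open>\<gamma> / r\<close>.\<close>

lemma pair_both:
  assumes "lipschitz_both \<Gamma> k c d" "y \<in> region" "y' \<in> region" "y k \<noteq> y' k" "0 < r"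
    and atoms: "\<And>\<eta>. \<eta> \<in> space (m k) \<Longrightarrow> {\<eta>} \<in> sets (m k) \<and> r \<le> measure P {z\<in>space P. z k = \<eta>}"
  shows "\<bar>incr i x y - incr i x y'\<bar> \<le> c + 2 * \<gamma> * (d - c) / r"
proof -
  have "risk \<Gamma> i x z \<le> \<gamma> / r" if z: "z \<in> space P" for z
  proof -
    have zk: "z k \<in> space (m k)" using z k_range by (auto simp: space_PiM)
    have "risk \<Gamma> i x z * r \<le> risk \<Gamma> i x z * measure P {w\<in>space P. w k = z k}"
      using atoms[OF zk] risk_nonneg by (intro mult_left_mono) auto
    also have "\<dots> \<le> \<gamma>" using atoms[OF zk] z by (intro risk_atom) auto
    finally show ?thesis using assms(5) by (simp add: field_simps)
  qed
  from this[OF box_space[OF assms(2)]] this[OF box_space[OF assms(3)]]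
  have "risk \<Gamma> i x y' + 1 * risk \<Gamma> i x y \<le> \<gamma> / r + \<gamma> / r" by linarith
  then have "risk \<Gamma> i x y' + 1 * risk \<Gamma> i x y \<le> 2 * \<gamma> / r" by simp
  then have "(d - c) * (risk \<Gamma> i x y' + 1 * risk \<Gamma> i x y) \<le> (d - c) * (2 * \<gamma> / r)"
    using cd by (intro mult_left_mono) auto
  with incr_diff_le_both[OF assms(1-4)] show ?thesis by (simp add: mult.commute)
qed

end

end

section \<open>Conditioning the coordinates\<close>

lemma uniform_measure_conditions:
  assumes "prob_space \<mu>" "G \<in> sets \<mu>" "emeasure \<mu> G \<noteq> 0"
  shows "prob_space (uniform_measure \<mu> G)" "emeasure (uniform_measure \<mu> G) G = 1"
proof -
  interpret prob_space \<mu> by fact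
  have "emeasure \<mu> G \<noteq> \<infinity>" by (simp add: emeasure_eq_measure)
  then show "prob_space (uniform_measure \<mu> G)" by (rule prob_space_uniform_measure[OF assms(3)])
  show "emeasure (uniform_measure \<mu> G) G = 1"
    using assms(2) ennreal_divide_self[OF assms(3)] \<open>emeasure \<mu> G \<noteq> \<infinity>\<close>
    by (simp add: less_top[symmetric])
qed

text \<open>The mean over \<open>G\<close> is a lower bound for every value outside
  \<open>G\<close>. Replacing \<open>u\<close> there by this mean lowers the integral, and the
  result is exactly the conditional mean.\<close>

lemma integral_uniform_measure_le:
  fixes u :: "'a \<Rightarrow> real"
  assumes "prob_space \<mu>" and G: "G \<in> sets \<mu>" "emeasure \<mu> G \<noteq> 0"
    and u: "u \<in> borel_measurable \<mu>" "\<And>x. x \<in> space \<mu> \<Longrightarrow> \<bar>u x\<bar> \<le> K"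
    and mono: "\<And>x y. x \<in> space \<mu> - G \<Longrightarrow> y \<in> G \<Longrightarrow> u y \<le> u x"
  shows "(\<integral>x. u x \<partial>uniform_measure \<mu> G) \<le> (\<integral>x. u x \<partial>\<mu>)"
proof -
  interpret prob_space \<mu> by fact
  interpret U: prob_space "uniform_measure \<mu> G" by (rule uniform_measure_conditions[OF assms(1) G])
  let ?a = "\<integral>x. u x \<partial>uniform_measure \<mu> G"
  have pos: "0 < prob G" using G(2) by (simp add: emeasure_eq_measure zero_less_measure_iff)
  have i: "integrable \<mu> u" using u by (intro integrable_const_bound[where B=K]) auto
  have iU: "integrable (uniform_measure \<mu> G) u"
    using u by (intro U.integrable_const_bound[where B=K]) auto
  have iG: "integrable \<mu> (\<lambda>x. indicator S x * u x)" if "S \<in> sets \<mu>" for S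
    using integrable_real_mult_indicator[OF that i] by (simp add: mult.commute)
  have a: "?a * prob G = (\<integral>x. indicator G x * u x \<partial>\<mu>)"
  proof -
    have "uniform_measure \<mu> G = density \<mu> (\<lambda>x. ennreal (indicator G x / prob G))"
      unfolding uniform_measure_def using pos G(1)
      by (intro density_cong) (auto simp: emeasure_eq_measure divide_ennreal simp flip: ennreal_indicator)
    then have "?a = (\<integral>x. (indicator G x / prob G) * u x \<partial>\<mu>)"
      using G u pos by (simp add: integral_density)
    also have "\<dots> = (\<integral>x. indicator G x * u x \<partial>\<mu>) / prob G"
      by (simp flip: integral_divide_zero)
    finally show ?thesis using pos by simp
  qed
  have c: "?a \<le> u x" if x: "x \<in> space \<mu> - G" for x
  proof -
    have "?a \<le> (\<integral>y. u x \<partial>uniform_measure \<mu> G)"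
    proof (rule integral_mono_AE[OF iU])
      have "AE y in uniform_measure \<mu> G. y \<in> G"
        using G U.AE_prob_1[of G] uniform_measure_conditions(2)[OF assms(1) G]
        by (simp add: U.emeasure_eq_measure)
      then show "AE y in uniform_measure \<mu> G. u y \<le> u x"
        using mono[OF x] by (auto elim!: eventually_mono)
    qed simp
    then show ?thesis using U.prob_space by simp
  qed
  have "?a = ?a * prob G + ?a * prob (space \<mu> - G)" using G by (simp add: prob_compl algebra_simps)
  also have "?a * prob (space \<mu> - G) = (\<integral>x. indicator (space \<mu> - G) x * ?a \<partial>\<mu>)"
    using G by simp
  also have "\<dots> \<le> (\<integral>x. indicator (space \<mu> - G) x * u x \<partial>\<mu>)"
  proof (rule integral_mono)
    show "integrable \<mu> (\<lambda>x. indicator (space \<mu> - G) x * ?a)"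
      using G(1) by (intro integrable_const_bound[where B="\<bar>?a\<bar>"]) (auto split: split_indicator)
    show "integrable \<mu> (\<lambda>x. indicator (space \<mu> - G) x * u x)" using G(1) by (intro iG) auto
  qed (use c in \<open>auto split: split_indicator\<close>)
  also have "?a * prob G + \<dots> = (\<integral>x. indicator G x * u x + indicator (space \<mu> - G) x * u x \<partial>\<mu>)"
    unfolding a using G iG by simp
  also have "\<dots> = (\<integral>x. u x \<partial>\<mu>)"
    by (intro Bochner_Integration.integral_cong) (auto split: split_indicator)
  finally show ?thesis by simp
qed

text \<open>This one inequality compares the means, the conditional probabilities of leaving \<open>\<Gamma>\<close> and the
  tail probabilities under the original and the conditioned law.\<close>

lemma integral_PiM_uniform_measure_le:
  fixes h :: "('i \<Rightarrow> 'a) \<Rightarrow> real"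
  assumes prob: "\<And>j. prob_space (m j)" and "finite I"
    and G: "\<And>j. j \<in> I \<Longrightarrow> G j \<in> sets (m j)" "\<And>j. j \<in> I \<Longrightarrow> emeasure (m j) (G j) \<noteq> 0"
    and h: "h \<in> borel_measurable (PiM I m)" "\<And>x. x \<in> space (PiM I m) \<Longrightarrow> \<bar>h x\<bar> \<le> K"
    and mono: "\<And>j x a b. j \<in> I \<Longrightarrow> x \<in> (\<Pi>\<^sub>E j\<in>I. space (m j)) \<Longrightarrow> a \<in> space (m j) - G j \<Longrightarrow> b \<in> G j \<Longrightarrow>
      h (x(j := b)) \<le> h (x(j := a))"
  shows "(\<integral>x. h x \<partial>PiM I (\<lambda>j. if j \<in> I then uniform_measure (m j) (G j) else m j)) \<le> (\<integral>x. h x \<partial>PiM I m)"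
proof -
  \<comment> \<open>Under \<open>r S\<close> the coordinates in \<open>S\<close> are conditioned.
    They are added one at a time, and Fubini isolates the coordinate being changed.\<close>
  define r where "r S = (\<lambda>j. if j \<in> S then uniform_measure (m j) (G j) else m j)" for S
  have sets_r: "sets (r S j) = sets (m j)" for S j by (simp add: r_def)
  have space_r: "space (r S j) = space (m j)" for S j by (simp add: r_def)
  have setsP: "sets (PiM J (r S)) = sets (PiM J m)" for J S
    by (intro sets_PiM_cong refl sets_r)
  have spaceP: "space (PiM J (r S)) = (\<Pi>\<^sub>E j\<in>J. space (m j))" for J S
    by (simp add: space_PiM space_r)
  have probr: "prob_space (r S j)" if "S \<subseteq> I" for S j
    using prob uniform_measure_conditions(1)[OF prob G] that by (auto simp: r_def)
  have "(\<integral>x. h x \<partial>PiM I (r S)) \<le> (\<integral>x. h x \<partial>PiM I m)" if "finite S" "S \<subseteq> I" for S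
    using that
  proof (induction S)
    case empty
    show ?case by (simp add: r_def)
  next
    case (insert k S)
    define J where "J = I - {k}"
    have J: "I = insert k J" "k \<notin> J" "finite J" using insert assms(2) by (auto simp: J_def)
    have product: "(\<integral>x. h x \<partial>PiM I (r T)) = (\<integral>x. (\<integral>y. h (x(k := y)) \<partial>r T k) \<partial>PiM J (r T))"
      if T: "T \<subseteq> I" for T
    proof -
      interpret product_sigma_finite "r T"
        using probr[OF T] by (auto simp: product_sigma_finite_def intro: prob_space_imp_sigma_finite)
      interpret PT: prob_space "PiM I (r T)" by (rule prob_space_PiM) (rule probr[OF T])
      have "integrable (PiM I (r T)) h"
        using h by (intro PT.integrable_const_bound[where B=K])
          (auto intro!: AE_I2 simp: spaceP space_PiM space_r measurable_cong_sets[OF setsP refl])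
      then show ?thesis using product_integral_insert[OF J(3,2), of h] unfolding J(1)[symmetric] by simp
    qed
    have eqJ: "PiM J (r (insert k S)) = PiM J (r S)"
      using J(2) by (intro PiM_cong) (auto simp: r_def)
    have Sk: "r S k = m k" "r (insert k S) k = uniform_measure (m k) (G k)"
      using insert by (auto simp: r_def)
    have kI: "k \<in> I" using insert by auto
    have meas: "(\<lambda>(x, y). h (x(k := y))) \<in> borel_measurable (PiM J (r S) \<Otimes>\<^sub>M \<nu>)"
      if "sets \<nu> = sets (m k)" for \<nu>
    proof -
      have "(\<lambda>(x, y). x(k := y)) \<in> measurable (PiM J m \<Otimes>\<^sub>M m k) (PiM I m)"
        unfolding J(1) by (rule measurable_add_dim)
      from measurable_compose[OF this h(1)]
      have "(\<lambda>(x, y). h (x(k := y))) \<in> borel_measurable (PiM J m \<Otimes>\<^sub>M m k)"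
        by (simp add: case_prod_beta)
      moreover have "sets (PiM J (r S) \<Otimes>\<^sub>M \<nu>) = sets (PiM J m \<Otimes>\<^sub>M m k)"
        by (intro sets_pair_measure_cong setsP that)
      ultimately show ?thesis using measurable_cong_sets[of _ _ borel borel] by blast
    qed
    interpret PJ: prob_space "PiM J (r S)" by (rule prob_space_PiM, rule probr) (use insert in auto)
    have upd: "x(k := y) \<in> space (PiM I m)" if "x \<in> space (PiM J (r S))" "y \<in> space (m k)" for x y
      using that(1)[unfolded spaceP] that(2) unfolding J(1) space_PiM by (intro PiE_fun_upd)
    have bound: "\<bar>\<integral>y. h (x(k := y)) \<partial>\<nu>\<bar> \<le> K"
      and int: "integrable \<nu> (\<lambda>y. h (x(k := y)))"
      if \<nu>: "prob_space \<nu>" "sets \<nu> = sets (m k)" and x: "x \<in> space (PiM J (r S))" for \<nu> x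
    proof -
      interpret prob_space \<nu> by fact
      have sp: "space \<nu> = space (m k)" using \<nu>(2) by (rule sets_eq_imp_space_eq)
      have "(\<lambda>y. h (x(k := y))) \<in> borel_measurable \<nu>"
        using measurable_Pair2[OF meas[OF \<nu>(2)] x] by simp
      then show int: "integrable \<nu> (\<lambda>y. h (x(k := y)))"
        using h(2) upd[OF x] sp by (intro integrable_const_bound[where B=K]) auto
      have "\<bar>\<integral>y. h (x(k := y)) \<partial>\<nu>\<bar> \<le> (\<integral>y. \<bar>h (x(k := y))\<bar> \<partial>\<nu>)" by (rule integral_abs_bound)
      also have "\<dots> \<le> (\<integral>y. K \<partial>\<nu>)"
        using int h(2) upd[OF x] sp by (intro integral_mono) auto
      finally show "\<bar>\<integral>y. h (x(k := y)) \<partial>\<nu>\<bar> \<le> K" by (simp add: prob_space)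
    qed
    have iJ: "integrable (PiM J (r S)) (\<lambda>x. \<integral>y. h (x(k := y)) \<partial>\<nu>)"
      if \<nu>: "prob_space \<nu>" "sets \<nu> = sets (m k)" for \<nu>
    proof -
      interpret prob_space \<nu> by fact
      have "(\<lambda>x. \<integral>y. h (x(k := y)) \<partial>\<nu>) \<in> borel_measurable (PiM J (r S))"
        by (rule borel_measurable_lebesgue_integral[OF meas[OF \<nu>(2)]])
      then show ?thesis using bound[OF \<nu>] by (intro PJ.integrable_const_bound[where B=K]) auto
    qed
    have "(\<integral>x. h x \<partial>PiM I (r (insert k S)))
        = (\<integral>x. (\<integral>y. h (x(k := y)) \<partial>uniform_measure (m k) (G k)) \<partial>PiM J (r S))"
      using product[of "insert k S"] insert by (simp add: eqJ Sk)
    also have "\<dots> \<le> (\<integral>x. (\<integral>y. h (x(k := y)) \<partial>m k) \<partial>PiM J (r S))"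
    proof (rule integral_mono[OF iJ iJ])
      fix x assume x: "x \<in> space (PiM J (r S))"
      show "(\<integral>y. h (x(k := y)) \<partial>uniform_measure (m k) (G k)) \<le> (\<integral>y. h (x(k := y)) \<partial>m k)"
      proof (rule integral_uniform_measure_le[OF prob G(1)[OF kI] G(2)[OF kI], where K=K])
        show "(\<lambda>y. h (x(k := y))) \<in> borel_measurable (m k)"
          using measurable_Pair2[OF meas[OF refl] x] by simp
        show "\<bar>h (x(k := y))\<bar> \<le> K" if "y \<in> space (m k)" for y using h(2) upd[OF x that] by blast
        show "h (x(k := b)) \<le> h (x(k := a))" if a: "a \<in> space (m k) - G k" and b: "b \<in> G k" for a b
        proof -
          have "x(k := a) \<in> (\<Pi>\<^sub>E j\<in>I. space (m j))" using upd[OF x] a by (simp add: space_PiM)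
          from mono[OF kI this a b] show ?thesis by simp
        qed
      qed
    qed (auto intro: prob uniform_measure_conditions(1)[OF prob G(1)[OF kI] G(2)[OF kI]])
    also have "\<dots> = (\<integral>x. h x \<partial>PiM I (r S))"
      using product[of S] insert by (simp add: Sk)
    also have "\<dots> \<le> (\<integral>x. h x \<partial>PiM I m)" using insert by simp
    finally show ?case .
  qed
  from this[OF assms(2) order_refl] show ?thesis by (simp add: r_def)
qed

section \<open>The three parts of the theorem\<close>

text \<open>Strategies and query sets see only the sigma-algebras, so they survive the change from
  \<open>\<Lambda> k\<close> to the laws of the coordinates and then to the conditioned
  laws.\<close>

lemma
  assumes "\<And>k. k \<in> {1..N} \<Longrightarrow> sets (m k) = sets (m' k)"
  shows outcomes_cong: "outcomes N m = outcomes N m'"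
    and query_strategy_cong: "query_strategy N m f q = query_strategy N m' f q"
    and query_sets_cong: "query_sets N m q = query_sets N m' q"
proof -
  show o: "outcomes N m = outcomes N m'"
    unfolding outcomes_def by (intro PiE_cong sets_eq_imp_space_eq assms)
  have "sets (PiM {1..N} m) = sets (PiM {1..N} m')" by (intro sets_PiM_cong refl assms)
  then have "measurable (PiM {1..N} m) S = measurable (PiM {1..N} m') S" for S :: "nat measure"
    by (rule measurable_cong_sets) simp
  then show "query_strategy N m f q = query_strategy N m' f q"
    unfolding query_strategy_def determined_by_def o by simp
  show "query_sets N m q = query_sets N m' q" unfolding query_sets_def o ..
qed

lemma exp_neg_quot_double: "exp_neg_quot (4 * t\<^sup>2) (2 * S) = exp_neg_quot (2 * t\<^sup>2) S"
  by (simp add: exp_neg_quot_def)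

context query_process begin

lemma bdd_of_lipschitz:
  assumes Lip: "\<And>k x y. k \<in> {1..N} \<Longrightarrow> x \<in> space P \<Longrightarrow> y \<in> space P \<Longrightarrow> differ_only_in N k x y \<Longrightarrow>
    \<bar>f x - f y\<bar> \<le> c k"
  shows "bdd f"
proof -
  obtain x0 where x0: "x0 \<in> space P" using P.not_empty by blast
  have step: "\<bar>f (mix {1..n} x x0) - f x0\<bar> \<le> (\<Sum>k\<in>{1..n}. \<bar>c k\<bar>)" if x: "x \<in> space P" and "n \<le> N" for x n
    using that(2)
  proof (induction n)
    case 0 then show ?case by (simp add: mix_simps)
  next
    case (Suc n)
    let ?u = "mix {1..Suc n} x x0" and ?v = "mix {1..n} x x0"
    \<comment> \<open>If the two points coincide the hypothesis is silent and
      \<open>c (Suc n)\<close> might be negative; hence the absolute values in the sum.\<close>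
    have "\<bar>f ?u - f ?v\<bar> \<le> \<bar>c (Suc n)\<bar>"
    proof (cases "?u = ?v")
      case False
      have "differ_only_in N (Suc n) ?u ?v"
        using False by (auto simp: differ_only_in_def mix_def fun_eq_iff le_Suc_eq split: if_splits)
      then have "\<bar>f ?u - f ?v\<bar> \<le> c (Suc n)"
        using Suc.prems x x0 by (intro Lip) (auto intro: mix_in_space)
      then show ?thesis by simp
    qed simp
    moreover have "\<bar>f ?v - f x0\<bar> \<le> (\<Sum>k\<in>{1..n}. \<bar>c k\<bar>)" using Suc by simp
    ultimately show ?case by (simp add: atLeastAtMostSuc_conv)
  qed
  show ?thesis
  proof (rule bddI[OF f_measurable])
    fix x assume x: "x \<in> space P"
    have "mix {1..N} x x0 = x"
      using x x0 by (intro PiE_ext[of _ "{1..N}" "\<lambda>k. space (m k)"]) (auto simp: space_PiM mix_def PiE_iff extensional_def)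
    then show "\<bar>f x\<bar> \<le> \<bar>f x0\<bar> + (\<Sum>k\<in>{1..N}. \<bar>c k\<bar>)" using step[OF x order_refl] by simp
  qed
qed

lemma boxed_space: "bdd f \<Longrightarrow> boxed_query m N f q (\<lambda>k. space (m k))"
  by unfold_locales (auto simp: space_PiM[symmetric])

lemma lipschitz_tails:
  assumes Lip: "\<And>k x y. k \<in> {1..N} \<Longrightarrow> x \<in> space P \<Longrightarrow> y \<in> space P \<Longrightarrow> differ_only_in N k x y \<Longrightarrow>
    \<bar>f x - f y\<bar> \<le> c k" and t: "0 \<le> t"
  defines "T \<equiv> measure P {x\<in>space P. integral\<^sup>L P f + t \<le> f x}"
  shows "T \<le> exp_neg_quot (2 * t\<^sup>2) (MAX Q\<in>query_sets N m q. \<Sum>k\<in>Q. (c k)\<^sup>2)"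
    and "\<And>z u p V C. z \<noteq> u \<Longrightarrow>
        (\<And>k. k \<in> {1..N} \<Longrightarrow> space (m k) = {z, u} \<and> {u} \<in> sets (m k) \<and> p k = measure P {y\<in>space P. y k = u}) \<Longrightarrow>
        C = (MAX Q\<in>query_sets N m q. MAX k\<in>Q. c k) \<Longrightarrow>
        V = (MAX Q\<in>query_sets N m q. \<Sum>k\<in>Q. (1 - p k) * p k * (c k)\<^sup>2) \<Longrightarrow>
        T \<le> exp_neg_quot (t\<^sup>2) (2 * V + 2 * C * t / 3) \<and>
        (0 < V \<and> 0 < C \<longrightarrow> T \<le> exp (- (V / C\<^sup>2 * phi (C * t / V))))"
    and "\<And>p V C. (\<And>k. k \<in> {1..N} \<Longrightarrow> \<exists>\<eta>\<in>space (m k). {\<eta>} \<in> sets (m k) \<and> 1 - p k \<le> measure P {y\<in>space P. y k = \<eta>}) \<Longrightarrow>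
        C = (MAX Q\<in>query_sets N m q. MAX k\<in>Q. c k) \<Longrightarrow>
        V = (MAX Q\<in>query_sets N m q. \<Sum>k\<in>Q. p k * (c k)\<^sup>2) \<Longrightarrow>
        T \<le> exp_neg_quot (t\<^sup>2) (2 * V + 2 * C * t / 3)"
proof -
  have bf: "bdd f" by (rule bdd_of_lipschitz[OF Lip])
  interpret boxed_query m N f q "\<lambda>k. space (m k)" by (rule boxed_space[OF bf])
  have reg: "region = space P" by (simp add: space_PiM)
  have pair: "\<bar>incr i x y - incr i x y'\<bar> \<le> c (q (Suc i) x)"
    if "x \<in> space P" "i < N" "fresh i x" "y \<in> region" "y' \<in> region" "y (q (Suc i) x) \<noteq> y' (q (Suc i) x)" for x i y y'
  proof -
    have k: "q (Suc i) x \<in> {1..N}" using q_range[OF that(1), of "Suc i"] that(2) by auto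
    \<comment> \<open>Unrestricted bounded differences are the case where \<Gamma> is the whole
      space, \<open>c = d\<close> and \<open>\<gamma> = 0\<close>.\<close>
    have "\<bar>incr i x y - incr i x y'\<bar>
        \<le> c (q (Suc i) x) + (c (q (Suc i) x) - c (q (Suc i) x)) * risk (space P) i x y'"
    proof (rule incr_diff_le_one[where \<gamma>=0 and k="q (Suc i) x"])
      show "lipschitz_one (space P) (q (Suc i) x) (c (q (Suc i) x)) (c (q (Suc i) x))"
        unfolding lipschitz_one_def reg using Lip[OF k] by auto
    qed (use that reg in \<open>auto simp: cexp_def\<close>)
    then show ?thesis by simp
  qed
  have sP: "space P \<in> sets P" by simp
  show "T \<le> exp_neg_quot (2 * t\<^sup>2) (MAX Q\<in>query_sets N m q. \<Sum>k\<in>Q. (c k)\<^sup>2)"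
    unfolding T_def exp_neg_quot_double[symmetric] by (rule tail_oscillation[OF sP t pair])
  {
    fix z u p V C
    assume "z \<noteq> u" "\<And>k. k \<in> {1..N} \<Longrightarrow> space (m k) = {z, u} \<and> {u} \<in> sets (m k) \<and> p k = measure P {y\<in>space P. y k = u}"
      and CV: "C = (MAX Q\<in>query_sets N m q. MAX k\<in>Q. c k)"
        "V = (MAX Q\<in>query_sets N m q. \<Sum>k\<in>Q. (1 - p k) * p k * (c k)\<^sup>2)"
    then show "T \<le> exp_neg_quot (t\<^sup>2) (2 * V + 2 * C * t / 3) \<and>
        (0 < V \<and> 0 < C \<longrightarrow> T \<le> exp (- (V / C\<^sup>2 * phi (C * t / V))))"
      unfolding T_def by (intro tail_two_values[OF sP t pair _ _ _ _ _ CV]) auto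
  }
  {
    fix p V C
    assume at: "\<And>k. k \<in> {1..N} \<Longrightarrow> \<exists>\<eta>\<in>space (m k). {\<eta>} \<in> sets (m k) \<and> 1 - p k \<le> measure P {y\<in>space P. y k = \<eta>}"
      and CV: "C = (MAX Q\<in>query_sets N m q. MAX k\<in>Q. c k)"
        "V = (MAX Q\<in>query_sets N m q. \<Sum>k\<in>Q. p k * (c k)\<^sup>2)"
    from at have "\<forall>k\<in>{1..N}. \<exists>\<eta>. \<eta> \<in> space (m k) \<and> {\<eta>} \<in> sets (m k) \<and> 1 - p k \<le> measure P {y\<in>space P. y k = \<eta>}"
      by blast
    then obtain \<eta> where \<eta>: "\<forall>k\<in>{1..N}. \<eta> k \<in> space (m k) \<and> {\<eta> k} \<in> sets (m k) \<and> 1 - p k \<le> measure P {y\<in>space P. y k = \<eta> k}"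
      by (rule bchoice[THEN exE])
    have alt: "incr i x y = 0 \<or> \<bar>incr i x y\<bar> \<le> c (q (Suc i) x)"
      if "x \<in> space P" "i < N" "fresh i x" "y \<in> region" for x i y
      using incr_alternatives[OF that(1,2) bdd_const pair[OF that(1-3)] that(4)] by (simp add: P.prob_space)
    show "T \<le> exp_neg_quot (t\<^sup>2) (2 * V + 2 * C * t / 3)"
      unfolding T_def using \<eta>
      by (intro tail_atom[OF sP t alt reg, where \<eta>=\<eta> and p=p and D'=c, OF _ _ _ _ _ _ _ pair CV]) auto
  }
qed

lemma typical_tails:
  assumes \<Gamma>: "\<Gamma> \<in> sets P" and \<gamma>: "0 < \<gamma>"
    and cd: "\<And>k. k \<in> {1..N} \<Longrightarrow> c k \<le> d k"
    and Lip: "(\<forall>k\<in>{1..N}. (\<forall>x\<in>space P. \<forall>y\<in>space P. differ_only_in N k x y \<longrightarrow>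
          \<bar>f x - f y\<bar> \<le> (if x \<in> \<Gamma> then c k else d k)) \<and> e k = \<gamma> * (d k - c k)) \<or>
      (\<exists>r. \<forall>k\<in>{1..N}. (\<forall>x\<in>space P. \<forall>y\<in>space P. differ_only_in N k x y \<longrightarrow>
          \<bar>f x - f y\<bar> \<le> (if x \<in> \<Gamma> \<and> y \<in> \<Gamma> then c k else d k)) \<and> 0 < r k \<and>
          (\<forall>\<eta>\<in>space (m k). {\<eta>} \<in> sets (m k) \<and> r k \<le> measure P {y\<in>space P. y k = \<eta>}) \<and>
          e k = 2 * \<gamma> * (d k - c k) / r k)" (is "?one \<or> ?both")
    and C: "C = (MAX Q\<in>query_sets N m q. MAX k\<in>Q. c k + e k)" and t: "0 \<le> t"
  defines "T \<equiv> measure P {x\<in>typical \<gamma> \<Gamma>. integral\<^sup>L P f + t \<le> f x}"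
  shows "T \<le> exp_neg_quot (t\<^sup>2) (2 * (MAX Q\<in>query_sets N m q. \<Sum>k\<in>Q. (c k + e k)\<^sup>2))"
    and "(\<And>k. k \<in> {1..N} \<Longrightarrow> card (space (m k)) = 2) \<Longrightarrow>
      T \<le> exp_neg_quot (4 * t\<^sup>2) (2 * (MAX Q\<in>query_sets N m q. \<Sum>k\<in>Q. (c k + e k)\<^sup>2))"
    and "\<And>z u p V. z \<noteq> u \<Longrightarrow>
        (\<And>k. k \<in> {1..N} \<Longrightarrow> space (m k) = {z, u} \<and> {u} \<in> sets (m k) \<and> p k = measure P {y\<in>space P. y k = u}) \<Longrightarrow>
        V = (MAX Q\<in>query_sets N m q. \<Sum>k\<in>Q. (1 - p k) * p k * (c k + e k)\<^sup>2) \<Longrightarrow>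
        T \<le> exp_neg_quot (t\<^sup>2) (2 * V + 2 * C * t / 3) \<and>
        (0 < V \<and> 0 < C \<longrightarrow> T \<le> exp (- (V / C\<^sup>2 * phi (C * t / V))))"
    and "\<And>p V. (\<And>k. k \<in> {1..N} \<Longrightarrow> 0 \<le> p k \<and> p k < 1 \<and>
        (\<exists>\<eta>\<in>space (m k). {\<eta>} \<in> sets (m k) \<and> 1 - p k \<le> measure P {y\<in>space P. y k = \<eta>})) \<Longrightarrow>
        V = (MAX Q\<in>query_sets N m q. \<Sum>k\<in>Q. p k * (c k + e k / (1 - p k))\<^sup>2) \<Longrightarrow>
        T \<le> exp_neg_quot (t\<^sup>2) (2 * V + 2 * C * t / 3)"
proof -
  have "\<bar>f x - f y\<bar> \<le> d k"
    if "k \<in> {1..N}" "x \<in> space P" "y \<in> space P" "differ_only_in N k x y" for k x y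
    using Lip
  proof
    assume ?one
    then have "\<bar>f x - f y\<bar> \<le> (if x \<in> \<Gamma> then c k else d k)" using that by blast
    then show ?thesis using cd[OF that(1)] by (auto split: if_splits)
  next
    assume ?both
    then have "\<bar>f x - f y\<bar> \<le> (if x \<in> \<Gamma> \<and> y \<in> \<Gamma> then c k else d k)" using that by blast
    then show ?thesis using cd[OF that(1)] by (auto split: if_splits)
  qed
  then have bf: "bdd f" by (rule bdd_of_lipschitz)
  interpret boxed_query m N f q "\<lambda>k. space (m k)" by (rule boxed_space[OF bf])
  have reg: "region = space P" by (simp add: space_PiM)
  note tm = typical_measurable[OF \<Gamma>, of \<gamma>]
  have safe: "x \<in> space P" "q (Suc i) x \<in> {1..N}" "cexp (exposed i x) (indicator (space P - \<Gamma>)) x \<le> \<gamma>"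
    if "x \<in> typical \<gamma> \<Gamma>" "i < N" "fresh i x" for x i
  proof -
    show x: "x \<in> space P" using that(1) sets.sets_into_space[OF tm] by blast
    show "q (Suc i) x \<in> {1..N}" using q_range[OF x, of "Suc i"] that(2) by auto
    show "cexp (exposed i x) (indicator (space P - \<Gamma>)) x \<le> \<gamma>" using that by (simp add: typical_def)
  qed
  have one: "lipschitz_one \<Gamma> k (c k) (d k)" "e k = \<gamma> * (d k - c k)" if ?one "k \<in> {1..N}" for k
    using that unfolding lipschitz_one_def reg by blast+
  have both: "lipschitz_both \<Gamma> k (c k) (d k)" "0 < r k"
      "\<And>\<eta>. \<eta> \<in> space (m k) \<Longrightarrow> {\<eta>} \<in> sets (m k) \<and> r k \<le> measure P {y\<in>space P. y k = \<eta>}"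
      "e k = 2 * \<gamma> * (d k - c k) / r k"
    if "\<forall>k\<in>{1..N}. (\<forall>x\<in>space P. \<forall>y\<in>space P. differ_only_in N k x y \<longrightarrow>
          \<bar>f x - f y\<bar> \<le> (if x \<in> \<Gamma> \<and> y \<in> \<Gamma> then c k else d k)) \<and> 0 < r k \<and>
          (\<forall>\<eta>\<in>space (m k). {\<eta>} \<in> sets (m k) \<and> r k \<le> measure P {y\<in>space P. y k = \<eta>}) \<and>
          e k = 2 * \<gamma> * (d k - c k) / r k" "k \<in> {1..N}" for r k
    using that unfolding lipschitz_both_def reg by blast+
  have e0: "0 \<le> e k" if "k \<in> {1..N}" for k
    using Lip
  proof
    assume ?one
    then show ?thesis using one(2)[OF _ that] \<gamma> cd[OF that] by simp
  next
    assume ?both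
    then show ?thesis
    proof (rule exE)
      fix r assume r: "\<forall>k\<in>{1..N}. (\<forall>x\<in>space P. \<forall>y\<in>space P. differ_only_in N k x y \<longrightarrow>
          \<bar>f x - f y\<bar> \<le> (if x \<in> \<Gamma> \<and> y \<in> \<Gamma> then c k else d k)) \<and> 0 < r k \<and>
          (\<forall>\<eta>\<in>space (m k). {\<eta>} \<in> sets (m k) \<and> r k \<le> measure P {y\<in>space P. y k = \<eta>}) \<and>
          e k = 2 * \<gamma> * (d k - c k) / r k"
      show ?thesis using both(2,4)[OF r that] \<gamma> cd[OF that] by simp
    qed
  qed
  \<comment> \<open>The two-sided hypothesis controls every pair, so this one estimate serves all
    the tail bounds below. The one-sided hypothesis needs a separate estimate for absolute values,
    for two-point coordinates and for atoms.\<close>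
  have pair_both': "\<bar>incr i x y - incr i x y'\<bar> \<le> c (q (Suc i) x) + e (q (Suc i) x)"
    if ?both "x \<in> typical \<gamma> \<Gamma>" "i < N" "fresh i x" "y \<in> region" "y' \<in> region"
      "y (q (Suc i) x) \<noteq> y' (q (Suc i) x)" for x i y y'
  proof -
    note s = safe[OF that(2-4)]
    have ex: ?both by (rule that(1))
    obtain r where r: "\<forall>k\<in>{1..N}. (\<forall>x\<in>space P. \<forall>y\<in>space P. differ_only_in N k x y \<longrightarrow>
          \<bar>f x - f y\<bar> \<le> (if x \<in> \<Gamma> \<and> y \<in> \<Gamma> then c k else d k)) \<and> 0 < r k \<and>
          (\<forall>\<eta>\<in>space (m k). {\<eta>} \<in> sets (m k) \<and> r k \<le> measure P {y\<in>space P. y k = \<eta>}) \<and>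
          e k = 2 * \<gamma> * (d k - c k) / r k"
      using ex ..
    show ?thesis
      unfolding both(4)[OF r s(2)]
      by (rule pair_both[OF \<Gamma> _ that(3,4) s(3) refl cd[OF s(2)] both(1)[OF r s(2)] that(5-7) both(2,3)[OF r s(2)]])
        (simp add: reg s(1))
  qed
  have alt: "incr i x y = 0 \<or> \<bar>incr i x y\<bar> \<le> c (q (Suc i) x) + e (q (Suc i) x)"
    if "x \<in> typical \<gamma> \<Gamma>" "i < N" "fresh i x" "y \<in> region" for x i y
    using Lip
  proof
    note s = safe[OF that(1-3)]
    assume o: ?one
    show ?thesis
      unfolding one(2)[OF o s(2)]
      by (rule incr_bound_one[OF \<Gamma> _ that(2,3) s(3) refl cd[OF s(2)] one(1)[OF o s(2)] that(4)])
        (simp add: reg s(1))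
  next
    assume ?both
    from incr_alternatives[OF safe(1)[OF that(1-3)] that(2) bdd_const pair_both'[OF this that(1-3)] that(4)]
    show ?thesis by (simp add: P.prob_space)
  qed
  have pair_two: "\<bar>incr i x y - incr i x y'\<bar> \<le> c (q (Suc i) x) + e (q (Suc i) x)"
    if two: "\<And>k. k \<in> {1..N} \<Longrightarrow> card (space (m k)) = 2"
      and "x \<in> typical \<gamma> \<Gamma>" "i < N" "fresh i x" "y \<in> region" "y' \<in> region"
      "y (q (Suc i) x) \<noteq> y' (q (Suc i) x)" for x i y y'
    using Lip
  proof
    note s = safe[OF that(2-4)]
    assume o: ?one
    show ?thesis
      unfolding one(2)[OF o s(2)]
      by (rule pair_one_two_points[OF \<Gamma> _ that(3,4) s(3) refl cd[OF s(2)] one(1)[OF o s(2)] that(5-7) two[OF s(2)]])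
        (simp add: reg s(1))
  next
    assume ?both
    from pair_both'[OF this that(2-7)] show ?thesis .
  qed
  show "T \<le> exp_neg_quot (t\<^sup>2) (2 * (MAX Q\<in>query_sets N m q. \<Sum>k\<in>Q. (c k + e k)\<^sup>2))"
    unfolding T_def by (rule tail_abs[OF tm t alt])
  show "T \<le> exp_neg_quot (4 * t\<^sup>2) (2 * (MAX Q\<in>query_sets N m q. \<Sum>k\<in>Q. (c k + e k)\<^sup>2))"
    if "\<And>k. k \<in> {1..N} \<Longrightarrow> card (space (m k)) = 2"
    unfolding T_def by (rule tail_oscillation[OF tm t pair_two[OF that]])
  show "T \<le> exp_neg_quot (t\<^sup>2) (2 * V + 2 * C * t / 3) \<and>
        (0 < V \<and> 0 < C \<longrightarrow> T \<le> exp (- (V / C\<^sup>2 * phi (C * t / V))))"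
    if two: "z \<noteq> u" "\<And>k. k \<in> {1..N} \<Longrightarrow> space (m k) = {z, u} \<and> {u} \<in> sets (m k) \<and> p k = measure P {y\<in>space P. y k = u}"
      and V: "V = (MAX Q\<in>query_sets N m q. \<Sum>k\<in>Q. (1 - p k) * p k * (c k + e k)\<^sup>2)" for z u p V
  proof -
    have "card (space (m k)) = 2" if "k \<in> {1..N}" for k using two that by simp
    from pair_two[OF this] show ?thesis
      unfolding T_def using two by (intro tail_two_values[OF tm t _ _ _ _ _ _ C V]) auto
  qed
  show "T \<le> exp_neg_quot (t\<^sup>2) (2 * V + 2 * C * t / 3)"
    if at: "\<And>k. k \<in> {1..N} \<Longrightarrow> 0 \<le> p k \<and> p k < 1 \<and>
        (\<exists>\<eta>\<in>space (m k). {\<eta>} \<in> sets (m k) \<and> 1 - p k \<le> measure P {y\<in>space P. y k = \<eta>})"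
      and V: "V = (MAX Q\<in>query_sets N m q. \<Sum>k\<in>Q. p k * (c k + e k / (1 - p k))\<^sup>2)" for p V
  proof -
    from at have "\<forall>k\<in>{1..N}. \<exists>\<eta>. \<eta> \<in> space (m k) \<and> {\<eta>} \<in> sets (m k) \<and> 1 - p k \<le> measure P {y\<in>space P. y k = \<eta>}"
      by blast
    then obtain \<eta> where \<eta>: "\<forall>k\<in>{1..N}. \<eta> k \<in> space (m k) \<and> {\<eta> k} \<in> sets (m k) \<and> 1 - p k \<le> measure P {y\<in>space P. y k = \<eta> k}"
      by (rule bchoice[THEN exE])
    have pair: "\<bar>incr i x y - incr i x y'\<bar> \<le> c (q (Suc i) x) + e (q (Suc i) x) / (1 - p (q (Suc i) x))"
      if h: "x \<in> typical \<gamma> \<Gamma>" "i < N" "fresh i x" "y \<in> region" "y' \<in> region"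
        "y (q (Suc i) x) \<noteq> y' (q (Suc i) x)" "y' (q (Suc i) x) = \<eta> (q (Suc i) x)" for x i y y'
      using Lip
    proof
      note s = safe[OF h(1-3)]
      assume o: ?one
      have "p (q (Suc i) x) < 1" using at[OF s(2)] by blast
      then show ?thesis
        unfolding one(2)[OF o s(2)] using \<eta> s(2) h(7)
        by (intro pair_one_atom[OF \<Gamma> _ h(2,3) s(3) refl cd[OF s(2)] one(1)[OF o s(2)] h(4-6)])
          (auto simp: reg s(1))
    next
      note s = safe[OF h(1-3)]
      assume ?both
      note pair_both'[OF this h(1-6)]
      \<comment> \<open>Pairs already obey the bound with \<open>e\<close>. Dividing a nonnegative
        \<open>e\<close> by \<open>1 - p\<close> can only increase it, so the common form of the
        variance covers this case.\<close>
      also have "e (q (Suc i) x) \<le> e (q (Suc i) x) / (1 - p (q (Suc i) x))"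
        using e0[OF s(2)] at[OF s(2)] by (simp add: divide_simps mult_left_le)
      finally show ?thesis by simp
    qed
    show ?thesis
      unfolding T_def using \<eta> by (intro tail_atom[OF tm t alt reg _ _ _ pair C V]) auto
  qed
qed

end

section \<open>Differences controlled only on a box\<close>

context query_process begin

text \<open>The martingale is run under the law conditioned on the box, but \<open>typical\<close>
  remains the event of the original law, for which the probability of the complement was bounded.
  This is consistent because conditioning only lowers the probability of leaving \<Gamma>, so a
  history safe for the original law is safe for the new one.\<close>

lemma conditioned_tails:
  assumes \<Gamma>: "\<Gamma> \<in> sets P" and \<gamma>: "0 < \<gamma>"
    and G: "\<And>k. k \<in> {1..N} \<Longrightarrow> G k \<in> sets (m k)" and sub: "\<Gamma> \<subseteq> PiE {1..N} G"
    and cd: "\<And>k. k \<in> {1..N} \<Longrightarrow> c k \<le> d k"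
    and Lip: "\<And>k x y. k \<in> {1..N} \<Longrightarrow> x \<in> PiE {1..N} G \<Longrightarrow> y \<in> PiE {1..N} G \<Longrightarrow> differ_only_in N k x y \<Longrightarrow>
      \<bar>f x - f y\<bar> \<le> (if x \<in> \<Gamma> then c k else d k)"
    and range: "\<And>x y. x \<in> space P \<Longrightarrow> y \<in> space P \<Longrightarrow> \<bar>f x - f y\<bar> \<le> s"
    and e: "\<And>k. k \<in> {1..N} \<Longrightarrow> e k = \<gamma> * (d k - c k)"
    and \<Delta>: "\<Delta> = s * measure P (space P - \<Gamma>) \<or> \<Delta> = 0 \<and>
      (\<forall>k\<in>{1..N}. \<forall>x\<in>space P. \<forall>y\<in>space P.
         differ_only_in N k x y \<and> x k \<in> space (m k) - G k \<and> y k \<in> G k \<longrightarrow> f y \<le> f x)"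
    and t: "0 \<le> t"
  shows "measure P {x\<in>typical \<gamma> \<Gamma>. integral\<^sup>L P f + t + \<Delta> \<le> f x}
      \<le> exp_neg_quot (t\<^sup>2) (2 * (MAX Q\<in>query_sets N m q. \<Sum>k\<in>Q. (c k + e k)\<^sup>2))"
    and "\<Gamma> = PiE {1..N} G \<Longrightarrow> measure P {x\<in>\<Gamma>. integral\<^sup>L P f + t + \<Delta> \<le> f x}
      \<le> exp_neg_quot (4 * t\<^sup>2) (2 * (MAX Q\<in>query_sets N m q. \<Sum>k\<in>Q. (c k)\<^sup>2))"
proof -
  let ?R = "PiE {1..N} G"
  have R: "?R \<in> sets P" using G by (intro sets_PiM_I_finite) auto
  have out: "x \<notin> ?R" if "j \<in> {1..N}" "x j \<notin> G j" for x j using that PiE_mem by metis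
  have Rsp: "x \<in> ?R \<Longrightarrow> x \<in> space P" for x using sets.sets_into_space[OF R] by blast
  obtain x0 where x0: "x0 \<in> space P" using P.not_empty by blast
  have s0: "0 \<le> s" using range[OF x0 x0] by simp
  have bf: "bdd f"
  proof (rule bddI[OF f_measurable])
    show "\<bar>f x\<bar> \<le> \<bar>f x0\<bar> + s" if "x \<in> space P" for x using range[OF that x0] by linarith
  qed
  have tail_sets: "{x\<in>E. a \<le> f x} \<in> sets P" if "E \<in> sets P" for E a
  proof -
    have "{x\<in>E. a \<le> f x} = E \<inter> {x\<in>space P. a \<le> f x}" using sets.sets_into_space[OF that] by blast
    also have "\<dots> \<in> sets P" using that by (intro sets.Int) simp_all
    finally show ?thesis .
  qed
  have "measure P {x\<in>typical \<gamma> \<Gamma>. integral\<^sup>L P f + t + \<Delta> \<le> f x}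
      \<le> exp_neg_quot (t\<^sup>2) (2 * (MAX Q\<in>query_sets N m q. \<Sum>k\<in>Q. (c k + e k)\<^sup>2)) \<and>
    (\<Gamma> = ?R \<longrightarrow> measure P {x\<in>\<Gamma>. integral\<^sup>L P f + t + \<Delta> \<le> f x}
      \<le> exp_neg_quot (4 * t\<^sup>2) (2 * (MAX Q\<in>query_sets N m q. \<Sum>k\<in>Q. (c k)\<^sup>2)))"
  proof (cases "\<exists>k\<in>{1..N}. emeasure (m k) (G k) = 0")
    \<comment> \<open>Conditioning is impossible if some \<open>G k\<close> is null, but then the
      whole box is null and both tail probabilities are 0.\<close>
    case True
    then have "emeasure P ?R = 0" using G by (subst measure_times) (auto simp: prod_zero_iff)
    then have "measure P ?R = 0" by (simp add: measure_def)
    then have null: "measure P F = 0" if "F \<subseteq> ?R" for F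
      using P.finite_measure_mono[OF that R] measure_nonneg[of P F] by simp
    have "{x\<in>typical \<gamma> \<Gamma>. integral\<^sup>L P f + t + \<Delta> \<le> f x} \<subseteq> ?R"
      "{x\<in>\<Gamma>. integral\<^sup>L P f + t + \<Delta> \<le> f x} \<subseteq> ?R"
      using sub typical_subset[of \<gamma> \<Gamma>] by (simp_all only: subset_iff mem_Collect_eq) simp_all
    note this[THEN null]
    then show ?thesis by (simp only: exp_neg_quot_nonneg simp_thms)
  next
    case False
    then have G0: "emeasure (m k) (G k) \<noteq> 0" if "k \<in> {1..N}" for k using that by blast
    define m' where "m' = (\<lambda>j. if j \<in> {1..N} then uniform_measure (m j) (G j) else m j)"
    have sets_m': "sets (m' k) = sets (m k)" for k by (simp add: m'_def)
    have sets_P': "sets (PiM {1..N} m') = sets P" by (intro sets_PiM_cong refl sets_m')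
    have space_P': "space (PiM {1..N} m') = space P" by (rule sets_eq_imp_space_eq[OF sets_P'])
    have meas_P': "measurable (PiM {1..N} m') borel = measurable P (borel :: real measure)"
      by (rule measurable_cong_sets[OF sets_P' refl])
    have G_space: "G k \<subseteq> space (m k)" if "k \<in> {1..N}" for k by (rule sets.sets_into_space[OF G[OF that]])
    have prob': "prob_space (m' k)" for k
      using prob_component uniform_measure_conditions(1)[OF prob_component G G0] by (auto simp: m'_def)
    have strategy': "query_strategy N m' f q" using strategy query_strategy_cong[of N m' m] sets_m' by blast
    interpret Q: query_process m' N f q
    proof (intro query_process.intro index_product.intro query_process_axioms.intro)
      show "f \<in> borel_measurable (PiM {1..N} m')" unfolding meas_P' by (rule f_measurable)
    qed (rule prob' finite_atLeastAtMost N_pos strategy')+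
    have AE_R: "AE z in PiM {1..N} m'. z \<in> ?R"
    proof -
      have "emeasure (PiM {1..N} m') ?R = (\<Prod>k\<in>{1..N}. emeasure (m' k) (G k))"
        using G by (intro Q.measure_times) (simp add: sets_m')
      also have "\<dots> = 1"
        using uniform_measure_conditions(2)[OF prob_component G G0] by (intro prod.neutral) (auto simp: m'_def)
      finally show ?thesis
        using R by (intro Q.P.AE_prob_1) (simp add: measure_def)
    qed
    interpret Q: boxed_query m' N f q G
    proof unfold_locales
      show "G k \<subseteq> space (m' k)" if "k \<in> {1..N}" for k using G_space[OF that] by (simp add: m'_def)
      show "Q.bdd f" using bf unfolding bdd_def Q.bdd_def by (simp add: meas_P' space_P')
    qed (rule AE_R)
    have le: "(\<integral>x. h x \<partial>PiM {1..N} m') \<le> (\<integral>x. h x \<partial>P)"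
      if h: "bdd h" and mono: "\<And>j x y a b. j \<in> {1..N} \<Longrightarrow> x \<in> space P \<Longrightarrow> y \<in> space P \<Longrightarrow>
        x j \<in> space (m j) - G j \<Longrightarrow> y j \<in> G j \<Longrightarrow> (\<And>l. l \<noteq> j \<Longrightarrow> y l = x l) \<Longrightarrow> h y \<le> h x" for h
    proof -
      obtain K where K: "\<And>x. x \<in> space P \<Longrightarrow> \<bar>h x\<bar> \<le> K" using bdd_bound[OF h] by metis
      show ?thesis unfolding m'_def
      proof (rule integral_PiM_uniform_measure_le[OF prob_component _ G G0 bdd_measurable[OF h] K])
        fix j x a b
        assume j: "j \<in> {1..N}" and x: "x \<in> (\<Pi>\<^sub>E j\<in>{1..N}. space (m j))"
          and ab: "a \<in> space (m j) - G j" "b \<in> G j"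
        have "x(j := w) \<in> space P" if "w \<in> space (m j)" for w
          using x j that by (auto simp: space_PiM PiE_iff extensional_def)
        then show "h (x(j := b)) \<le> h (x(j := a))"
          using j ab G_space[OF j] by (intro mono[of j]) auto
      qed auto
    qed
    have F_le: "measure P F \<le> measure (PiM {1..N} m') F" if F: "F \<in> sets P" "F \<subseteq> ?R" for F
    proof -
      \<comment> \<open>The indicator of the complement of \<open>F\<close> has its largest value 1
        off the box, so moving a coordinate into the box cannot increase it. Events inside the box
        thus gain probability.\<close>
      have "(\<integral>x. indicator (space P - F) x \<partial>PiM {1..N} m') \<le> (\<integral>x. indicator (space P - F) x \<partial>P :: real)"
      proof (rule le)
        show "bdd (indicator (space P - F))" using F by (intro bdd_indicator) auto
        fix j x y assume "j \<in> {1..N}" "x \<in> space P" "x j \<in> space (m j) - G j"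
        then have "x \<in> space P - F" using F(2) out[of j x] by blast
        then show "indicator (space P - F) y \<le> (indicator (space P - F) x :: real)"
          by (simp add: indicator_le_1)
      qed
      moreover have "(\<integral>x. indicator (space P - F) x \<partial>P :: real) = 1 - measure P F"
        using F by (simp add: P.prob_compl)
      moreover have "(\<integral>x. indicator (space P - F) x \<partial>PiM {1..N} m' :: real) = 1 - measure (PiM {1..N} m') F"
        using F Q.P.prob_compl[of F] by (simp add: sets_P' space_P')
      ultimately show ?thesis by simp
    qed
    have mean: "(\<integral>x. f x \<partial>PiM {1..N} m') \<le> integral\<^sup>L P f + \<Delta>"
      using \<Delta>
    proof
      assume D: "\<Delta> = s * measure P (space P - \<Gamma>)"
      define S where "S = (SUP y\<in>space P. f y)"
      have bb: "bdd_above (f ` space P)"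
        using range[OF _ x0] by (intro bdd_aboveI2[where M="f x0 + s"]) (smt (verit))
      have S: "f x \<le> S" "S \<le> f x + s" if "x \<in> space P" for x
      proof -
        show "f x \<le> S" unfolding S_def by (rule cSUP_upper[OF that bb])
        show "S \<le> f x + s" unfolding S_def
        proof (rule cSUP_least[OF P.not_empty])
          show "f y \<le> f x + s" if "y \<in> space P" for y using range[OF \<open>x \<in> space P\<close> that] by linarith
        qed
      qed
      \<comment> \<open>\<open>f\<close> need not decrease when a coordinate moves into the box.
        Raising it to its supremum off the box enforces this, changes nothing for the conditioned
        law, and costs at most \<open>s\<close> times the probability of missing \<Gamma>.\<close>
      define h where "h x = f x + (S - f x) * indicator (space P - ?R) x" for x
      have bh: "bdd h" unfolding h_def
        using R by (intro bdd_add bdd_mult bdd_diff bdd_const bf bdd_indicator) auto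
      have h_in: "h x = f x" if "x \<in> ?R" for x using that by (simp add: h_def)
      have h_out: "h x = S" if "x \<in> space P" "x \<notin> ?R" for x using that by (simp add: h_def)
      have "(\<integral>x. f x \<partial>PiM {1..N} m') = (\<integral>x. h x \<partial>PiM {1..N} m')"
      proof (rule integral_cong_AE)
        show "AE x in PiM {1..N} m'. f x = h x" using AE_R by eventually_elim (simp add: h_in)
      qed (use bdd_measurable[OF bh] f_measurable in \<open>auto simp: meas_P'\<close>)
      also have "\<dots> \<le> (\<integral>x. h x \<partial>P)"
      proof (rule le[OF bh])
        fix j x y assume a: "j \<in> {1..N}" "x \<in> space P" "y \<in> space P" "x j \<in> space (m j) - G j"
        then have "h x = S" using out[of j x] by (intro h_out) blast+
        moreover have "h y \<le> S" using S(1)[OF a(3)] h_in[of y] h_out[OF a(3)] by (cases "y \<in> ?R") auto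
        ultimately show "h y \<le> h x" by simp
      qed
      also have "\<dots> \<le> (\<integral>x. f x + s * indicator (space P - \<Gamma>) x \<partial>P)"
      proof (rule integral_mono)
        show "integrable P h" by (rule bdd_integrable[OF bh])
        show "integrable P (\<lambda>x. f x + s * indicator (space P - \<Gamma>) x)"
          using \<Gamma> by (intro bdd_integrable bdd_add bdd_mult bdd_const bf bdd_indicator) auto
        fix x assume x: "x \<in> space P"
        show "h x \<le> f x + s * indicator (space P - \<Gamma>) x"
          using x S(2)[OF x] s0 sub h_in[of x] h_out[OF x] by (cases "x \<in> ?R") (auto split: split_indicator)
      qed
      also have "\<dots> = integral\<^sup>L P f + \<Delta>"
        using \<Gamma> bdd_integrable[OF bf] bdd_integrable[OF bdd_indicator[of "space P - \<Gamma>"]] by (simp add: D)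
      finally show ?thesis .
    next
      assume D: "\<Delta> = 0 \<and> (\<forall>k\<in>{1..N}. \<forall>x\<in>space P. \<forall>y\<in>space P.
         differ_only_in N k x y \<and> x k \<in> space (m k) - G k \<and> y k \<in> G k \<longrightarrow> f y \<le> f x)"
      have "(\<integral>x. f x \<partial>PiM {1..N} m') \<le> (\<integral>x. f x \<partial>P)"
      proof (rule le[OF bf])
        fix j x y assume a: "j \<in> {1..N}" "x \<in> space P" "y \<in> space P" "x j \<in> space (m j) - G j" "y j \<in> G j"
          "\<And>l. l \<noteq> j \<Longrightarrow> y l = x l"
        then have "differ_only_in N j x y" by (auto simp: differ_only_in_def)
        with D a show "f y \<le> f x" by blast
      qed
      then show ?thesis using D by simp
    qed
    have cexp_le: "Q.cexp A (indicator (space P - \<Gamma>)) x \<le> cexp A (indicator (space P - \<Gamma>)) x"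
      if x: "x \<in> ?R" for A x
      unfolding cexp_def Q.cexp_def
    proof (rule le)
      have W: "bdd (indicator (space P - \<Gamma>))" using \<Gamma> by (intro bdd_indicator) auto
      show "bdd (\<lambda>y. indicator (space P - \<Gamma>) (mix A x y))" by (rule bdd_mix[OF W Rsp[OF x]])
      fix j y y' assume a: "j \<in> {1..N}" "y \<in> space P" "y' \<in> space P" "y j \<in> space (m j) - G j"
        "\<And>l. l \<noteq> j \<Longrightarrow> y' l = y l"
      show "indicator (space P - \<Gamma>) (mix A x y') \<le> (indicator (space P - \<Gamma>) (mix A x y) :: real)"
      \<comment> \<open>Coordinates in \<open>A\<close> are overwritten by \<open>x\<close>. Any
        other coordinate outside \<open>G j\<close> takes the mixed point out of the box, hence out
        of \<Gamma>, where the indicator is already 1.\<close>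
      proof (cases "j \<in> A")
        case True
        then have "mix A x y' = mix A x y" using a(5) unfolding mix_def fun_eq_iff by metis
        then show ?thesis by simp
      next
        case False
        then have "mix A x y j \<notin> G j" using a(4) by (simp add: mix_def)
        then have "mix A x y \<in> space P - \<Gamma>" using sub out[OF a(1)] mix_in_space[OF Rsp[OF x] a(2)] by blast
        then show ?thesis by (simp add: indicator_le_1)
      qed
    qed
    have qs: "query_sets N m' q = query_sets N m q" by (rule query_sets_cong) (rule sets_m')
    have transfer: "measure P {x\<in>E. integral\<^sup>L P f + t + \<Delta> \<le> f x}
        \<le> measure (PiM {1..N} m') {x\<in>E. integral\<^sup>L (PiM {1..N} m') f + t \<le> f x}"
      if E: "E \<in> sets P" "E \<subseteq> ?R" for E
    proof -
      have "measure P {x\<in>E. integral\<^sup>L P f + t + \<Delta> \<le> f x}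
          \<le> measure P {x\<in>E. integral\<^sup>L (PiM {1..N} m') f + t \<le> f x}"
        using mean by (intro P.finite_measure_mono tail_sets E) auto
      also have "\<dots> \<le> measure (PiM {1..N} m') {x\<in>E. integral\<^sup>L (PiM {1..N} m') f + t \<le> f x}"
        using E by (intro F_le tail_sets) auto
      finally show ?thesis .
    qed
    have tR: "typical \<gamma> \<Gamma> \<subseteq> ?R" using sub typical_subset[of \<gamma> \<Gamma>] by blast
    note tm = typical_measurable[OF \<Gamma>, of \<gamma>]
    have "measure P {x\<in>typical \<gamma> \<Gamma>. integral\<^sup>L P f + t + \<Delta> \<le> f x}
        \<le> exp_neg_quot (t\<^sup>2) (2 * (MAX Q\<in>query_sets N m' q. \<Sum>k\<in>Q. (c k + e k)\<^sup>2))"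
    proof (rule order_trans[OF transfer[OF tm tR] Q.tail_abs[OF _ t]])
      show "typical \<gamma> \<Gamma> \<in> sets (PiM {1..N} m')" using tm by (simp add: sets_P')
      fix x i y assume x: "x \<in> typical \<gamma> \<Gamma>" "i < N" "fresh i x" and y: "y \<in> ?R"
      let ?k = "q (Suc i) x"
      have xR: "x \<in> ?R" using x(1) tR by blast
      have k: "?k \<in> {1..N}" using q_range[OF Rsp[OF xR], of "Suc i"] x(2) by auto
      show "Q.incr i x y = 0 \<or> \<bar>Q.incr i x y\<bar> \<le> c ?k + e ?k"
        unfolding e[OF k]
      proof (rule Q.incr_bound_one[OF _ xR x(2,3) _ refl cd[OF k] _ y, where \<Gamma>=\<Gamma>])
        show "\<Gamma> \<in> sets (PiM {1..N} m')" using \<Gamma> by (simp add: sets_P')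
        have "cexp (exposed i x) (indicator (space P - \<Gamma>)) x \<le> \<gamma>" using x by (simp add: typical_def)
        then show "Q.cexp (exposed i x) (indicator (space (PiM {1..N} m') - \<Gamma>)) x \<le> \<gamma>"
          unfolding space_P' using cexp_le[OF xR, of "exposed i x"] by linarith
        show "Q.lipschitz_one \<Gamma> ?k (c ?k) (d ?k)" using Lip[OF k] by (simp add: Q.lipschitz_one_def)
      qed
    qed
    moreover have "measure P {x\<in>\<Gamma>. integral\<^sup>L P f + t + \<Delta> \<le> f x}
        \<le> exp_neg_quot (4 * t\<^sup>2) (2 * (MAX Q\<in>query_sets N m' q. \<Sum>k\<in>Q. (c k)\<^sup>2))" if eq: "\<Gamma> = ?R"
    proof (rule order_trans[OF transfer[OF \<Gamma> sub] Q.tail_oscillation[OF _ t]])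
      show "\<Gamma> \<in> sets (PiM {1..N} m')" using \<Gamma> by (simp add: sets_P')
      fix x i y y' assume x: "x \<in> \<Gamma>" "i < N" "fresh i x" and y: "y \<in> ?R" "y' \<in> ?R"
        "y (q (Suc i) x) \<noteq> y' (q (Suc i) x)"
      let ?k = "q (Suc i) x"
      have xR: "x \<in> ?R" using x(1) eq by blast
      have k: "?k \<in> {1..N}" using q_range[OF Rsp[OF xR], of "Suc i"] x(2) by auto
      \<comment> \<open>On the full box \<open>c\<close> holds for every pair, so the conditioned
        law is in the unrestricted case with risk 0. No history has to be safe, and all of \<Gamma>
        is good.\<close>
      have "\<bar>Q.incr i x y - Q.incr i x y'\<bar>
          \<le> c ?k + (c ?k - c ?k) * Q.risk (space (PiM {1..N} m')) i x y'"
      proof (rule Q.incr_diff_le_one[OF _ xR x(2,3) _ refl order_refl _ y, where \<gamma>=0])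
        show "Q.lipschitz_one (space (PiM {1..N} m')) ?k (c ?k) (c ?k)"
          unfolding Q.lipschitz_one_def using Lip[OF k] eq by auto
      qed (auto simp: Q.cexp_def)
      then show "\<bar>Q.incr i x y - Q.incr i x y'\<bar> \<le> c ?k" by simp
    qed
    ultimately show ?thesis unfolding qs by blast
  qed
  then show "measure P {x\<in>typical \<gamma> \<Gamma>. integral\<^sup>L P f + t + \<Delta> \<le> f x}
      \<le> exp_neg_quot (t\<^sup>2) (2 * (MAX Q\<in>query_sets N m q. \<Sum>k\<in>Q. (c k + e k)\<^sup>2))"
    and "\<Gamma> = ?R \<Longrightarrow> measure P {x\<in>\<Gamma>. integral\<^sup>L P f + t + \<Delta> \<le> f x}
      \<le> exp_neg_quot (4 * t\<^sup>2) (2 * (MAX Q\<in>query_sets N m q. \<Sum>k\<in>Q. (c k)\<^sup>2))"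
    by blast+
qed

lemma one_le_Max_card:
  fixes \<gamma> :: real
  assumes "0 < \<gamma>" "\<gamma> \<le> 1"
  shows "1 \<le> (MAX Q\<in>query_sets N m q. \<Sum>k\<in>Q. 1 / \<gamma>)"
proof -
  obtain x where x: "x \<in> space P" using P.not_empty by blast
  have "q 1 x \<in> exposed N x" using N_pos by (auto simp: exposed_def)
  then have "1 / \<gamma> \<le> (\<Sum>k\<in>exposed N x. 1 / \<gamma>)"
    using assms finite_exposed member_le_sum[of "q 1 x" "exposed N x" "\<lambda>_. 1 / \<gamma>"] by simp
  also have "\<dots> \<le> (MAX Q\<in>query_sets N m q. \<Sum>k\<in>Q. 1 / \<gamma>)" by (rule sum_le_Max[OF x])
  finally show ?thesis using assms by (simp add: order_trans[of 1 "1 / \<gamma>"])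
qed

end

section \<open>Transfer from the random variables to their product law\<close>

theorem theorem13:
  fixes M :: "'w measure" and N :: nat and \<Lambda> :: "nat \<Rightarrow> 'a measure"
    and X :: "nat \<Rightarrow> 'w \<Rightarrow> 'a" and f :: "(nat \<Rightarrow> 'a) \<Rightarrow> real"
    and q :: "nat \<Rightarrow> (nat \<Rightarrow> 'a) \<Rightarrow> nat" and \<gamma> :: real
    and Xv :: "'w \<Rightarrow> nat \<Rightarrow> 'a" and \<mu> :: real and QQ :: "nat set set"
    and \<Omega> :: "(nat \<Rightarrow> 'a) set"
  assumes "prob_space M" and "N \<ge> 1"
    and "prob_space.indep_vars M \<Lambda> X {1..N}"
    and "f \<in> borel_measurable (PiM {1..N} \<Lambda>)"
    and "query_strategy N \<Lambda> f q"
    and "0 < \<gamma>" and "\<gamma> \<le> 1"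
  defines "\<Omega> \<equiv> outcomes N \<Lambda>"
    and "Xv \<equiv> \<lambda>\<omega>. \<lambda>k\<in>{1..N}. X k \<omega>"
    and "\<mu> \<equiv> LINT \<omega>|M. f (Xv \<omega>)"
    and "QQ \<equiv> query_sets N \<Lambda> q"
  shows
    "\<comment> \<open>(1)\<close>
     (\<forall>c :: nat \<Rightarrow> real.
       (\<forall>k\<in>{1..N}. \<forall>x\<in>\<Omega>. \<forall>y\<in>\<Omega>. differ_only_in N k x y \<longrightarrow> \<bar>f x - f y\<bar> \<le> c k) \<longrightarrow>
       (\<forall>t\<ge>0.
          \<comment> \<open>(1a)\<close>
          \<P>(\<omega> in M. f (Xv \<omega>) \<ge> \<mu> + t)
            \<le> exp_neg_quot (2 * t\<^sup>2) (MAX Q\<in>QQ. \<Sum>k\<in>Q. (c k)\<^sup>2) \<and>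
          \<comment> \<open>(1b); the two points z and u play the roles of 0 and 1\<close>
          (\<forall>z u (p :: nat \<Rightarrow> real) V C.
             z \<noteq> u \<and>
             (\<forall>k\<in>{1..N}. space (\<Lambda> k) = {z, u} \<and> {u} \<in> sets (\<Lambda> k) \<and>
                         p k = \<P>(\<omega> in M. X k \<omega> = u)) \<and>
             C = (MAX Q\<in>QQ. MAX k\<in>Q. c k) \<and>
             V = (MAX Q\<in>QQ. \<Sum>k\<in>Q. (1 - p k) * p k * (c k)\<^sup>2) \<longrightarrow>
             \<P>(\<omega> in M. f (Xv \<omega>) \<ge> \<mu> + t) \<le> exp_neg_quot (t\<^sup>2) (2 * V + 2 * C * t / 3) \<and>
             (V > 0 \<and> C > 0 \<longrightarrow>
              \<P>(\<omega> in M. f (Xv \<omega>) \<ge> \<mu> + t) \<le> exp (- (V / C\<^sup>2 * phi (C * t / V))))) \<and>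
          \<comment> \<open>(1c)\<close>
          (\<forall>(p :: nat \<Rightarrow> real) V' C.
             (\<forall>k\<in>{1..N}. \<exists>\<eta>\<in>space (\<Lambda> k). {\<eta>} \<in> sets (\<Lambda> k) \<and>
                         \<P>(\<omega> in M. X k \<omega> = \<eta>) \<ge> 1 - p k) \<and>
             C = (MAX Q\<in>QQ. MAX k\<in>Q. c k) \<and>
             V' = (MAX Q\<in>QQ. \<Sum>k\<in>Q. p k * (c k)\<^sup>2) \<longrightarrow>
             \<P>(\<omega> in M. f (Xv \<omega>) \<ge> \<mu> + t) \<le> exp_neg_quot (t\<^sup>2) (2 * V' + 2 * C * t / 3)))) \<and>
     \<comment> \<open>(2)\<close>
     (\<forall>\<Gamma>\<in>sets (PiM {1..N} \<Lambda>). \<exists>B\<in>sets (PiM {1..N} \<Lambda>).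
       \<P>(\<omega> in M. Xv \<omega> \<in> B) \<le> (MAX Q\<in>QQ. \<Sum>k\<in>Q. 1 / \<gamma>) * \<P>(\<omega> in M. Xv \<omega> \<notin> \<Gamma>) \<and>
       \<Omega> - B \<subseteq> \<Gamma> \<and>
       (\<forall>(c :: nat \<Rightarrow> real) (d :: nat \<Rightarrow> real) (e :: nat \<Rightarrow> real) C.
          (\<forall>k\<in>{1..N}. c k \<le> d k) \<and>
          (\<comment> \<open>(i)\<close>
           (\<forall>k\<in>{1..N}.
              (\<forall>x\<in>\<Omega>. \<forall>y\<in>\<Omega>. differ_only_in N k x y \<longrightarrow>
                 \<bar>f x - f y\<bar> \<le> (if x \<in> \<Gamma> then c k else d k)) \<and>
              e k = \<gamma> * (d k - c k)) \<or>
           \<comment> \<open>(ii)\<close>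
           (\<exists>r :: nat \<Rightarrow> real. \<forall>k\<in>{1..N}.
              (\<forall>x\<in>\<Omega>. \<forall>y\<in>\<Omega>. differ_only_in N k x y \<longrightarrow>
                 \<bar>f x - f y\<bar> \<le> (if x \<in> \<Gamma> \<and> y \<in> \<Gamma> then c k else d k)) \<and>
              r k > 0 \<and>
              (\<forall>\<eta>\<in>space (\<Lambda> k). {\<eta>} \<in> sets (\<Lambda> k) \<and> \<P>(\<omega> in M. X k \<omega> = \<eta>) \<ge> r k) \<and>
              e k = 2 * \<gamma> * (d k - c k) / r k)) \<and>
          C = (MAX Q\<in>QQ. MAX k\<in>Q. c k + e k) \<longrightarrow>
          (\<forall>t\<ge>0.
             \<comment> \<open>(2a)\<close>
             \<P>(\<omega> in M. f (Xv \<omega>) \<ge> \<mu> + t \<and> Xv \<omega> \<notin> B)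
               \<le> exp_neg_quot (t\<^sup>2) (2 * (MAX Q\<in>QQ. \<Sum>k\<in>Q. (c k + e k)\<^sup>2)) \<and>
             ((\<forall>k\<in>{1..N}. card (space (\<Lambda> k)) = 2) \<longrightarrow>
              \<P>(\<omega> in M. f (Xv \<omega>) \<ge> \<mu> + t \<and> Xv \<omega> \<notin> B)
                \<le> exp_neg_quot (4 * t\<^sup>2) (2 * (MAX Q\<in>QQ. \<Sum>k\<in>Q. (c k + e k)\<^sup>2))) \<and>
             \<comment> \<open>(2b)\<close>
             (\<forall>z u (p :: nat \<Rightarrow> real) V.
                z \<noteq> u \<and>
                (\<forall>k\<in>{1..N}. space (\<Lambda> k) = {z, u} \<and> {u} \<in> sets (\<Lambda> k) \<and>
                            p k = \<P>(\<omega> in M. X k \<omega> = u)) \<and>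
                V = (MAX Q\<in>QQ. \<Sum>k\<in>Q. (1 - p k) * p k * (c k + e k)\<^sup>2) \<longrightarrow>
                \<P>(\<omega> in M. f (Xv \<omega>) \<ge> \<mu> + t \<and> Xv \<omega> \<notin> B)
                  \<le> exp_neg_quot (t\<^sup>2) (2 * V + 2 * C * t / 3) \<and>
                (V > 0 \<and> C > 0 \<longrightarrow>
                 \<P>(\<omega> in M. f (Xv \<omega>) \<ge> \<mu> + t \<and> Xv \<omega> \<notin> B)
                   \<le> exp (- (V / C\<^sup>2 * phi (C * t / V))))) \<and>
             \<comment> \<open>(2c)\<close>
             (\<forall>(p :: nat \<Rightarrow> real) V'.
                (\<forall>k\<in>{1..N}. 0 \<le> p k \<and> p k < 1 \<and>
                   (\<exists>\<eta>\<in>space (\<Lambda> k). {\<eta>} \<in> sets (\<Lambda> k) \<and>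
                      \<P>(\<omega> in M. X k \<omega> = \<eta>) \<ge> 1 - p k)) \<and>
                V' = (MAX Q\<in>QQ. \<Sum>k\<in>Q. p k * (c k + e k / (1 - p k))\<^sup>2) \<longrightarrow>
                \<P>(\<omega> in M. f (Xv \<omega>) \<ge> \<mu> + t \<and> Xv \<omega> \<notin> B)
                  \<le> exp_neg_quot (t\<^sup>2) (2 * V' + 2 * C * t / 3))))) \<and>
     \<comment> \<open>(3)\<close>
     (\<forall>\<Gamma>\<in>sets (PiM {1..N} \<Lambda>). \<exists>B\<in>sets (PiM {1..N} \<Lambda>).
       \<P>(\<omega> in M. Xv \<omega> \<in> B) \<le> (MAX Q\<in>QQ. \<Sum>k\<in>Q. 1 / \<gamma>) * \<P>(\<omega> in M. Xv \<omega> \<notin> \<Gamma>) \<and>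
       \<Omega> - B \<subseteq> \<Gamma> \<and>
       (\<forall>(G :: nat \<Rightarrow> 'a set) (c :: nat \<Rightarrow> real) (d :: nat \<Rightarrow> real) (e :: nat \<Rightarrow> real) (s :: real) (\<Delta> :: real).
          (\<forall>k\<in>{1..N}. G k \<in> sets (\<Lambda> k)) \<and> \<Gamma> \<subseteq> (\<Pi>\<^sub>E j\<in>{1..N}. G j) \<and>
          (\<forall>k\<in>{1..N}. c k \<le> d k) \<and>
          (\<forall>k\<in>{1..N}. \<forall>x\<in>(\<Pi>\<^sub>E j\<in>{1..N}. G j). \<forall>y\<in>(\<Pi>\<^sub>E j\<in>{1..N}. G j).
             differ_only_in N k x y \<longrightarrow> \<bar>f x - f y\<bar> \<le> (if x \<in> \<Gamma> then c k else d k)) \<and>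
          (\<forall>x\<in>\<Omega>. \<forall>y\<in>\<Omega>. \<bar>f x - f y\<bar> \<le> s) \<and>
          (\<forall>k\<in>{1..N}. e k = \<gamma> * (d k - c k)) \<and>
          (\<Delta> = s * \<P>(\<omega> in M. Xv \<omega> \<notin> \<Gamma>) \<or>
           \<Delta> = 0 \<and>
           (\<forall>k\<in>{1..N}. \<forall>x\<in>\<Omega>. \<forall>y\<in>\<Omega>.
              differ_only_in N k x y \<and> x k \<in> space (\<Lambda> k) - G k \<and> y k \<in> G k \<longrightarrow> f x \<ge> f y)) \<longrightarrow>
          (\<forall>t\<ge>0. \<P>(\<omega> in M. f (Xv \<omega>) \<ge> \<mu> + t + \<Delta> \<and> Xv \<omega> \<notin> B)
             \<le> exp_neg_quot (t\<^sup>2) (2 * (MAX Q\<in>QQ. \<Sum>k\<in>Q. (c k + e k)\<^sup>2))) \<and>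
          \<comment> \<open>if \<open>\<Gamma>\<close> is the whole product: the complement of \<open>\<Gamma>\<close> as bad event, and 0 for \<open>e\<close>\<close>
          (\<Gamma> = (\<Pi>\<^sub>E j\<in>{1..N}. G j) \<longrightarrow>
             \<P>(\<omega> in M. Xv \<omega> \<in> \<Omega> - \<Gamma>)
               \<le> (MAX Q\<in>QQ. \<Sum>k\<in>Q. 1 / \<gamma>) * \<P>(\<omega> in M. Xv \<omega> \<notin> \<Gamma>) \<and>
             (\<forall>t\<ge>0. \<P>(\<omega> in M. f (Xv \<omega>) \<ge> \<mu> + t + \<Delta> \<and> Xv \<omega> \<notin> \<Omega> - \<Gamma>)
                \<le> exp_neg_quot (4 * t\<^sup>2) (2 * (MAX Q\<in>QQ. \<Sum>k\<in>Q. (c k)\<^sup>2))))))"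
proof -
  interpret M: prob_space M by fact
  have X: "X k \<in> measurable M (\<Lambda> k)" if "k \<in> {1..N}" for k
    using assms(3) that by (auto simp: M.indep_vars_def)
  \<comment> \<open>The locale asks for a probability measure at every index, so a point mass is put
    at those outside \<open>{1..N}\<close>.\<close>
  define m where "m = (\<lambda>k. if k \<in> {1..N} then distr M (\<Lambda> k) (X k) else return (count_space UNIV) undefined)"
  have sets_m: "sets (m k) = sets (\<Lambda> k)" if "k \<in> {1..N}" for k using that by (simp add: m_def)
  have space_m: "space (m k) = space (\<Lambda> k)" if "k \<in> {1..N}" for k using that by (simp add: m_def)
  let ?P = "PiM {1..N} m"
  have sets_P: "sets (PiM {1..N} \<Lambda>) = sets ?P" by (intro sets_PiM_cong refl sets_m[symmetric])
  have space_P: "\<Omega> = space ?P"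
    unfolding \<Omega>_def outcomes_def space_PiM by (intro PiE_cong) (simp add: space_m)
  have Xv: "Xv \<in> measurable M (PiM {1..N} \<Lambda>)"
    unfolding Xv_def by (intro measurable_restrict X)
  have law: "distr M (PiM {1..N} \<Lambda>) Xv = ?P"
  proof -
    have "distr M (PiM {1..N} \<Lambda>) Xv = PiM {1..N} (\<lambda>k. distr M (\<Lambda> k) (X k))"
      unfolding Xv_def using assms(2,3) M.indep_vars_iff_distr_eq_PiM'[where I="{1..N}" and M'=\<Lambda> and X=X, OF _ X] by simp
    also have "\<dots> = ?P" by (intro PiM_cong) (simp_all add: m_def)
    finally show ?thesis .
  qed
  interpret Q: query_process m N f q
  proof (intro query_process.intro index_product.intro query_process_axioms.intro)
    show "prob_space (m k)" for k
      using M.prob_space_distr[OF X, of k] by (auto simp: m_def intro: prob_space_return)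
    show "f \<in> borel_measurable ?P" using assms(4) measurable_cong_sets[OF sets_P refl] by blast
    show "query_strategy N m f q" using assms(5) query_strategy_cong[of N m \<Lambda>] sets_m by blast
  qed (use assms(2) in auto)
  have QQ: "query_sets N m q = QQ" unfolding QQ_def by (rule query_sets_cong[OF sets_m])
  have law_prob: "\<P>(\<omega> in M. Xv \<omega> \<in> E) = measure ?P E" if "E \<in> sets ?P" for E
  proof -
    have "measure ?P E = measure M (Xv -` E \<inter> space M)"
      unfolding law[symmetric] using that Xv sets_P by (intro measure_distr) auto
    also have "Xv -` E \<inter> space M = {\<omega> \<in> space M. Xv \<omega> \<in> E}" by auto
    finally show ?thesis ..
  qed
  have Xv_space: "Xv \<omega> \<in> \<Omega>" if "\<omega> \<in> space M" for \<omega>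
    using measurable_space[OF Xv that] by (simp add: \<Omega>_def outcomes_def space_PiM)
  have mean: "\<mu> = integral\<^sup>L ?P f"
    unfolding \<mu>_def law[symmetric] using assms(4) Xv by (simp add: integral_distr)
  have tail: "\<P>(\<omega> in M. f (Xv \<omega>) \<ge> a \<and> Xv \<omega> \<notin> \<Omega> - E) = measure ?P {x\<in>E. a \<le> f x}"
    if "E \<in> sets ?P" for E a
  proof -
    have "{x\<in>E. a \<le> f x} = E \<inter> {x\<in>space ?P. a \<le> f x}" using sets.sets_into_space[OF that] by blast
    also have "\<dots> \<in> sets ?P" using that by (intro sets.Int) simp_all
    finally have "measure ?P {x\<in>E. a \<le> f x} = \<P>(\<omega> in M. Xv \<omega> \<in> {x\<in>E. a \<le> f x})"
      by (rule law_prob[symmetric])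
    also have "{\<omega> \<in> space M. Xv \<omega> \<in> {x\<in>E. a \<le> f x}} = {\<omega> \<in> space M. f (Xv \<omega>) \<ge> a \<and> Xv \<omega> \<notin> \<Omega> - E}"
      using Xv_space by blast
    finally show ?thesis ..
  qed
  have tail_all: "\<P>(\<omega> in M. f (Xv \<omega>) \<ge> a) = measure ?P {x\<in>space ?P. a \<le> f x}" for a
    using tail[of "space ?P" a] by (simp add: space_P)
  have outside: "\<P>(\<omega> in M. Xv \<omega> \<notin> \<Gamma>) = measure ?P (space ?P - \<Gamma>)" if "\<Gamma> \<in> sets ?P" for \<Gamma>
  proof -
    have eq: "{\<omega> \<in> space M. Xv \<omega> \<notin> \<Gamma>} = {\<omega> \<in> space M. Xv \<omega> \<in> space ?P - \<Gamma>}"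
      using Xv_space unfolding space_P by blast
    have "space ?P - \<Gamma> \<in> sets ?P" using that by auto
    from law_prob[OF this] show ?thesis unfolding eq .
  qed
  have atom: "\<P>(\<omega> in M. X k \<omega> = \<eta>) = measure ?P {y\<in>space ?P. y k = \<eta>}"
    if "k \<in> {1..N}" "{\<eta>} \<in> sets (\<Lambda> k)" for k \<eta>
  proof -
    have "{y\<in>space ?P. y k = \<eta>} \<in> sets ?P"
      using that by (intro Q.coordinate_atom_sets) (simp_all add: sets_m)
    from law_prob[OF this] have "\<P>(\<omega> in M. Xv \<omega> \<in> {y\<in>space ?P. y k = \<eta>}) = measure ?P {y\<in>space ?P. y k = \<eta>}" .
    moreover have "{\<omega>\<in>space M. X k \<omega> = \<eta>} = {\<omega>\<in>space M. Xv \<omega> \<in> {y\<in>space ?P. y k = \<eta>}}"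
    proof -
      have "Xv \<omega> k = X k \<omega>" for \<omega> using that(1) by (simp add: Xv_def)
      then show ?thesis using Xv_space unfolding space_P by auto
    qed
    ultimately show ?thesis by simp
  qed
  have two: "space (m k) = {z, u} \<and> {u} \<in> sets (m k) \<and> p k = measure ?P {y\<in>space ?P. y k = u}"
    if "\<forall>k\<in>{1..N}. space (\<Lambda> k) = {z, u} \<and> {u} \<in> sets (\<Lambda> k) \<and> p k = \<P>(\<omega> in M. X k \<omega> = u)" "k \<in> {1..N}"
    for z u p k
    using that atom[OF that(2), of u] by (simp add: sets_m space_m)
  have likely: "\<exists>\<eta>\<in>space (m k). {\<eta>} \<in> sets (m k) \<and> 1 - p \<le> measure ?P {y\<in>space ?P. y k = \<eta>}"
    if "\<exists>\<eta>\<in>space (\<Lambda> k). {\<eta>} \<in> sets (\<Lambda> k) \<and> \<P>(\<omega> in M. X k \<omega> = \<eta>) \<ge> 1 - p" "k \<in> {1..N}" for p k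
  proof -
    from that(1) obtain \<eta> where \<eta>: "\<eta> \<in> space (\<Lambda> k)" "{\<eta>} \<in> sets (\<Lambda> k)" "\<P>(\<omega> in M. X k \<omega> = \<eta>) \<ge> 1 - p"
      by blast
    then show ?thesis
      using atom[OF that(2) \<eta>(2)] that(2) by (intro bexI[of _ \<eta>]) (simp_all add: sets_m space_m)
  qed
  \<comment> \<open>The bad event has to be chosen before the constants are given. The complement of
    \<open>Q.typical\<close> qualifies, being built from the law, the strategy, \<Gamma> and
    \<gamma> alone.\<close>
  have typical_set: "Q.typical \<gamma> \<Gamma> \<in> sets ?P" "\<Omega> - Q.typical \<gamma> \<Gamma> \<in> sets (PiM {1..N} \<Lambda>)"
    "\<P>(\<omega> in M. Xv \<omega> \<in> \<Omega> - Q.typical \<gamma> \<Gamma>) \<le> (MAX Q\<in>QQ. \<Sum>k\<in>Q. 1 / \<gamma>) * \<P>(\<omega> in M. Xv \<omega> \<notin> \<Gamma>)"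
    "\<Omega> - (\<Omega> - Q.typical \<gamma> \<Gamma>) \<subseteq> \<Gamma>"
    if "\<Gamma> \<in> sets (PiM {1..N} \<Lambda>)" for \<Gamma>
  proof -
    have \<Gamma>: "\<Gamma> \<in> sets ?P" using that sets_P by simp
    show ty: "Q.typical \<gamma> \<Gamma> \<in> sets ?P" by (rule Q.typical_measurable[OF \<Gamma>])
    then have co: "\<Omega> - Q.typical \<gamma> \<Gamma> \<in> sets ?P" unfolding space_P by auto
    then show "\<Omega> - Q.typical \<gamma> \<Gamma> \<in> sets (PiM {1..N} \<Lambda>)" unfolding sets_P .
    show "\<P>(\<omega> in M. Xv \<omega> \<in> \<Omega> - Q.typical \<gamma> \<Gamma>) \<le> (MAX Q\<in>QQ. \<Sum>k\<in>Q. 1 / \<gamma>) * \<P>(\<omega> in M. Xv \<omega> \<notin> \<Gamma>)"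
      using Q.prob_not_typical[OF \<Gamma> assms(6,7)]
      unfolding law_prob[OF co] outside[OF \<Gamma>] QQ space_P[symmetric] .
    show "\<Omega> - (\<Omega> - Q.typical \<gamma> \<Gamma>) \<subseteq> \<Gamma>" using Q.typical_subset[of \<gamma> \<Gamma>] by blast
  qed
  show ?thesis
  proof (intro conjI allI impI ballI, goal_cases)
    case (1 c t)
    show ?case
      unfolding tail_all mean QQ[symmetric]
      by (rule Q.lipschitz_tails(1)) (use 1 space_P in auto)
  next
    case (2 c t z u p V C)
    show ?case
      unfolding tail_all mean
      by (rule Q.lipschitz_tails(2)[where p=p and c=c and z=z and u=u, THEN conjunct1])
        (use 2 space_P two[of z u p] QQ in auto)
  next
    case (3 c t z u p V C)
    show ?case
      unfolding tail_all mean
      by (rule Q.lipschitz_tails(2)[where p=p and c=c and z=z and u=u, THEN conjunct2, rule_format])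
        (use 3 space_P two[of z u p] QQ in auto)
  next
    case (4 c t p V C)
    show ?case
      unfolding tail_all mean
      by (rule Q.lipschitz_tails(3)[where p=p and c=c])
        (use 4 space_P likely QQ in auto)
  next
    case (5 \<Gamma>)
    note ts = typical_set[OF 5]
    have \<Gamma>: "\<Gamma> \<in> sets ?P" using 5 sets_P by simp
    have hyp: "(\<forall>k\<in>{1..N}. (\<forall>x\<in>space ?P. \<forall>y\<in>space ?P. differ_only_in N k x y \<longrightarrow>
          \<bar>f x - f y\<bar> \<le> (if x \<in> \<Gamma> then c k else d k)) \<and> e k = \<gamma> * (d k - c k)) \<or>
        (\<exists>r. \<forall>k\<in>{1..N}. (\<forall>x\<in>space ?P. \<forall>y\<in>space ?P. differ_only_in N k x y \<longrightarrow>
          \<bar>f x - f y\<bar> \<le> (if x \<in> \<Gamma> \<and> y \<in> \<Gamma> then c k else d k)) \<and> 0 < r k \<and>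
          (\<forall>\<eta>\<in>space (m k). {\<eta>} \<in> sets (m k) \<and> r k \<le> measure ?P {y\<in>space ?P. y k = \<eta>}) \<and>
          e k = 2 * \<gamma> * (d k - c k) / r k)"
      if "(\<forall>k\<in>{1..N}.
              (\<forall>x\<in>\<Omega>. \<forall>y\<in>\<Omega>. differ_only_in N k x y \<longrightarrow>
                 \<bar>f x - f y\<bar> \<le> (if x \<in> \<Gamma> then c k else d k)) \<and>
              e k = \<gamma> * (d k - c k)) \<or>
           (\<exists>r :: nat \<Rightarrow> real. \<forall>k\<in>{1..N}.
              (\<forall>x\<in>\<Omega>. \<forall>y\<in>\<Omega>. differ_only_in N k x y \<longrightarrow>
                 \<bar>f x - f y\<bar> \<le> (if x \<in> \<Gamma> \<and> y \<in> \<Gamma> then c k else d k)) \<and>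
              r k > 0 \<and>
              (\<forall>\<eta>\<in>space (\<Lambda> k). {\<eta>} \<in> sets (\<Lambda> k) \<and> \<P>(\<omega> in M. X k \<omega> = \<eta>) \<ge> r k) \<and>
              e k = 2 * \<gamma> * (d k - c k) / r k)" for c d e
    proof -
      have eq: "(\<forall>\<eta>\<in>space (m k). {\<eta>} \<in> sets (m k) \<and> r k \<le> measure ?P {y\<in>space ?P. y k = \<eta>})
        \<longleftrightarrow> (\<forall>\<eta>\<in>space (\<Lambda> k). {\<eta>} \<in> sets (\<Lambda> k) \<and> \<P>(\<omega> in M. X k \<omega> = \<eta>) \<ge> r k)"
        if "k \<in> {1..N}" for k and r :: "nat \<Rightarrow> real"
        unfolding sets_m[OF that] space_m[OF that] using atom[OF that] by (metis (no_types, lifting))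
      show ?thesis
        using that unfolding space_P
      proof (elim disjE exE, goal_cases)
        case 1
        then show ?case by (rule disjI1)
      next
        case (2 r)
        show ?case
        proof (rule disjI2, rule exI[of _ r], rule ballI, goal_cases)
          case (1 k)
          from bspec[OF 2 1] show ?case unfolding eq[OF 1] .
        qed
      qed
    qed
    show ?case
    proof (intro bexI[OF _ ts(2)] conjI allI impI, goal_cases)
      case 1
      show ?case by (rule ts(3))
    next
      case 2
      show ?case by (rule ts(4))
    next
      case (3 c d e C t)
      have h: "\<And>k. k \<in> {1..N} \<Longrightarrow> c k \<le> d k" "C = (MAX Q\<in>query_sets N m q. MAX k\<in>Q. c k + e k)"
        using 3(1) QQ by blast+
      from 3(1) show ?case
        unfolding tail[OF ts(1)] mean QQ[symmetric]
        by (intro Q.typical_tails(1)[OF \<Gamma> assms(6) h(1) hyp h(2) 3(2)]) blast+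
    next
      case (4 c d e C t)
      have h: "\<And>k. k \<in> {1..N} \<Longrightarrow> c k \<le> d k" "C = (MAX Q\<in>query_sets N m q. MAX k\<in>Q. c k + e k)"
        using 4(1) QQ by blast+
      have c2: "card (space (m k)) = 2" if "k \<in> {1..N}" for k using 4(3) that by (simp add: space_m)
      from 4(1) show ?case
        unfolding tail[OF ts(1)] mean QQ[symmetric]
        by (intro Q.typical_tails(2)[OF \<Gamma> assms(6) h(1) hyp h(2) 4(2) c2]) blast+
    next
      case (5 c d e C t z u p V)
      have h: "\<And>k. k \<in> {1..N} \<Longrightarrow> c k \<le> d k" "C = (MAX Q\<in>query_sets N m q. MAX k\<in>Q. c k + e k)"
        "V = (MAX Q\<in>query_sets N m q. \<Sum>k\<in>Q. (1 - p k) * p k * (c k + e k)\<^sup>2)"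
        using 5(1,3) QQ by blast+
      have p: "z \<noteq> u" "\<forall>k\<in>{1..N}. space (\<Lambda> k) = {z, u} \<and> {u} \<in> sets (\<Lambda> k) \<and> p k = \<P>(\<omega> in M. X k \<omega> = u)"
        using 5(3) by blast+
      from 5(1) show ?case
        unfolding tail[OF ts(1)] mean
        by (intro Q.typical_tails(3)[OF \<Gamma> assms(6) h(1) hyp h(2) 5(2) p(1) two[OF p(2)] h(3), THEN conjunct1]) blast+
    next
      case (6 c d e C t z u p V)
      have h: "\<And>k. k \<in> {1..N} \<Longrightarrow> c k \<le> d k" "C = (MAX Q\<in>query_sets N m q. MAX k\<in>Q. c k + e k)"
        "V = (MAX Q\<in>query_sets N m q. \<Sum>k\<in>Q. (1 - p k) * p k * (c k + e k)\<^sup>2)"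
        using 6(1,3) QQ by blast+
      have p: "z \<noteq> u" "\<forall>k\<in>{1..N}. space (\<Lambda> k) = {z, u} \<and> {u} \<in> sets (\<Lambda> k) \<and> p k = \<P>(\<omega> in M. X k \<omega> = u)"
        using 6(3) by blast+
      from 6(1) show ?case
        unfolding tail[OF ts(1)] mean
        by (intro Q.typical_tails(3)[OF \<Gamma> assms(6) h(1) hyp h(2) 6(2) p(1) two[OF p(2)] h(3),
              THEN conjunct2, THEN mp, OF _ _ _ 6(4)]) blast+
    next
      case (7 c d e C t p V)
      have h: "\<And>k. k \<in> {1..N} \<Longrightarrow> c k \<le> d k" "C = (MAX Q\<in>query_sets N m q. MAX k\<in>Q. c k + e k)"
        "V = (MAX Q\<in>query_sets N m q. \<Sum>k\<in>Q. p k * (c k + e k / (1 - p k))\<^sup>2)"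
        using 7(1,3) QQ by blast+
      have p: "0 \<le> p k \<and> p k < 1 \<and>
          (\<exists>\<eta>\<in>space (m k). {\<eta>} \<in> sets (m k) \<and> 1 - p k \<le> measure ?P {y\<in>space ?P. y k = \<eta>})"
        if "k \<in> {1..N}" for k
        using 7(3) likely[OF _ that, of "p k"] that by blast
      from 7(1) show ?case
        unfolding tail[OF ts(1)] mean
        by (intro Q.typical_tails(4)[OF \<Gamma> assms(6) h(1) hyp h(2) 7(2) p h(3)]) blast+
    qed
  next
    case (6 \<Gamma>)
    note ts = typical_set[OF 6]
    have \<Gamma>: "\<Gamma> \<in> sets ?P" using 6 sets_P by simp
    have co: "\<Omega> - \<Gamma> \<in> sets ?P" using \<Gamma> unfolding space_P by auto
    have tails: "\<P>(\<omega> in M. f (Xv \<omega>) \<ge> \<mu> + t + \<Delta> \<and> Xv \<omega> \<notin> \<Omega> - Q.typical \<gamma> \<Gamma>)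
        \<le> exp_neg_quot (t\<^sup>2) (2 * (MAX Q\<in>QQ. \<Sum>k\<in>Q. (c k + e k)\<^sup>2)) \<and>
      (\<Gamma> = (\<Pi>\<^sub>E j\<in>{1..N}. G j) \<longrightarrow> \<P>(\<omega> in M. f (Xv \<omega>) \<ge> \<mu> + t + \<Delta> \<and> Xv \<omega> \<notin> \<Omega> - \<Gamma>)
                \<le> exp_neg_quot (4 * t\<^sup>2) (2 * (MAX Q\<in>QQ. \<Sum>k\<in>Q. (c k)\<^sup>2)))"
      if h: "(\<forall>k\<in>{1..N}. G k \<in> sets (\<Lambda> k)) \<and> \<Gamma> \<subseteq> (\<Pi>\<^sub>E j\<in>{1..N}. G j) \<and>
          (\<forall>k\<in>{1..N}. c k \<le> d k) \<and>
          (\<forall>k\<in>{1..N}. \<forall>x\<in>(\<Pi>\<^sub>E j\<in>{1..N}. G j). \<forall>y\<in>(\<Pi>\<^sub>E j\<in>{1..N}. G j).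
             differ_only_in N k x y \<longrightarrow> \<bar>f x - f y\<bar> \<le> (if x \<in> \<Gamma> then c k else d k)) \<and>
          (\<forall>x\<in>\<Omega>. \<forall>y\<in>\<Omega>. \<bar>f x - f y\<bar> \<le> s) \<and>
          (\<forall>k\<in>{1..N}. e k = \<gamma> * (d k - c k)) \<and>
          (\<Delta> = s * \<P>(\<omega> in M. Xv \<omega> \<notin> \<Gamma>) \<or>
           \<Delta> = 0 \<and>
           (\<forall>k\<in>{1..N}. \<forall>x\<in>\<Omega>. \<forall>y\<in>\<Omega>.
              differ_only_in N k x y \<and> x k \<in> space (\<Lambda> k) - G k \<and> y k \<in> G k \<longrightarrow> f x \<ge> f y))" and t: "0 \<le> t"
      for G c d e s \<Delta> t
    proof -
      have G: "G k \<in> sets (m k)" if "k \<in> {1..N}" for k using h that sets_m by blast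
      have sub: "\<Gamma> \<subseteq> PiE {1..N} G" using h by blast
      have cd: "c k \<le> d k" if "k \<in> {1..N}" for k using h that by blast
      have Lip: "\<bar>f x - f y\<bar> \<le> (if x \<in> \<Gamma> then c k else d k)"
        if "k \<in> {1..N}" "x \<in> PiE {1..N} G" "y \<in> PiE {1..N} G" "differ_only_in N k x y" for k x y
        using h that by blast
      have range: "\<bar>f x - f y\<bar> \<le> s" if "x \<in> space ?P" "y \<in> space ?P" for x y
        using h that unfolding space_P by blast
      have e: "e k = \<gamma> * (d k - c k)" if "k \<in> {1..N}" for k using h that by blast
      have \<Delta>: "\<Delta> = s * measure ?P (space ?P - \<Gamma>) \<or> \<Delta> = 0 \<and>
        (\<forall>k\<in>{1..N}. \<forall>x\<in>space ?P. \<forall>y\<in>space ?P.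
           differ_only_in N k x y \<and> x k \<in> space (m k) - G k \<and> y k \<in> G k \<longrightarrow> f y \<le> f x)"
      proof -
        have "f y \<le> f x"
          if mono: "\<forall>k\<in>{1..N}. \<forall>x\<in>\<Omega>. \<forall>y\<in>\<Omega>.
              differ_only_in N k x y \<and> x k \<in> space (\<Lambda> k) - G k \<and> y k \<in> G k \<longrightarrow> f x \<ge> f y"
            and k: "k \<in> {1..N}" and xy: "x \<in> space ?P" "y \<in> space ?P"
              "differ_only_in N k x y" "x k \<in> space (m k) - G k" "y k \<in> G k" for k x y
          using mono k xy unfolding space_P space_m[OF k] by blast
        then show ?thesis using h unfolding outside[OF \<Gamma>] by blast
      qed
      show ?thesis
        unfolding tail[OF ts(1)] tail[OF \<Gamma>] mean QQ[symmetric]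
      proof (rule conjI, goal_cases)
        case 1
        show ?case by (rule Q.conditioned_tails(1)[OF \<Gamma> assms(6) G sub cd Lip range e \<Delta> t])
      next
        case 2
        show ?case
          by (rule impI, rule Q.conditioned_tails(2)[OF \<Gamma> assms(6) G sub cd Lip range e \<Delta> t])
      qed
    qed
    show ?case
    proof (intro bexI[OF _ ts(2)] conjI allI impI, goal_cases)
      case 1
      show ?case by (rule ts(3))
    next
      case 2
      show ?case by (rule ts(4))
    next
      case (3 G c d e s \<Delta> t)
      show ?case using tails[OF 3] by blast
    next
      case (4 G c d e s \<Delta>)
      have "1 * measure ?P (space ?P - \<Gamma>)
          \<le> (MAX Q\<in>query_sets N m q. \<Sum>k\<in>Q. 1 / \<gamma>) * measure ?P (space ?P - \<Gamma>)"
        by (intro mult_right_mono Q.one_le_Max_card assms(6,7)) simp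
      then show ?case unfolding law_prob[OF co] outside[OF \<Gamma>] QQ space_P[symmetric] by simp
    next
      case (5 G c d e s \<Delta> t)
      show ?case using tails[OF 5(1,3)] 5(2) by blast
    qed
  qed
qed

end
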